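(* Let $d\ge 1$ and let $X\subseteq\mathbb{T}_{\pm}^d$ be an arbitrary set. Then the following are equivalent: (i) $X$ is an intersection of finitely many closed tropical halfspaces. (ii) There exist two finite sets $V,W\subset\mathbb{T}_{\pm}^d$ such that $\mathrm{conv}_{TC}\bigl(\{v\lhd(\lambda\odot w): v\in V,\ w\in W,\ \lambda\in\mathbb{T}_{\ge\mathbb{O}}\}\bigr)=X$. (iii) There exists a finite collection of polyhedra $\mathbf{P}_1,\dots,\mathbf{P}_m\subset\mathbb{K}^d$ such that $\bigcap_i\mathrm{sval}(\mathbf{P}_i)=X$. (iv) There exists a finite collection of affine halfspaces $\mathbf{H}_1,\dots,\mathbf{H}_m\subseteq\mathbb{K}^d$ such that $\bigcap_i\mathrm{sval}(\mathbf{H}_i)=X$.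
   Context: Signed tropical numbers. Let $\mathbb{O}=-\infty$ be the tropical zero. $\mathbb{T}_{>\mathbb{O}}=\mathbb{R}$ (positive numbers), $\mathbb{T}_{<\mathbb{O}}=\{\ominus r: r\in\mathbb{R}\}$ (negative numbers), $\mathbb{T}_{\ge\mathbb{O}}=\mathbb{R}\cup\{\mathbb{O}\}$, $\mathbb{T}_{\pm}=\mathbb{T}_{>\mathbb{O}}\cup\mathbb{T}_{<\mathbb{O}}\cup\{\mathbb{O}\}$, balanced numbers $\mathbb{T}_{\bullet}=\{\bullet r: r\in\mathbb{R}\}\cup\{\mathbb{O}\}$, symmetrized semiring $\mathbb{S}=\mathbb{T}_{\pm}\cup\mathbb{T}_{\bullet}$. The norm is $|r|=|\ominus r|=|\bullet r|=r$ and $|\mathbb{O}|=\mathbb{O}$; the sign $\mathrm{tsgn}$ takes values in $\{\oplus,\ominus,\bullet,\mathbb{O}\}$. Addition on $\mathbb{S}$: $x\oplus y$ equals $x$ if $|x|>|y|$, $y$ if $|y|>|x|$, $x$ if $|x|=|y|$ and $\mathrm{tsgn}(x)=\mathrm{tsgn}(y)$, and $\bullet|x|$ if $|x|=|y|$ and the signs differ. Multiplication: $x\odot y$ has norm $|x|+|y|$ and sign the product of signs (with $\oplus,\ominus,\bullet$ multiplying like $1,-1,0$); $\mathbb{O}$ is absorbing. The multiplicative unit is the real number $0$. Left sum: for $x,y\in\mathbb{T}_{\pm}$, $x\lhd y=x$ if $|x|=|y|$ and $x\lhd y=x\oplus y$ otherwise; extended componentwise to vectors. Closed tropical halfspaces.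 For $a=(a_0,\dots,a_d)\in\mathbb{T}_{\pm}^{d+1}$ with $(a_1,\dots,a_d)\ne(\mathbb{O},\dots,\mathbb{O})$, $\overline{\mathcal{H}}^+(a)=\{x\in\mathbb{T}_{\pm}^d: a_0\oplus a_1\odot x_1\oplus\dots\oplus a_d\odot x_d\in\mathbb{T}_{>\mathbb{O}}\cup\mathbb{T}_{\bullet}\}$. Finite collections in (i), (iii), (iv) may be empty; an empty intersection is $\mathbb{T}_{\pm}^d$. TC-convexity. For two points $x,y\in\mathbb{T}_{\pm}^d$, $\mathrm{conv}_{TC}(x,y)$ is the intersection of all closed halfspaces $\overline{\mathcal{H}}^+(a)$ containing both. A set $S$ is TC-convex if $\mathrm{conv}_{TC}(x,y)\subseteq S$ for all $x,y\in S$. For $M\subseteq\mathbb{T}_{\pm}^d$, $\mathrm{conv}_{TC}(M)$ is the intersection of all TC-convex sets containing $M$. Puiseux series. $\mathbb{K}$ is the field of generalized real Puiseux series: formal series $\gamma=\sum_i c_it^{\alpha_i}$ with $\alpha_i\in\mathbb{R}$, nonzero $c_i\in\mathbb{R}$, $\alpha_0>\alpha_1>\cdots$, where $(\alpha_i)$ is finite (possibly empty, giving $0$) or unbounded. $\gamma\neq0$ is positive iff $c_0>0$; this makes $\mathbb{K}$ an ordered (real closed) field. An affine halfspace is $\{\mathbf{x}\in\mathbb{K}^d:\mathbf{a}_0+\mathbf{a}_1\mathbf{x}_1+\dots+\mathbf{a}_d\mathbf{x}_d\ge0\}$ with $(\mathbf{a}_1,\dots,\mathbf{a}_d)\ne0$;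 a polyhedron is an intersection of finitely many affine halfspaces. The signed valuation $\mathrm{sval}:\mathbb{K}\to\mathbb{T}_{\pm}$ sends $\gamma$ to $\alpha_0$ if $\gamma>0$, to $\mathbb{O}$ if $\gamma=0$, to $\ominus\alpha_0$ if $\gamma<0$; it is extended componentwise to vectors and to sets by taking images. *)

theory Defs
  imports "HOL-Analysis.Analysis"
begin

section \<open>Symmetrized tropical semiring\<close>

datatype tsign = Plus | Minus | Balanced

instantiation tsign :: times
begin

fun times_tsign :: "tsign \<Rightarrow> tsign \<Rightarrow> tsign" where
  "Balanced * t = Balanced"
| "s * Balanced = Balanced"
| "s * t = (if s = t then Plus else Minus)"

instance ..

end

text \<open>
  The element of norm \<open>r\<close> and sign \<open>s\<close> is \<^term>\<open>TNum s r\<close>, so \<open>TNum Plus r\<close>, \<open>TNum Minus r\<close> and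
  \<open>TNum Balanced r\<close> are the numbers usually written as \<open>r\<close>, \<open>\<ominus>r\<close> and \<open>\<bullet>r\<close>.
  Tropical addition and multiplication are written \<open>+\<close> and \<open>*\<close>. Hence \<open>0\<close> is the tropical zero
  (the element \<open>-\<infinity>\<close>) and \<open>1\<close> is the real number zero.
\<close>

datatype sym_trop = TZero | TNum tsign real

fun tnorm :: "sym_trop \<Rightarrow> ereal" where
  "tnorm TZero = -\<infinity>"
| "tnorm (TNum s r) = ereal r"

instantiation sym_trop :: comm_semiring_1
begin

definition zero_sym_trop :: sym_trop where
  "0 = TZero"

definition one_sym_trop :: sym_trop where
  "1 = TNum Plus 0"

fun plus_sym_trop :: "sym_trop \<Rightarrow> sym_trop \<Rightarrow> sym_trop" where
  "TZero + y = y"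
| "x + TZero = x"
| "TNum s a + TNum t b =
    (if a > b then TNum s a
     else if b > a then TNum t b
     else if s = t then TNum s a
     else TNum Balanced a)"

fun times_sym_trop :: "sym_trop \<Rightarrow> sym_trop \<Rightarrow> sym_trop" where
  "TZero * y = TZero"
| "x * TZero = TZero"
| "TNum s a * TNum t b = TNum (s * t) (a + b)"

instance
proof
  fix a b c :: sym_trop
  have sc: "s * t = t * s" for s t :: tsign
    by (cases s; cases t) auto
  have sa: "s * t * u = s * (t * u)" for s t u :: tsign
    by (cases s; cases t; cases u) auto
  show "a + b + c = a + (b + c)"
    by (cases a; cases b; cases c) auto
  show "a + b = b + a"
    by (cases a; cases b) auto
  show "0 + a = a"
    by (simp add: zero_sym_trop_def)
  show "a * b * c = a * (b * c)"
    by (cases a; cases b; cases c) (auto simp: sa)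
  show "a * b = b * a"
    by (cases a; cases b) (auto simp: sc)
  show "1 * a = a"
  proof (cases a)
    case (TNum s r)
    then show ?thesis by (cases s) (auto simp: one_sym_trop_def)
  qed (simp add: one_sym_trop_def)
  show "(a + b) * c = a * c + b * c"
  proof (cases a)
    case 1: (TNum s r)
    show ?thesis
    proof (cases b)
      case 2: (TNum t q)
      show ?thesis
      proof (cases c)
        case (TNum u p)
        then show ?thesis using 1 2
          by (cases s; cases t; cases u) auto
      qed (auto simp: 1 2)
    qed (cases c, auto simp: 1)
  qed auto
  show "0 * a = 0" "a * 0 = 0"
    by (cases a; simp add: zero_sym_trop_def)+
  show "(0 :: sym_trop) \<noteq> 1"
    by (simp add: zero_sym_trop_def one_sym_trop_def)
qed

end

definition T_pos :: "sym_trop set" where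
  "T_pos = range (TNum Plus)"

definition T_neg :: "sym_trop set" where
  "T_neg = range (TNum Minus)"

definition T_nonneg :: "sym_trop set" where
  "T_nonneg = T_pos \<union> {0}"

definition T_signed :: "sym_trop set" where
  "T_signed = T_pos \<union> T_neg \<union> {0}"

definition T_bal :: "sym_trop set" where
  "T_bal = range (TNum Balanced) \<union> {0}"

definition left_sum :: "sym_trop \<Rightarrow> sym_trop \<Rightarrow> sym_trop" (infixl \<open>\<lhd>\<close> 65) where
  "x \<lhd> y = (if tnorm x = tnorm y then x else x + y)"

section \<open>Tropical halfspaces and TC-convexity\<close>

definition signed_space :: "(sym_trop ^ 'n) set" where
  "signed_space = {x. \<forall>i. x $ i \<in> T_signed}"

definition left_sum_vec :: "sym_trop ^ 'n \<Rightarrow> sym_trop ^ 'n \<Rightarrow> sym_trop ^ 'n" (infixl \<open>\<lhd>\<^sub>v\<close> 65) where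
  "x \<lhd>\<^sub>v y = (\<chi> i. x $ i \<lhd> y $ i)"

definition closed_halfspace :: "sym_trop \<Rightarrow> sym_trop ^ 'n \<Rightarrow> (sym_trop ^ 'n) set" where
  "closed_halfspace a0 a =
    {x \<in> signed_space. a0 + (\<Sum>i\<in>UNIV. a $ i * x $ i) \<in> T_pos \<union> T_bal}"

definition is_closed_halfspace :: "(sym_trop ^ 'n) set \<Rightarrow> bool" where
  "is_closed_halfspace H \<longleftrightarrow>
    (\<exists>a0\<in>T_signed. \<exists>a\<in>signed_space. a \<noteq> 0 \<and> H = closed_halfspace a0 a)"

definition tc_segment :: "sym_trop ^ 'n \<Rightarrow> sym_trop ^ 'n \<Rightarrow> (sym_trop ^ 'n) set" where
  "tc_segment x y = signed_space \<inter> \<Inter>{H. is_closed_halfspace H \<and> x \<in> H \<and> y \<in> H}"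

definition tc_convex :: "(sym_trop ^ 'n) set \<Rightarrow> bool" where
  "tc_convex S \<longleftrightarrow> S \<subseteq> signed_space \<and> (\<forall>x\<in>S. \<forall>y\<in>S. tc_segment x y \<subseteq> S)"

definition tc_hull :: "(sym_trop ^ 'n) set \<Rightarrow> (sym_trop ^ 'n) set" where
  "tc_hull M = \<Inter>{S. tc_convex S \<and> M \<subseteq> S}"

section \<open>Generalized real Puiseux series\<close>

text \<open>
  A series is given by its coefficient function, which sends the \<open>i\<close>-th exponent to the \<open>i\<close>-th
  coefficient and all other reals to \<open>0\<close>. The exponents with nonzero coefficient
  form a strictly decreasing sequence that is finite or unbounded (below) iff only finitely many of
  them lie above any given bound.
\<close>

typedef puiseux = "{f :: real \<Rightarrow> real. \<forall>r. finite {a. r \<le> a \<and> f a \<noteq> 0}}"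
  morphisms pcoeff Abs_puiseux
  by (rule exI[of _ "\<lambda>_. 0"]) simp

setup_lifting type_definition_puiseux

lemma puiseux_eqI: "(\<And>a. pcoeff f a = pcoeff g a) \<Longrightarrow> f = g"
  by (simp add: pcoeff_inject[symmetric] fun_eq_iff)

lemma finite_support: "finite {a. r \<le> a \<and> pcoeff f a \<noteq> 0}"
  using pcoeff[of f] by auto

lemma support_bdd: "\<exists>F. \<forall>a. pcoeff f a \<noteq> 0 \<longrightarrow> a \<le> F"
proof -
  let ?S = "{a. 0 \<le> a \<and> pcoeff f a \<noteq> 0}"
  have "a \<le> Max (insert 0 ?S)" if "pcoeff f a \<noteq> 0" for a
  proof (cases "0 \<le> a")
    case True
    then show ?thesis using that finite_support[of 0 f] by (intro Max_ge) auto
  next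
    case False
    moreover have "0 \<le> Max (insert 0 ?S)" using finite_support[of 0 f] by (intro Max_ge) auto
    ultimately show ?thesis by linarith
  qed
  then show ?thesis by blast
qed

lemma finite_convolution: "finite {a. pcoeff f a \<noteq> 0 \<and> pcoeff g (c - a) \<noteq> 0}"
proof -
  obtain G where G: "\<And>a. pcoeff g a \<noteq> 0 \<Longrightarrow> a \<le> G" using support_bdd by blast
  show ?thesis
    by (rule finite_subset[OF _ finite_support[of "c - G" f]]) (use G in force)
qed

instantiation puiseux :: "{zero, one, plus, minus, uminus, times}"
begin

lift_definition zero_puiseux :: puiseux is "\<lambda>_. 0" by simp

lift_definition one_puiseux :: puiseux is "\<lambda>a. if a = 0 then 1 else 0"
  by (rule finite_subset[of _ "{0}"]) auto

lift_definition plus_puiseux :: "puiseux \<Rightarrow> puiseux \<Rightarrow> puiseux" is "\<lambda>f g a. f a + g a"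
  subgoal for f g r
    by (rule finite_subset[of _ "{a. r \<le> a \<and> f a \<noteq> 0} \<union> {a. r \<le> a \<and> g a \<noteq> 0}"]) auto
  done

lift_definition minus_puiseux :: "puiseux \<Rightarrow> puiseux \<Rightarrow> puiseux" is "\<lambda>f g a. f a - g a"
  subgoal for f g r
    by (rule finite_subset[of _ "{a. r \<le> a \<and> f a \<noteq> 0} \<union> {a. r \<le> a \<and> g a \<noteq> 0}"]) auto
  done

lift_definition uminus_puiseux :: "puiseux \<Rightarrow> puiseux" is "\<lambda>f a. - f a" by simp

lemma finite_support_times:
  "finite {c. r \<le> c \<and>
    (\<Sum>a | pcoeff f a \<noteq> 0 \<and> pcoeff g (c - a) \<noteq> 0. pcoeff f a * pcoeff g (c - a)) \<noteq> 0}"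
proof -
  obtain F where F: "\<And>a. pcoeff f a \<noteq> 0 \<Longrightarrow> a \<le> F" using support_bdd by blast
  obtain G where G: "\<And>a. pcoeff g a \<noteq> 0 \<Longrightarrow> a \<le> G" using support_bdd by blast
  let ?P = "{a. r - G \<le> a \<and> pcoeff f a \<noteq> 0} \<times> {b. r - F \<le> b \<and> pcoeff g b \<noteq> 0}"
  have "finite ((\<lambda>(a, b). a + b) ` ?P)"
    by (intro finite_imageI finite_cartesian_product finite_support)
  then show ?thesis
  proof (rule rev_finite_subset, intro subsetI)
    fix c
    assume "c \<in> {c. r \<le> c \<and>
      (\<Sum>a | pcoeff f a \<noteq> 0 \<and> pcoeff g (c - a) \<noteq> 0. pcoeff f a * pcoeff g (c - a)) \<noteq> 0}"
    then have "(\<Sum>a | pcoeff f a \<noteq> 0 \<and> pcoeff g (c - a) \<noteq> 0. pcoeff f a * pcoeff g (c - a)) \<noteq> 0"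
      and rc: "r \<le> c"
      by auto
    from this(1) obtain a where a: "pcoeff f a \<noteq> 0" "pcoeff g (c - a) \<noteq> 0"
      by (rule sum.not_neutral_contains_not_neutral) auto
    show "c \<in> (\<lambda>(a, b). a + b) ` ?P"
      using a F[OF a(1)] G[OF a(2)] rc by (intro image_eqI[of _ _ "(a, c - a)"]) auto
  qed
qed

definition times_puiseux :: "puiseux \<Rightarrow> puiseux \<Rightarrow> puiseux" where
  "f * g = Abs_puiseux (\<lambda>c.
    \<Sum>a | pcoeff f a \<noteq> 0 \<and> pcoeff g (c - a) \<noteq> 0. pcoeff f a * pcoeff g (c - a))"

instance ..

end

lemmas pcoeff_simps [simp] =
  zero_puiseux.rep_eq one_puiseux.rep_eq plus_puiseux.rep_eq minus_puiseux.rep_eq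
  uminus_puiseux.rep_eq

lemma pcoeff_times:
  "pcoeff (f * g) c =
    (\<Sum>a | pcoeff f a \<noteq> 0 \<and> pcoeff g (c - a) \<noteq> 0. pcoeff f a * pcoeff g (c - a))"
  unfolding times_puiseux_def using finite_support_times[of _ f g]
  by (subst Abs_puiseux_inverse) auto

lemma pcoeff_times_superset:
  assumes "finite A" "{a. pcoeff f a \<noteq> 0 \<and> pcoeff g (c - a) \<noteq> 0} \<subseteq> A"
  shows "pcoeff (f * g) c = (\<Sum>a\<in>A. pcoeff f a * pcoeff g (c - a))"
  unfolding pcoeff_times by (rule sum.mono_neutral_left[OF assms]) auto

lemma puiseux_mult_commute: "f * g = g * (f :: puiseux)"
proof (rule puiseux_eqI)
  fix c
  show "pcoeff (f * g) c = pcoeff (g * f) c"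
    unfolding pcoeff_times
    by (rule sum.reindex_bij_witness[of _ "\<lambda>a. c - a" "\<lambda>a. c - a"]) auto
qed

lemma puiseux_mult_assoc: "f * g * h = f * (g * (h :: puiseux))"
proof (rule puiseux_eqI)
  fix c
  obtain F where F: "\<And>a. pcoeff f a \<noteq> 0 \<Longrightarrow> a \<le> F" using support_bdd by blast
  obtain G where G: "\<And>a. pcoeff g a \<noteq> 0 \<Longrightarrow> a \<le> G" using support_bdd by blast
  obtain H where H: "\<And>a. pcoeff h a \<noteq> 0 \<Longrightarrow> a \<le> H" using support_bdd by blast
  define A where "A = {a. c - G - H \<le> a \<and> pcoeff f a \<noteq> 0}"
  define C where "C = {k. c - F - G \<le> k \<and> pcoeff h k \<noteq> 0}"
  have fin: "finite A" "finite C" unfolding A_def C_def by (rule finite_support)+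
  have 1: "a + b \<le> F + G" if "pcoeff (f * g) (a + b) \<noteq> 0" for a b
  proof -
    obtain x where x: "pcoeff f x \<noteq> 0" "pcoeff g (a + b - x) \<noteq> 0"
      using \<open>pcoeff (f * g) (a + b) \<noteq> 0\<close> unfolding pcoeff_times
      by (rule sum.not_neutral_contains_not_neutral) auto
    then show ?thesis using F[OF x(1)] G[OF x(2)] by linarith
  qed
  have 2: "a + b \<le> G + H" if "pcoeff (g * h) (a + b) \<noteq> 0" for a b
  proof -
    obtain x where x: "pcoeff g x \<noteq> 0" "pcoeff h (a + b - x) \<noteq> 0"
      using \<open>pcoeff (g * h) (a + b) \<noteq> 0\<close> unfolding pcoeff_times
      by (rule sum.not_neutral_contains_not_neutral) auto
    then show ?thesis using G[OF x(1)] H[OF x(2)] by linarith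
  qed
  have "pcoeff (f * g * h) c = pcoeff (h * (f * g)) c"
    by (simp add: puiseux_mult_commute)
  also have "\<dots> = (\<Sum>k\<in>C. pcoeff h k * pcoeff (f * g) (c - k))"
  proof (rule pcoeff_times_superset[OF fin(2)], intro subsetI)
    fix k assume "k \<in> {a. pcoeff h a \<noteq> 0 \<and> pcoeff (f * g) (c - a) \<noteq> 0}"
    then show "k \<in> C" using 1[of c "- k"] by (auto simp: C_def)
  qed
  also have "\<dots> = (\<Sum>k\<in>C. pcoeff h k * (\<Sum>a\<in>A. pcoeff f a * pcoeff g (c - k - a)))"
  proof (rule sum.cong[OF refl])
    fix k assume "k \<in> C"
    then have k: "k \<le> H" using H by (auto simp: C_def)
    have "pcoeff (f * g) (c - k) = (\<Sum>a\<in>A. pcoeff f a * pcoeff g (c - k - a))"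
    proof (rule pcoeff_times_superset[OF fin(1)], intro subsetI)
      fix a assume "a \<in> {a. pcoeff f a \<noteq> 0 \<and> pcoeff g (c - k - a) \<noteq> 0}"
      then show "a \<in> A" using G[of "c - k - a"] k by (auto simp: A_def)
    qed
    then show "pcoeff h k * pcoeff (f * g) (c - k) =
      pcoeff h k * (\<Sum>a\<in>A. pcoeff f a * pcoeff g (c - k - a))" by simp
  qed
  also have "\<dots> = (\<Sum>k\<in>C. \<Sum>a\<in>A. pcoeff f a * (pcoeff h k * pcoeff g (c - k - a)))"
    by (simp add: sum_distrib_left mult_ac)
  also have "\<dots> = (\<Sum>a\<in>A. \<Sum>k\<in>C. pcoeff f a * (pcoeff h k * pcoeff g (c - k - a)))"
    by (rule sum.swap)
  also have "\<dots> = (\<Sum>a\<in>A. pcoeff f a * (\<Sum>k\<in>C. pcoeff h k * pcoeff g (c - a - k)))"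
    by (simp add: sum_distrib_left algebra_simps)
  also have "\<dots> = (\<Sum>a\<in>A. pcoeff f a * pcoeff (h * g) (c - a))"
  proof (rule sum.cong[OF refl])
    fix a assume "a \<in> A"
    then have a: "a \<le> F" using F by (auto simp: A_def)
    have "pcoeff (h * g) (c - a) = (\<Sum>k\<in>C. pcoeff h k * pcoeff g (c - a - k))"
    proof (rule pcoeff_times_superset[OF fin(2)], intro subsetI)
      fix k assume "k \<in> {k. pcoeff h k \<noteq> 0 \<and> pcoeff g (c - a - k) \<noteq> 0}"
      then show "k \<in> C" using G[of "c - a - k"] a by (auto simp: C_def)
    qed
    then show "pcoeff f a * (\<Sum>k\<in>C. pcoeff h k * pcoeff g (c - a - k)) =
      pcoeff f a * pcoeff (h * g) (c - a)" by simp
  qed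
  also have "\<dots> = (\<Sum>a\<in>A. pcoeff f a * pcoeff (g * h) (c - a))"
    by (simp add: puiseux_mult_commute)
  also have "\<dots> = pcoeff (f * (g * h)) c"
  proof (rule pcoeff_times_superset[OF fin(1), symmetric], intro subsetI)
    fix a assume "a \<in> {a. pcoeff f a \<noteq> 0 \<and> pcoeff (g * h) (c - a) \<noteq> 0}"
    then show "a \<in> A" using 2[of c "- a"] by (auto simp: A_def)
  qed
  finally show "pcoeff (f * g * h) c = pcoeff (f * (g * h)) c" .
qed

instance puiseux :: comm_ring_1
proof
  fix f g h :: puiseux
  show "f * g * h = f * (g * h)" by (rule puiseux_mult_assoc)
  show "f * g = g * f" by (rule puiseux_mult_commute)
  show "1 * f = f"
  proof (rule puiseux_eqI)
    fix c
    have "pcoeff (1 * f) c = (\<Sum>a\<in>{0}. pcoeff 1 a * pcoeff f (c - a))"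
      by (rule pcoeff_times_superset) auto
    then show "pcoeff (1 * f) c = pcoeff f c" by simp
  qed
  show "(f + g) * h = f * h + g * h"
  proof (rule puiseux_eqI)
    fix c
    let ?A = "{a. pcoeff f a \<noteq> 0 \<and> pcoeff h (c - a) \<noteq> 0} \<union>
      {a. pcoeff g a \<noteq> 0 \<and> pcoeff h (c - a) \<noteq> 0}"
    have A: "finite ?A" by (simp add: finite_convolution)
    have "pcoeff ((f + g) * h) c = (\<Sum>a\<in>?A. pcoeff (f + g) a * pcoeff h (c - a))"
      by (rule pcoeff_times_superset[OF A]) auto
    moreover have "pcoeff (f * h) c = (\<Sum>a\<in>?A. pcoeff f a * pcoeff h (c - a))"
      by (rule pcoeff_times_superset[OF A]) auto
    moreover have "pcoeff (g * h) c = (\<Sum>a\<in>?A. pcoeff g a * pcoeff h (c - a))"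
      by (rule pcoeff_times_superset[OF A]) auto
    ultimately show "pcoeff ((f + g) * h) c = pcoeff (f * h + g * h) c"
      by (simp add: algebra_simps sum.distrib)
  qed
  show "f + g + h = f + (g + h)" "f + g = g + f" "0 + f = f" "- f + f = 0" "f - g = f + - g"
    by (rule puiseux_eqI, simp)+
  show "(0 :: puiseux) \<noteq> 1"
  proof
    assume "(0 :: puiseux) = 1"
    then have "pcoeff 0 0 = pcoeff 1 0" by simp
    then show False by simp
  qed
qed

text \<open>
  For a nonzero series, the exponent of the leading term is the greatest element of its support;
  the value at \<open>0\<close> is irrelevant.
\<close>

definition lead_exp :: "puiseux \<Rightarrow> real" where
  "lead_exp f = (GREATEST a. pcoeff f a \<noteq> 0)"

lemma lead_exp_eqI:
  assumes "pcoeff f a \<noteq> 0" "\<And>b. a < b \<Longrightarrow> pcoeff f b = 0"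
  shows "lead_exp f = a"
  unfolding lead_exp_def by (rule Greatest_equality) (use assms in \<open>auto simp: not_less[symmetric]\<close>)

lemma lead_exp_exists:
  assumes "f \<noteq> 0"
  shows "\<exists>a. pcoeff f a \<noteq> 0 \<and> (\<forall>b>a. pcoeff f b = 0)"
proof -
  obtain r where r: "pcoeff f r \<noteq> 0" using assms puiseux_eqI[of f 0] by auto
  let ?S = "{a. r \<le> a \<and> pcoeff f a \<noteq> 0}"
  have S: "finite ?S" "?S \<noteq> {}" using finite_support r by auto
  have "pcoeff f b = 0" if "b > Max ?S" for b
  proof (rule ccontr)
    assume "pcoeff f b \<noteq> 0"
    moreover have "r \<le> Max ?S" using r S(1) by (intro Max_ge) auto
    ultimately have "b \<in> ?S" using that by auto
    then have "b \<le> Max ?S" using S(1) by (rule Max_ge[rotated])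
    then show False using that by simp
  qed
  moreover have "pcoeff f (Max ?S) \<noteq> 0" using Max_in[OF S] by auto
  ultimately show ?thesis by blast
qed

lemma pcoeff_lead_exp: "f \<noteq> 0 \<Longrightarrow> pcoeff f (lead_exp f) \<noteq> 0"
  using lead_exp_exists[of f] lead_exp_eqI[of f] by auto

lemma pcoeff_gt_lead_exp: "lead_exp f < b \<Longrightarrow> pcoeff f b = 0"
proof (cases "f = 0")
  case False
  then obtain a where "pcoeff f a \<noteq> 0" "\<forall>b>a. pcoeff f b = 0" using lead_exp_exists by blast
  then show "lead_exp f < b \<Longrightarrow> pcoeff f b = 0" using lead_exp_eqI[of f a] by auto
qed simp

definition puiseux_pos :: "puiseux \<Rightarrow> bool" where
  "puiseux_pos f \<longleftrightarrow> f \<noteq> 0 \<and> pcoeff f (lead_exp f) > 0"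

lemma puiseux_pos_iff: "puiseux_pos f \<longleftrightarrow> (\<exists>a. pcoeff f a > 0 \<and> (\<forall>b>a. pcoeff f b = 0))"
proof
  assume "puiseux_pos f"
  then show "\<exists>a. pcoeff f a > 0 \<and> (\<forall>b>a. pcoeff f b = 0)"
    using pcoeff_gt_lead_exp[of f] unfolding puiseux_pos_def by blast
next
  assume "\<exists>a. pcoeff f a > 0 \<and> (\<forall>b>a. pcoeff f b = 0)"
  then obtain a where a: "pcoeff f a > 0" "\<forall>b>a. pcoeff f b = 0" by blast
  then have "lead_exp f = a" by (intro lead_exp_eqI) auto
  then show "puiseux_pos f" using a by (auto simp: puiseux_pos_def)
qed

lemma not_puiseux_pos_0: "\<not> puiseux_pos 0"
  by (simp add: puiseux_pos_def)

lemma puiseux_pos_trichotomy: "f = 0 \<or> puiseux_pos f \<or> puiseux_pos (- f)"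
proof (cases "f = 0")
  case False
  then obtain a where a: "pcoeff f a \<noteq> 0" "\<forall>b>a. pcoeff f b = 0" using lead_exp_exists by blast
  then consider "pcoeff f a > 0" | "pcoeff (- f) a > 0" by fastforce
  then show ?thesis
  proof cases
    case 1
    then show ?thesis using a unfolding puiseux_pos_iff by blast
  next
    case 2
    moreover have "\<forall>b>a. pcoeff (- f) b = 0" using a by simp
    ultimately show ?thesis unfolding puiseux_pos_iff by blast
  qed
qed simp

lemma puiseux_pos_add:
  assumes "puiseux_pos f" "puiseux_pos g"
  shows "puiseux_pos (f + g)"
proof -
  obtain a where a: "pcoeff f a > 0" "\<And>b. b > a \<Longrightarrow> pcoeff f b = 0"
    using assms unfolding puiseux_pos_iff by blast
  obtain c where c: "pcoeff g c > 0" "\<And>b. b > c \<Longrightarrow> pcoeff g b = 0"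
    using assms unfolding puiseux_pos_iff by blast
  have "pcoeff (f + g) (max a c) > 0"
    using a c by (cases a c rule: linorder_cases) auto
  moreover have "\<forall>b>max a c. pcoeff (f + g) b = 0" using a c by simp
  ultimately show ?thesis unfolding puiseux_pos_iff by blast
qed

lemma pcoeff_times_lead:
  assumes "\<And>b. b > a \<Longrightarrow> pcoeff f b = 0" "\<And>b. b > c \<Longrightarrow> pcoeff g b = 0"
  shows "pcoeff (f * g) (a + c) = pcoeff f a * pcoeff g c"
    and "b > a + c \<Longrightarrow> pcoeff (f * g) b = 0"
proof -
  have le: "x \<le> a \<and> y \<le> c" if "pcoeff f x \<noteq> 0" "pcoeff g y \<noteq> 0" for x y
    using that assms by (meson not_le)
  have "pcoeff (f * g) (a + c) = (\<Sum>x\<in>{a}. pcoeff f x * pcoeff g (a + c - x))"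
    by (rule pcoeff_times_superset) (use le in force)+
  then show "pcoeff (f * g) (a + c) = pcoeff f a * pcoeff g c" by simp
  have "pcoeff (f * g) b = (\<Sum>x\<in>{}. pcoeff f x * pcoeff g (b - x))" if "b > a + c"
    by (rule pcoeff_times_superset) (use le that in force)+
  then show "b > a + c \<Longrightarrow> pcoeff (f * g) b = 0" by simp
qed

lemma puiseux_pos_mult:
  assumes "puiseux_pos f" "puiseux_pos g"
  shows "puiseux_pos (f * g)"
proof -
  obtain a where a: "pcoeff f a > 0" "\<And>b. b > a \<Longrightarrow> pcoeff f b = 0"
    using assms unfolding puiseux_pos_iff by blast
  obtain c where c: "pcoeff g c > 0" "\<And>b. b > c \<Longrightarrow> pcoeff g b = 0"
    using assms unfolding puiseux_pos_iff by blast
  have "pcoeff (f * g) (a + c) > 0" "\<forall>b>a + c. pcoeff (f * g) b = 0"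
    using pcoeff_times_lead[OF a(2) c(2)] a(1) c(1) by auto
  then show ?thesis unfolding puiseux_pos_iff by blast
qed

instantiation puiseux :: linordered_idom
begin

definition less_puiseux :: "puiseux \<Rightarrow> puiseux \<Rightarrow> bool" where
  "f < g \<longleftrightarrow> puiseux_pos (g - f)"

definition less_eq_puiseux :: "puiseux \<Rightarrow> puiseux \<Rightarrow> bool" where
  "f \<le> g \<longleftrightarrow> f < g \<or> f = (g :: puiseux)"

definition abs_puiseux :: "puiseux \<Rightarrow> puiseux" where
  "\<bar>f :: puiseux\<bar> = (if f < 0 then - f else f)"

definition sgn_puiseux :: "puiseux \<Rightarrow> puiseux" where
  "sgn (f :: puiseux) = (if f = 0 then 0 else if 0 < f then 1 else - 1)"

instance
proof
  fix f g h :: puiseux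
  have asym: "\<not> (f < g \<and> g < f)" for f g :: puiseux
    using puiseux_pos_add[of "g - f" "f - g"] not_puiseux_pos_0 by (auto simp: less_puiseux_def)
  have trans: "f < g \<Longrightarrow> g < h \<Longrightarrow> f < h" for f g h :: puiseux
    using puiseux_pos_add[of "g - f" "h - g"] by (auto simp: less_puiseux_def)
  show "(f < g) = (f \<le> g \<and> \<not> g \<le> f)"
    using asym[of f g] asym[of f f] by (auto simp: less_eq_puiseux_def)
  show "f \<le> f" by (simp add: less_eq_puiseux_def)
  show "f \<le> g \<Longrightarrow> g \<le> h \<Longrightarrow> f \<le> h" using trans[of f g h] by (auto simp: less_eq_puiseux_def)
  show "f \<le> g \<Longrightarrow> g \<le> f \<Longrightarrow> f = g" using asym[of f g] by (auto simp: less_eq_puiseux_def)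
  show "f \<le> g \<or> g \<le> f"
    using puiseux_pos_trichotomy[of "g - f"] by (auto simp: less_eq_puiseux_def less_puiseux_def)
  show "f \<le> g \<Longrightarrow> h + f \<le> h + g" by (auto simp: less_eq_puiseux_def less_puiseux_def)
  show "f < g \<Longrightarrow> 0 < h \<Longrightarrow> h * f < h * g"
    using puiseux_pos_mult[of h "g - f"] by (simp add: less_puiseux_def algebra_simps)
  show "\<bar>f\<bar> = (if f < 0 then - f else f)" by (rule abs_puiseux_def)
  show "sgn f = (if f = 0 then 0 else if 0 < f then 1 else - 1)" by (rule sgn_puiseux_def)
qed

end

lift_definition pmonom :: "real \<Rightarrow> real \<Rightarrow> puiseux" is "\<lambda>c a b. if b = a then c else 0"
  subgoal for c a by (rule finite_subset[of _ "{a}"]) auto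
  done

lemma pcoeff_pmonom [simp]: "pcoeff (pmonom c a) b = (if b = a then c else 0)"
  by transfer simp

lemma pcoeff_sum: "pcoeff (sum F A) c = (\<Sum>n\<in>A. pcoeff (F n) c)"
  by (induction A rule: infinite_finite_induct) auto

lemma pcoeff_power_eq_0:
  assumes "\<And>a. a > - \<delta> \<Longrightarrow> pcoeff e a = 0" "a > - (real n * \<delta>)"
  shows "pcoeff (e ^ n) a = 0"
  using assms(2)
proof (induction n arbitrary: a)
  case (Suc n)
  show ?case unfolding power_Suc
    by (rule pcoeff_times_lead(2)[OF assms(1) Suc.IH]) (use Suc.prems in \<open>auto simp: algebra_simps\<close>)
qed simp

text \<open>The inverse of \<open>1 - e\<close> with infinitesimal \<open>e\<close> is the geometric series.\<close>

lemma puiseux_one_minus_inverse: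
  assumes \<delta>: "\<delta> > 0" and e: "\<And>a. a > - \<delta> \<Longrightarrow> pcoeff e a = 0"
  shows "\<exists>g. (1 - e) * g = 1"
proof -
  define G where "G N = (\<Sum>n\<le>N. e ^ n)" for N :: nat
  define K where "K c = nat \<lceil>- c / \<delta>\<rceil>" for c
  have K: "- c < real (Suc n) * \<delta>" if "K c \<le> n" for c n
  proof -
    have "- c / \<delta> \<le> real n" using that unfolding K_def by linarith
    then have "- c \<le> real n * \<delta>" using \<delta> by (simp only: pos_divide_le_eq)
    then show ?thesis using \<delta> by (simp add: algebra_simps)
  qed
  have G: "pcoeff (G N) c = pcoeff (G (K c)) c" if "K c \<le> N" for c N
    unfolding G_def pcoeff_sum
  proof (rule sum.mono_neutral_right)
    show "\<forall>n\<in>{..N} - {..K c}. pcoeff (e ^ n) c = 0"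
    proof
      fix n assume "n \<in> {..N} - {..K c}"
      then obtain m where m: "n = Suc m" "K c \<le> m" by (cases n) auto
      show "pcoeff (e ^ n) c = 0"
        by (rule pcoeff_power_eq_0[OF e]) (use K[OF m(2)] m(1) in auto)
    qed
  qed (use that in auto)
  have mono: "K c \<le> K r" if "r \<le> c" for r c
    unfolding K_def using that \<delta> by (intro nat_mono ceiling_mono divide_right_mono) auto
  have "finite {c. r \<le> c \<and> pcoeff (G (K c)) c \<noteq> 0}" for r
  proof (rule finite_subset[OF _ finite_support[of r "G (K r)"]], intro subsetI CollectI)
    fix c assume c: "c \<in> {c. r \<le> c \<and> pcoeff (G (K c)) c \<noteq> 0}"
    then have "K c \<le> K r" by (intro mono) simp
    then have "pcoeff (G (K r)) c = pcoeff (G (K c)) c" by (rule G)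
    with c show "r \<le> c \<and> pcoeff (G (K r)) c \<noteq> 0" by simp
  qed
  then have mem: "(\<lambda>c. pcoeff (G (K c)) c) \<in> {f. \<forall>r. finite {a. r \<le> a \<and> f a \<noteq> 0}}"
    by simp
  define g where "g = Abs_puiseux (\<lambda>c. pcoeff (G (K c)) c)"
  have g: "pcoeff g c = pcoeff (G (K c)) c" for c
    unfolding g_def by (simp only: Abs_puiseux_inverse[OF mem])
  have neg: "a \<le> 0" if "pcoeff (1 - e) a \<noteq> 0" for a
    using that e[of a] \<delta> by (cases "a > 0") auto
  have "(1 - e) * g = 1"
  proof (rule puiseux_eqI)
    fix c
    have eq: "pcoeff g (c - a) = pcoeff (G (K c)) (c - a)" if "pcoeff (1 - e) a \<noteq> 0" for a
    proof -
      have "K (c - a) \<le> K c" by (rule mono) (use neg[OF that] in simp)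
      from G[OF this] show ?thesis unfolding g by (rule sym)
    qed
    have "pcoeff ((1 - e) * g) c = pcoeff ((1 - e) * G (K c)) c"
      unfolding pcoeff_times by (intro sum.cong Collect_cong conj_cong refl) (use eq in \<open>simp_all del: pcoeff_simps\<close>)
    also have "(1 - e) * G (K c) = 1 - e ^ Suc (K c)"
      unfolding G_def by (rule sum_gp_basic)
    also have "pcoeff (e ^ Suc (K c)) c = 0"
      by (rule pcoeff_power_eq_0[OF e]) (use K[of c "K c"] in auto)
    then have "pcoeff (1 - e ^ Suc (K c)) c = pcoeff 1 c"
      by (simp only: minus_puiseux.rep_eq)
    finally show "pcoeff ((1 - e) * g) c = pcoeff 1 c" .
  qed
  then show ?thesis ..
qed

lemma puiseux_inverse_exists:
  assumes "f \<noteq> 0"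
  shows "\<exists>g. f * g = (1 :: puiseux)"
proof -
  let ?l = "lead_exp f"
  define m where "m = pmonom (1 / pcoeff f ?l) (- ?l)"
  define e where "e = 1 - f * m"
  have m: "pcoeff m b = 0" if "b > - ?l" for b using that by (simp add: m_def)
  have "pcoeff (f * m) (?l + - ?l) = pcoeff f ?l * pcoeff m (- ?l)"
    by (rule pcoeff_times_lead(1)) (simp_all add: pcoeff_gt_lead_exp m)
  then have "pcoeff (f * m) 0 = 1"
    using pcoeff_lead_exp[OF assms] by (simp add: m_def)
  moreover have "pcoeff (f * m) b = 0" if "b > 0" for b
    by (rule pcoeff_times_lead(2)[of ?l f "- ?l"]) (use that in \<open>simp_all add: pcoeff_gt_lead_exp m\<close>)
  ultimately have e: "pcoeff e b = 0" if "b \<ge> 0" for b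
    using that by (cases "b = 0") (auto simp: e_def)
  have "\<exists>\<delta>>0. \<forall>a>- \<delta>. pcoeff e a = 0"
  proof (cases "e = 0")
    case True
    then show ?thesis by (intro exI[of _ 1]) simp
  next
    case False
    then have "lead_exp e < 0" using pcoeff_lead_exp e by (meson not_le)
    then show ?thesis using pcoeff_gt_lead_exp by (intro exI[of _ "- lead_exp e"]) auto
  qed
  then obtain g where "(1 - e) * g = 1" using puiseux_one_minus_inverse by metis
  then have "f * (m * g) = 1" by (simp add: e_def mult.assoc)
  then show ?thesis ..
qed

instantiation puiseux :: linordered_field
begin

definition inverse_puiseux :: "puiseux \<Rightarrow> puiseux" where
  "inverse f = (if f = 0 then 0 else THE g. f * g = (1 :: puiseux))"

definition divide_puiseux :: "puiseux \<Rightarrow> puiseux \<Rightarrow> puiseux" where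
  "f div g = f * inverse (g :: puiseux)"

instance
proof
  fix f g :: puiseux
  show "inverse f * f = 1" if "f \<noteq> 0"
  proof -
    have "\<exists>!g. f * g = 1"
      using puiseux_inverse_exists[OF that] that by (metis mult_left_cancel)
    then have "f * (THE g. f * g = 1) = 1" by (rule theI')
    then show ?thesis using that by (simp add: inverse_puiseux_def mult.commute)
  qed
  show "f div g = f * inverse g" by (rule divide_puiseux_def)
  show "inverse (0 :: puiseux) = 0" by (simp add: inverse_puiseux_def)
qed

end

section \<open>Polyhedra and signed valuation\<close>

definition is_affine_halfspace :: "(puiseux ^ 'n) set \<Rightarrow> bool" where
  "is_affine_halfspace H \<longleftrightarrow>
    (\<exists>a0 a. a \<noteq> 0 \<and> H = {x. a0 + (\<Sum>i\<in>UNIV. a $ i * x $ i) \<ge> 0})"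

definition is_polyhedron :: "(puiseux ^ 'n) set \<Rightarrow> bool" where
  "is_polyhedron P \<longleftrightarrow> (\<exists>F. finite F \<and> (\<forall>H\<in>F. is_affine_halfspace H) \<and> P = \<Inter>F)"

definition sval :: "puiseux \<Rightarrow> sym_trop" where
  "sval f = (if f = 0 then 0 else TNum (if f > 0 then Plus else Minus) (lead_exp f))"

definition sval_vec :: "puiseux ^ 'n \<Rightarrow> sym_trop ^ 'n" where
  "sval_vec x = (\<chi> i. sval (x $ i))"

end

theory Submission
  imports Defs
begin

text \<open>
  A signed tropical number is encoded by a real number, \<open>r\<close> by \<open>exp r\<close>, \<open>\<ominus>r\<close> by \<open>- exp r\<close> and the
  tropical zero by \<open>0\<close>. Tropical multiplication becomes multiplication, the norm becomes the absolute
  value, and a point lies in a closed halfspace iff one of its terms is at least the absolute value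
  of every term. Points and halfspaces thus play symmetric roles.

  For halfspaces and polyhedra over the Puiseux series, a point is in \<open>sval P\<close> iff \<open>P\<close> meets a box of
  lifts whose coordinates vary by a large integer factor. By Farkas' lemma an obstruction is an
  element of the dual cone of \<open>P\<close>, and it may be taken among the finitely many generators of the
  intersections of this cone with the orthants.

  For generation, closed halfspaces are stable under the left sum, and in each orthant a finite
  intersection of halfspaces is a max-times cone, which the double description method shows to be
  finitely generated. Applied to the polar, the same argument leaves only finitely many halfspaces
  containing given generators. What remains is separation: a set that is closed under scaling, left
  sums and the elimination of a single coordinate contains every point that lies in all closed
  halfspaces around finitely many of its points. To prove it, unit vectors \<open>e\<^sub>i\<close> or \<open>- e\<^sub>i\<close> are added one
  after the other without capturing the point. When all of them are present the set is closed under
  raising coordinates, simultaneous cancellations become harmless, and Fourier-Motzkin elimination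
  produces the separating halfspace.
\<close>

section \<open>Tropical halfspaces and cones in real coordinates\<close>

text \<open>The obstacle is simultaneous cancellation. The points x = (1,-1) and y = (-1,1) satisfy
  the inequality with coefficients (1,1), and so does their left sum (1,-1), but changing its first
  entry to -1 gives (-1,-1), which violates it. A cancelled coordinate may therefore be chosen
  freely only if no other coordinate cancels, and \<open>tcone\<close> offers just this rule. An
  elimination step on a pair of vectors has to resolve all other cancelled coordinates as well. This
  is possible once the set is closed upwards in every coordinate, because they can then be raised to
  their positive norm; hence the unit vectors come before any elimination. Their signs cannot be
  prescribed, they depend on the point to be kept out. A second obstacle is that W consists of
  directions and not of points of the hull. Separation therefore takes place in a cone to which the
  directions of recession of the hull are adjoined, and membership of W among these directions needs
  its own argument.\<close>

definition tnonneg :: "('i \<Rightarrow> real) \<Rightarrow> ('i \<Rightarrow> real) \<Rightarrow> bool" where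
  "tnonneg a x \<longleftrightarrow> (\<exists>k. \<forall>i. \<bar>a i * x i\<bar> \<le> a k * x k)"

definition lsum :: "('i \<Rightarrow> real) \<Rightarrow> ('i \<Rightarrow> real) \<Rightarrow> 'i \<Rightarrow> real" where
  "lsum x y = (\<lambda>k. if \<bar>y k\<bar> \<le> \<bar>x k\<bar> then x k else y k)"

definition opp_only :: "('i \<Rightarrow> real) \<Rightarrow> ('i \<Rightarrow> real) \<Rightarrow> 'i \<Rightarrow> bool" where
  "opp_only x y l \<longleftrightarrow> x l \<noteq> 0 \<and> y l = - x l \<and> (\<forall>k. k \<noteq> l \<longrightarrow> y k = - x k \<longrightarrow> x k = 0)"

text \<open>In the last rule the tropical sum is balanced at \<open>l\<close>, and every value of
  norm at most \<open>\<bar>x l\<bar>\<close> resolves it. That these rules capture TC-convexity of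
  the dehomogenised set is \<open>tc_convex_iff_tcone\<close>.\<close>

definition tcone :: "('i \<Rightarrow> real) set \<Rightarrow> bool" where
  "tcone S \<longleftrightarrow> (\<lambda>_. 0) \<in> S \<and>
    (\<forall>x\<in>S. \<forall>c>0. (\<lambda>k. c * x k) \<in> S) \<and>
    (\<forall>x\<in>S. \<forall>y\<in>S. lsum x y \<in> S) \<and>
    (\<forall>x\<in>S. \<forall>y\<in>S. \<forall>l t. opp_only x y l \<longrightarrow> \<bar>t\<bar> \<le> \<bar>x l\<bar> \<longrightarrow> (lsum x y)(l := t) \<in> S)"

lemma tconeD:
  assumes "tcone S"
  shows tcone_zero: "(\<lambda>_. 0) \<in> S"
    and tcone_scale: "x \<in> S \<Longrightarrow> c > 0 \<Longrightarrow> (\<lambda>k. c * x k) \<in> S"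
    and tcone_lsum: "x \<in> S \<Longrightarrow> y \<in> S \<Longrightarrow> lsum x y \<in> S"
    and tcone_elim: "x \<in> S \<Longrightarrow> y \<in> S \<Longrightarrow> opp_only x y l \<Longrightarrow> \<bar>t\<bar> \<le> \<bar>x l\<bar> \<Longrightarrow> (lsum x y)(l := t) \<in> S"
  using assms unfolding tcone_def by blast+

lemma tnonneg_commute: "tnonneg a x \<longleftrightarrow> tnonneg x a"
  by (simp add: tnonneg_def mult.commute)

lemma tnonneg_scale: "tnonneg a x \<Longrightarrow> c \<ge> 0 \<Longrightarrow> tnonneg a (\<lambda>k. c * x k)"
  unfolding tnonneg_def
  by (metis (no_types, lifting) abs_mult abs_of_nonneg mult.left_commute mult_left_mono)

lemma tnonneg_scale_iff: "c > 0 \<Longrightarrow> tnonneg a (\<lambda>k. c * x k) \<longleftrightarrow> tnonneg a x"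
  using tnonneg_scale[of a x c] tnonneg_scale[of a "\<lambda>k. c * x k" "1 / c"] by auto

lemma lsum_scale: "c > 0 \<Longrightarrow> lsum (\<lambda>k. c * x k) (\<lambda>k. c * y k) = (\<lambda>k. c * lsum x y k)"
  by (auto simp: lsum_def abs_mult fun_eq_iff)

lemma lsum_assoc: "lsum (lsum x y) z = lsum x (lsum y z)"
  unfolding lsum_def by (rule ext) (smt (verit))

lemma lsum_distrib: "lsum g (lsum x y) = lsum (lsum g x) (lsum g y)"
  unfolding lsum_def by (rule ext) (smt (verit))

lemma abs_mult_le_cancel:
  fixes c u v :: real
  assumes "\<bar>c * u\<bar> \<le> c * v"
  shows "c * (if \<bar>u\<bar> \<le> \<bar>v\<bar> then v else u) = c * v"
proof (cases "c = 0")
  case False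
  have "\<bar>c\<bar> * \<bar>u\<bar> \<le> \<bar>c\<bar> * \<bar>v\<bar>"
    using assms abs_ge_self[of "c * v"] unfolding abs_mult by linarith
  then show ?thesis using False by simp
qed simp

text \<open>The larger of the two dominating terms survives. If it is the one of \<open>y\<close>,
  and strictly larger, then \<open>\<bar>x m\<bar> < \<bar>y m\<bar>\<close>, so the left sum takes
  \<open>y m\<close>. If it is the one of \<open>x\<close>, an override by \<open>y\<close> at
  \<open>k\<close> is possible only when \<open>a k = 0\<close>, which is
  \<open>abs_mult_le_cancel\<close>.\<close>

lemma tnonneg_lsum:
  assumes "tnonneg a x" "tnonneg a y"
  shows "tnonneg a (lsum x y)"
proof -
  obtain k where k: "\<And>i. \<bar>a i * x i\<bar> \<le> a k * x k" using assms(1) unfolding tnonneg_def by blast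
  obtain m where m: "\<And>i. \<bar>a i * y i\<bar> \<le> a m * y m" using assms(2) unfolding tnonneg_def by blast
  show ?thesis
  proof (cases "a m * y m \<le> a k * x k")
    case True
    have "a k * lsum x y k = a k * x k"
      unfolding lsum_def by (rule abs_mult_le_cancel) (use m[of k] True in linarith)
    moreover have "\<bar>a i * lsum x y i\<bar> \<le> a k * x k" for i
      using k[of i] m[of i] True by (auto simp: lsum_def)
    ultimately show ?thesis unfolding tnonneg_def by metis
  next
    case False
    then have "\<bar>a m * x m\<bar> < \<bar>a m * y m\<bar>" using k[of m] by linarith
    then have "\<not> \<bar>y m\<bar> \<le> \<bar>x m\<bar>"
      unfolding abs_mult by (meson abs_ge_zero mult_left_mono not_le)
    then have "lsum x y m = y m" by (simp add: lsum_def)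
    moreover have "\<bar>a i * lsum x y i\<bar> \<le> a m * y m" for i
      using k[of i] m[of i] False by (auto simp: lsum_def)
    ultimately show ?thesis unfolding tnonneg_def by metis
  qed
qed

lemma lsum_commute_off:
  assumes "opp_only x y l" "k \<noteq> l"
  shows "lsum x y k = lsum y x k"
proof -
  have "y k = - x k \<longrightarrow> x k = 0" using assms unfolding opp_only_def by blast
  then show ?thesis by (auto simp: lsum_def abs_if split: if_splits)
qed

lemma opp_only_commute: "opp_only x y l \<longleftrightarrow> opp_only y x l"
  unfolding opp_only_def by (metis minus_equation_iff neg_equal_0_iff_equal)

lemma elim_commute:
  assumes "opp_only x y l"
  shows "(lsum x y)(l := t) = (lsum y x)(l := t)"
  using lsum_commute_off[OF assms] by (auto simp: fun_eq_iff)

lemma tnonneg_elim_aux: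
  assumes k: "\<And>i. \<bar>a i * x i\<bar> \<le> a k * x k" and m: "\<And>i. \<bar>a i * y i\<bar> \<le> a k * x k"
    and o: "opp_only x y l" and t: "\<bar>t\<bar> \<le> \<bar>x l\<bar>" and kl: "k \<noteq> l"
  shows "tnonneg a ((lsum x y)(l := t))"
proof -
  have "a k * lsum x y k = a k * x k"
    unfolding lsum_def by (rule abs_mult_le_cancel) (rule m)
  moreover have "\<bar>a i * lsum x y i\<bar> \<le> a k * x k" for i
    using k[of i] m[of i] by (auto simp: lsum_def)
  moreover have "\<bar>a l * t\<bar> \<le> a k * x k"
    using mult_left_mono[OF t, of "\<bar>a l\<bar>"] k[of l] unfolding abs_mult by linarith
  ultimately show ?thesis unfolding tnonneg_def using kl by (metis fun_upd_apply)
qed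

text \<open>It suffices to find a dominating term away from \<open>l\<close>. If only one of the two
  vectors is dominated at \<open>l\<close>, the other one has a term of the same norm at
  \<open>l\<close>, so its own dominating term is at least as large and takes over.\<close>

lemma tnonneg_elim:
  assumes "tnonneg a x" "tnonneg a y" and o: "opp_only x y l" and t: "\<bar>t\<bar> \<le> \<bar>x l\<bar>"
  shows "tnonneg a ((lsum x y)(l := t))"
proof -
  obtain k where k: "\<And>i. \<bar>a i * x i\<bar> \<le> a k * x k" using assms(1) unfolding tnonneg_def by blast
  obtain m where m: "\<And>i. \<bar>a i * y i\<bar> \<le> a m * y m" using assms(2) unfolding tnonneg_def by blast
  have o': "opp_only y x l" using opp_only_commute[THEN iffD1, OF o] .
  have yl: "y l = - x l" using o by (simp add: opp_only_def)
  then have t': "\<bar>t\<bar> \<le> \<bar>y l\<bar>" using t by simp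
  have 1: ?thesis if "a m * y m \<le> a k * x k" "k \<noteq> l"
    by (rule tnonneg_elim_aux[OF k _ o t that(2)]) (use m that(1) in \<open>meson order_trans\<close>)
  have 2: ?thesis if "a k * x k \<le> a m * y m" "m \<noteq> l"
    unfolding elim_commute[OF o]
    by (rule tnonneg_elim_aux[OF m _ o' t' that(2)]) (use k that(1) in \<open>meson order_trans\<close>)
  consider "a m * y m \<le> a k * x k" "k \<noteq> l" | "a k * x k \<le> a m * y m" "m \<noteq> l"
    | "k = l" "m = l" | "k = l" "m \<noteq> l" "a m * y m \<le> a k * x k"
    | "m = l" "k \<noteq> l" "a k * x k \<le> a m * y m" by fastforce
  then show ?thesis
  proof cases
    \<comment> \<open>The two terms at \<open>l\<close> are opposite and both nonnegative, so they
      vanish, and with them all terms.\<close>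
    case 3
    have "a l * y l = - (a l * x l)" using yl by simp
    then have "a l * x l = 0" using k[of l] m[of l] unfolding 3 by linarith
    then have "a l = 0" using o by (simp add: opp_only_def)
    then have "\<bar>a i * (((lsum x y)(l := t)) i)\<bar> \<le> a l * (((lsum x y)(l := t)) l)" for i
      using k[of i] m[of i] 3 by (auto simp: lsum_def)
    then show ?thesis unfolding tnonneg_def by blast
  next
    case 4
    then have "a k * x k \<le> a m * y m" using m[of l] yl by auto
    then show ?thesis using 2 4 by blast
  next
    case 5
    then have "a m * y m \<le> a k * x k" using k[of l] yl by auto
    then show ?thesis using 1 5 by blast
  qed (use 1 2 in auto)
qed

lemma lsum_cong: "y k = y' k \<Longrightarrow> lsum x y k = lsum x y' k"
  by (simp only: lsum_def)

text \<open>Allows \<open>y\<close> to be exchanged for a vector with the same cancellation at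
  \<open>l\<close>. Entries taken from the shrunk copy of \<open>x\<close> have the sign of
  \<open>x\<close> and cannot cancel it; at \<open>l\<close> the shrunk entry is too small to
  override \<open>y l\<close>.\<close>

lemma opp_only_absorb:
  assumes xl: "x l \<noteq> 0" "y l = - x l"
    and op: "\<And>k. k \<noteq> l \<Longrightarrow> y k = - x k \<Longrightarrow> x k = 0 \<or> \<bar>y k\<bar> \<le> \<bar>c * x k\<bar>"
    and c: "0 < c" "c < 1"
  shows "opp_only x (lsum (\<lambda>k. c * x k) y) l"
proof -
  let ?y = "lsum (\<lambda>k. c * x k) y"
  have cx: "x k = 0" if "c * x k = - x k" for k
  proof -
    have "(c + 1) * x k = 0" using that by (simp add: algebra_simps)
    then show ?thesis using c by simp
  qed
  have "\<bar>c * x l\<bar> < \<bar>x l\<bar>" using c xl by (simp add: abs_mult)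
  then have 1: "?y l = - x l" using xl by (simp add: lsum_def)
  have 2: "x k = 0" if "k \<noteq> l" "?y k = - x k" for k
    using that op[of k] cx[of k] by (cases "\<bar>y k\<bar> \<le> \<bar>c * x k\<bar>") (simp_all add: lsum_def)
  show ?thesis unfolding opp_only_def using 1 2 xl by blast
qed

text \<open>Elimination seen through a mask \<open>g\<close>: where \<open>g\<close> dominates,
  cancellations between \<open>x\<close> and \<open>y\<close> are hidden. Either the one at
  \<open>l\<close> is hidden too and the plain left sum is enough, or \<open>l\<close> is the only
  cancellation between \<open>lsum g x\<close> and \<open>lsum g y\<close>.\<close>

lemma lsum_elim_mem:
  assumes S: "tcone S" and gx: "lsum g x \<in> S" "lsum g y \<in> S" and xl: "x l \<noteq> 0" "y l = - x l"
    and op: "\<And>k. k \<noteq> l \<Longrightarrow> y k = - x k \<Longrightarrow> x k = 0 \<or> \<bar>x k\<bar> \<le> \<bar>g k\<bar>"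
    and z: "\<And>k. k \<noteq> l \<Longrightarrow> lsum g z k = lsum g (lsum x y) k" "\<bar>z l\<bar> \<le> \<bar>x l\<bar>"
  shows "lsum g z \<in> S"
proof -
  have off: "lsum (lsum g x) (lsum g y) k = lsum g z k" if "k \<noteq> l" for k
    unfolding z(1)[OF that] by (rule fun_cong[OF lsum_distrib[symmetric]])
  show ?thesis
  proof (cases "\<bar>x l\<bar> \<le> \<bar>g l\<bar>")
    case True
    have "\<bar>y l\<bar> \<le> \<bar>g l\<bar>" "\<bar>z l\<bar> \<le> \<bar>g l\<bar>" using True xl(2) z(2) by linarith+
    then have "lsum (lsum g x) (lsum g y) l = lsum g z l" using True by (simp add: lsum_def)
    then have "lsum (lsum g x) (lsum g y) = lsum g z" using off by (intro ext) metis
    then show ?thesis using tcone_lsum[OF S gx] by simp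
  next
    case False
    have l: "lsum g x l = x l" "lsum g y l = - x l" using False xl by (simp_all add: lsum_def)
    have "opp_only (lsum g x) (lsum g y) l"
      unfolding opp_only_def
    proof (intro conjI allI impI)
      fix k assume k: "k \<noteq> l" "lsum g y k = - lsum g x k"
      show "lsum g x k = 0" using k op[of k] by (auto simp: lsum_def split: if_splits)
    qed (simp_all add: l xl)
    moreover have "\<bar>lsum g z l\<bar> \<le> \<bar>lsum g x l\<bar>" using False z(2) unfolding l by (simp add: lsum_def)
    ultimately have in_S: "(lsum (lsum g x) (lsum g y))(l := lsum g z l) \<in> S"
      using tcone_elim[OF S gx] by blast
    have "(lsum (lsum g x) (lsum g y))(l := lsum g z l) = lsum g z"
      using off by (intro ext) (simp add: fun_upd_apply)
    from subst[of _ _ "\<lambda>v. v \<in> S", OF this in_S] show ?thesis .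
  qed
qed

text \<open>Relaxation: the coordinate \<open>i\<close> may become balanced, which the flag records; the entry at
  \<open>i\<close> is then the positive norm.\<close>

definition badd :: "real \<Rightarrow> bool \<Rightarrow> real \<Rightarrow> bool \<Rightarrow> real" where
  "badd w b w' b' = (if \<bar>w'\<bar> < \<bar>w\<bar> then w else if \<bar>w\<bar> < \<bar>w'\<bar> then w'
     else if b \<or> b' \<or> w \<noteq> w' then \<bar>w\<bar> else w)"

definition bbal :: "real \<Rightarrow> bool \<Rightarrow> real \<Rightarrow> bool \<Rightarrow> bool" where
  "bbal w b w' b' = (if \<bar>w'\<bar> < \<bar>w\<bar> then b else if \<bar>w\<bar> < \<bar>w'\<bar> then b'
     else b \<or> b' \<or> w \<noteq> w')"

lemma abs_badd: "\<bar>badd w b w' b'\<bar> = max \<bar>w\<bar> \<bar>w'\<bar>"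
  by (auto simp: badd_def)

definition opp_only_off :: "'i \<Rightarrow> ('i \<Rightarrow> real) \<Rightarrow> ('i \<Rightarrow> real) \<Rightarrow> 'i \<Rightarrow> bool" where
  "opp_only_off i x y l \<longleftrightarrow> l \<noteq> i \<and> x l \<noteq> 0 \<and> y l = - x l \<and>
     (\<forall>k. k \<noteq> l \<longrightarrow> k \<noteq> i \<longrightarrow> y k = - x k \<longrightarrow> x k = 0)"

text \<open>The closure of \<open>S\<close> under the rules of a tropical cone with the entry at
  \<open>i\<close> added in the symmetrized semiring: a cancellation at \<open>i\<close> is recorded
  instead of resolved, and it does not block an elimination at another coordinate.\<close>

inductive_set relax :: "('i \<Rightarrow> real) set \<Rightarrow> 'i \<Rightarrow> (('i \<Rightarrow> real) \<times> bool) set" for S i where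
  base: "x \<in> S \<Longrightarrow> (x, False) \<in> relax S i"
| scale: "(x, b) \<in> relax S i \<Longrightarrow> c > 0 \<Longrightarrow> (\<lambda>k. c * x k, b) \<in> relax S i"
| comp: "(x, b) \<in> relax S i \<Longrightarrow> (y, b') \<in> relax S i \<Longrightarrow>
    ((lsum x y)(i := badd (x i) b (y i) b'), bbal (x i) b (y i) b') \<in> relax S i"
| elim: "(x, b) \<in> relax S i \<Longrightarrow> (y, b') \<in> relax S i \<Longrightarrow> opp_only_off i x y l \<Longrightarrow> \<bar>t\<bar> \<le> \<bar>x l\<bar> \<Longrightarrow>
    ((lsum x y)(l := t, i := badd (x i) b (y i) b'), bbal (x i) b (y i) b') \<in> relax S i"

lemma badd_pos: "bbal w b w' b' \<Longrightarrow> (b \<Longrightarrow> w > 0) \<Longrightarrow> (b' \<Longrightarrow> w' > 0) \<Longrightarrow> badd w b w' b' > 0"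
  unfolding bbal_def badd_def by (smt (verit))

lemma relax_balanced_pos:
  assumes "(x, b) \<in> relax S i" b
  shows "x i > 0"
  using assms by (induction rule: relax.induct) (simp_all add: badd_pos)

text \<open>A member \<open>g\<close> of \<open>S\<close> that dominates at \<open>i\<close> masks
  the only coordinate where the relaxed rules deviate from those of \<open>S\<close>. Behind this
  mask a derivation in \<open>relax S i\<close> is a derivation in \<open>S\<close>.\<close>

lemma relax_lsum:
  assumes S: "tcone S" and "(x, b) \<in> relax S i" "g \<in> S" "\<bar>x i\<bar> \<le> \<bar>g i\<bar>"
  shows "lsum g x \<in> S"
  using assms(2-)
proof (induction arbitrary: g rule: relax.induct)
  case (base x)
  then show ?case using tcone_lsum[OF S] by blast
next
  case (scale x b c)
  have "(\<lambda>k. (1/c) * g k) \<in> S" using tcone_scale[OF S scale.prems(1), of "1/c"] scale.hyps by simp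
  then have "lsum (\<lambda>k. (1/c) * g k) x \<in> S"
    using scale.IH scale.prems scale.hyps by (auto simp: abs_mult field_simps)
  then have "(\<lambda>k. c * lsum (\<lambda>k. (1/c) * g k) x k) \<in> S" using tcone_scale[OF S] scale.hyps by blast
  then show ?case using lsum_scale[OF scale.hyps(2), of "\<lambda>k. (1/c) * g k" x] scale.hyps by simp
next
  case (comp x b y b')
  have le: "\<bar>x i\<bar> \<le> \<bar>g i\<bar>" "\<bar>y i\<bar> \<le> \<bar>g i\<bar>" using comp.prems by (simp_all add: abs_badd)
  have "lsum (lsum g x) (lsum g y) \<in> S"
    using tcone_lsum[OF S comp.IH(1)[OF comp.prems(1) le(1)] comp.IH(2)[OF comp.prems(1) le(2)]] .
  moreover have "lsum (lsum g x) (lsum g y) = lsum g ((lsum x y)(i := badd (x i) b (y i) b'))"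
    using le abs_badd[of "x i" b "y i" b'] by (auto simp: lsum_def fun_eq_iff)
  ultimately show ?case by (simp add: fun_upd_def)
next
  case (elim x b y b' l t)
  let ?z = "(lsum x y)(l := t, i := badd (x i) b (y i) b')"
  have le: "\<bar>x i\<bar> \<le> \<bar>g i\<bar>" "\<bar>y i\<bar> \<le> \<bar>g i\<bar>" using elim.prems by (simp_all add: abs_badd)
  have li: "l \<noteq> i" and xl: "y l = - x l" "x l \<noteq> 0"
    and op: "\<And>k. k \<noteq> l \<Longrightarrow> k \<noteq> i \<Longrightarrow> y k = - x k \<Longrightarrow> x k = 0"
    using elim.hyps(3) unfolding opp_only_off_def by blast+
  have "lsum g ?z \<in> S"
  proof (rule lsum_elim_mem[OF S elim.IH(1)[OF elim.prems(1) le(1)] elim.IH(2)[OF elim.prems(1) le(2)] xl(2,1)])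
    show "x k = 0 \<or> \<bar>x k\<bar> \<le> \<bar>g k\<bar>" if "k \<noteq> l" "y k = - x k" for k
      using op[of k] that le by (cases "k = i") simp_all
    show "lsum g ?z k = lsum g (lsum x y) k" if k: "k \<noteq> l" for k
    proof (cases "k = i")
      case True
      then show ?thesis using le abs_badd[of "x i" b "y i" b'] by (simp add: lsum_def)
    qed (use k in \<open>simp add: lsum_def\<close>)
    show "\<bar>?z l\<bar> \<le> \<bar>x l\<bar>" using elim.hyps(4) li by simp
  qed
  then show ?case by (simp add: fun_upd_def)
qed

text \<open>This law and the next one let a shrunk copy of an operand serve as a mask: the copy
  disappears from the final left sum.\<close>

lemma lsum_absorb:
  assumes "0 < c" "c < 1"
  shows "lsum (lsum (\<lambda>k. c * y k) x) y = lsum x y"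
proof
  fix k
  define d where "d = c * y k"
  have "\<bar>d\<bar> < \<bar>y k\<bar> \<or> (y k = 0 \<and> d = 0)"
    using assms by (cases "y k = 0") (simp_all add: d_def abs_mult)
  then have "(if \<bar>y k\<bar> \<le> \<bar>if \<bar>x k\<bar> \<le> \<bar>d\<bar> then d else x k\<bar> then if \<bar>x k\<bar> \<le> \<bar>d\<bar> then d else x k else y k) =
      (if \<bar>y k\<bar> \<le> \<bar>x k\<bar> then x k else y k)"
    by (smt (verit))
  then show "lsum (lsum (\<lambda>k. c * y k) x) y k = lsum x y k"
    by (simp only: lsum_def d_def)
qed

lemma lsum_absorb2:
  assumes "0 < c" "c \<le> 1"
  shows "lsum x (lsum (\<lambda>k. c * x k) y) = lsum x y"
proof
  fix k
  define d where "d = c * x k"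
  have "\<bar>d\<bar> \<le> \<bar>x k\<bar>"
    using assms by (simp add: d_def abs_mult mult_left_le_one_le)
  then have "(if \<bar>if \<bar>y k\<bar> \<le> \<bar>d\<bar> then d else y k\<bar> \<le> \<bar>x k\<bar> then x k else if \<bar>y k\<bar> \<le> \<bar>d\<bar> then d else y k) =
      (if \<bar>y k\<bar> \<le> \<bar>x k\<bar> then x k else y k)"
    by (smt (verit))
  then show "lsum x (lsum (\<lambda>k. c * x k) y) k = lsum x y k"
    by (simp only: lsum_def d_def)
qed

lemma shrink_above:
  fixes u v :: real
  assumes "\<bar>u\<bar> < \<bar>v\<bar>"
  obtains c where "0 < c" "c < 1" "\<bar>u\<bar> \<le> \<bar>c * v\<bar>"
proof
  let ?c = "(\<bar>u\<bar> / \<bar>v\<bar> + 1) / 2"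
  have v: "\<bar>v\<bar> > 0" using assms by linarith
  show "0 < ?c" by (simp add: add_nonneg_pos)
  have "\<bar>u\<bar> / \<bar>v\<bar> < 1" using assms v by simp
  then show "?c < 1" by simp
  have "r \<le> (r + 1) / 2" if "r < 1" for r :: real using that by simp
  then have "\<bar>u\<bar> / \<bar>v\<bar> \<le> ?c" using \<open>\<bar>u\<bar> / \<bar>v\<bar> < 1\<close> by blast
  then have "\<bar>u\<bar> \<le> ?c * \<bar>v\<bar>" using v by (simp only: pos_divide_le_eq)
  then show "\<bar>u\<bar> \<le> \<bar>?c * v\<bar>" using \<open>0 < ?c\<close> by (simp only: abs_mult abs_of_pos)
qed

text \<open>Relaxation adds only balanced elements. If the norms at \<open>i\<close> differ, the
  flag of the result is that of the larger operand, which is therefore in \<open>S\<close> and masks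
  the other one by \<open>relax_lsum\<close>; a shrunk copy is the mask where the order of the
  operands or an elimination forbids the operand itself. If the norms agree, an unbalanced result
  has two unbalanced operands with equal entries at \<open>i\<close>.\<close>

lemma relax_unbalanced:
  assumes S: "tcone S" and "(x, b) \<in> relax S i" "\<not> b"
  shows "x \<in> S"
  using assms(2-)
proof (induction rule: relax.induct)
  case (base x)
  then show ?case by blast
next
  case (scale x b c)
  then show ?case using tcone_scale[OF S] by blast
next
  case (comp x b y b')
  consider "\<bar>y i\<bar> < \<bar>x i\<bar>" | "\<bar>x i\<bar> < \<bar>y i\<bar>" | "\<bar>x i\<bar> = \<bar>y i\<bar>" by linarith
  then have *: "lsum x y \<in> S \<and> badd (x i) b (y i) b' = lsum x y i"
  proof cases
    case 1
    then have "x \<in> S" using comp by (simp add: bbal_def)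
    then show ?thesis using relax_lsum[OF S comp.hyps(2), of x] 1 by (simp add: badd_def lsum_def)
  next
    case 2
    then have y: "y \<in> S" using comp by (simp add: bbal_def)
    from shrink_above[OF 2] obtain c where c: "0 < c" "c < 1" "\<bar>x i\<bar> \<le> \<bar>c * y i\<bar>" .
    have "lsum (\<lambda>k. c * y k) x \<in> S"
      by (rule relax_lsum[OF S comp.hyps(1) tcone_scale[OF S y c(1)] c(3)])
    from tcone_lsum[OF S this y] show ?thesis
      using 2 by (simp add: lsum_absorb[OF c(1,2)] badd_def) (simp add: lsum_def)
  next
    case 3
    then have "x \<in> S" "y \<in> S" "x i = y i" using comp by (simp_all add: bbal_def)
    then show ?thesis using tcone_lsum[OF S] 3 comp.prems by (simp add: badd_def bbal_def lsum_def)
  qed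
  then have "(lsum x y)(i := badd (x i) b (y i) b') = lsum x y" by simp
  with * show ?case by simp
next
  case (elim x b y b' l t)
  have li: "l \<noteq> i" and xl: "y l = - x l" "x l \<noteq> 0"
    and op: "\<And>k. k \<noteq> l \<Longrightarrow> k \<noteq> i \<Longrightarrow> y k = - x k \<Longrightarrow> x k = 0"
    using elim.hyps(3) unfolding opp_only_off_def by blast+
  consider "\<bar>y i\<bar> < \<bar>x i\<bar>" | "\<bar>x i\<bar> < \<bar>y i\<bar>" | "\<bar>x i\<bar> = \<bar>y i\<bar>" by linarith
  then have *: "(lsum x y)(l := t) \<in> S \<and> badd (x i) b (y i) b' = lsum x y i"
  proof cases
    case 1
    then have x: "x \<in> S" using elim by (simp add: bbal_def)
    from shrink_above[OF 1] obtain c where c: "0 < c" "c < 1" "\<bar>y i\<bar> \<le> \<bar>c * x i\<bar>" .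
    have y': "lsum (\<lambda>k. c * x k) y \<in> S"
      by (rule relax_lsum[OF S elim.hyps(2) tcone_scale[OF S x c(1)] c(3)])
    have "opp_only x (lsum (\<lambda>k. c * x k) y) l"
      by (rule opp_only_absorb[of x l y c, OF xl(2,1) _ c(1,2)]) (use op c(3) in metis)
    from tcone_elim[OF S x y' this elim.hyps(4)] show ?thesis
      using 1 c lsum_absorb2[of c x y] by (simp add: badd_def) (simp add: lsum_def)
  next
    case 2
    then have y: "y \<in> S" using elim by (simp add: bbal_def)
    from shrink_above[OF 2] obtain c where c: "0 < c" "c < 1" "\<bar>x i\<bar> \<le> \<bar>c * y i\<bar>" .
    have x': "lsum (\<lambda>k. c * y k) x \<in> S"
      by (rule relax_lsum[OF S elim.hyps(1) tcone_scale[OF S y c(1)] c(3)])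
    have o: "opp_only y (lsum (\<lambda>k. c * y k) x) l"
      by (rule opp_only_absorb[of y l x c, OF _ _ _ c(1,2)]) (use xl op c(3) in \<open>metis minus_equation_iff neg_equal_0_iff_equal\<close>)+
    have t: "\<bar>t\<bar> \<le> \<bar>y l\<bar>" using elim.hyps(4) xl by simp
    from tcone_elim[OF S y x' o t] show ?thesis
      unfolding elim_commute[OF o] lsum_absorb[OF c(1,2)]
      using 2 by (simp add: badd_def lsum_def)
  next
    case 3
    then have x: "x \<in> S" "y \<in> S" "x i = y i" using elim by (simp_all add: bbal_def)
    have "x k = 0" if "k \<noteq> l" "y k = - x k" for k
      using that op[of k] x(3) by (cases "k = i") simp_all
    then have "opp_only x y l"
      unfolding opp_only_def using xl by blast
    from tcone_elim[OF S x(1,2) this elim.hyps(4)] show ?thesis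
      using 3 elim.prems by (simp add: badd_def bbal_def lsum_def)
  qed
  then have "(lsum x y)(l := t, i := badd (x i) b (y i) b') = (lsum x y)(l := t)"
    using li by (auto simp: fun_eq_iff)
  with * show ?case by (simp add: fun_upd_def)
qed

text \<open>The sum of the lower bounds \<open>w\<close> and \<open>w'\<close> stays below the left
  sum of \<open>u\<close> and \<open>v\<close> unless \<open>u\<close> and \<open>v\<close> cancel.
  The second alternatives then supply an unbalanced operand that dominates at \<open>i\<close>, as
  \<open>relax_lsum\<close> requires.\<close>

lemma badd_cases:
  assumes "b \<Longrightarrow> w > 0" "b' \<Longrightarrow> w' > 0" "w \<le> u" "w' \<le> v"
  shows badd_case1: "badd w b w' b' \<le> (if \<bar>v\<bar> \<le> \<bar>u\<bar> then u else v) \<or> (\<not> b \<and> \<bar>w'\<bar> \<le> \<bar>w\<bar> \<and> \<bar>v\<bar> \<le> \<bar>u\<bar>)"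
    and badd_case2: "(v = - u \<Longrightarrow> u = 0) \<Longrightarrow> badd w b w' b' \<le> (if \<bar>v\<bar> \<le> \<bar>u\<bar> then u else v)"
    and badd_case3: "v = - u \<Longrightarrow> u > 0 \<Longrightarrow> badd w b w' b' \<le> - u \<or> (\<not> b' \<and> \<bar>w\<bar> \<le> \<bar>w'\<bar>)"
  using assms unfolding badd_def by (smt (verit))+

text \<open>A balanced entry is stored as its positive norm, so it is raised from its largest
  resolution and not from its smallest.\<close>

definition up_ext :: "('i \<Rightarrow> real) set \<Rightarrow> 'i \<Rightarrow> ('i \<Rightarrow> real) set" where
  "up_ext S i = {x. \<exists>q b. (q, b) \<in> relax S i \<and> (\<forall>k. k \<noteq> i \<longrightarrow> x k = q k) \<and> q i \<le> x i}"

lemma up_extI: "(q, b) \<in> relax S i \<Longrightarrow> (\<And>k. k \<noteq> i \<Longrightarrow> x k = q k) \<Longrightarrow> q i \<le> x i \<Longrightarrow> x \<in> up_ext S i"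
  unfolding up_ext_def by blast

lemma up_ext_subset: "S \<subseteq> up_ext S i"
  by (auto intro: up_extI relax.base)

text \<open>A witness with entry at most \<open>- x i\<close> at \<open>i\<close> suffices, since
  \<open>- x i \<le> t\<close>. Such an entry is negative, hence unbalanced: either \<open>q\<close>
  has it and overrides \<open>q'\<close>, or \<open>q'\<close> belongs to \<open>S\<close> and masks
  \<open>q\<close>.\<close>

lemma up_ext_elim_at:
  assumes S: "tcone S" and q: "(q, b) \<in> relax S i" "(q', b') \<in> relax S i"
    and x: "\<And>k. k \<noteq> i \<Longrightarrow> x k = q k" "q i \<le> x i" and y: "\<And>k. k \<noteq> i \<Longrightarrow> y k = q' k" "q' i \<le> y i"
    and o: "opp_only x y i" and t: "\<bar>t\<bar> \<le> \<bar>x i\<bar>" and pos: "x i > 0"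
  shows "(lsum x y)(i := t) \<in> up_ext S i"
proof -
  have yi: "y i = - x i" using o by (simp add: opp_only_def)
  have tx: "- x i \<le> t" using t pos by linarith
  note bp = relax_balanced_pos[OF q(1)] relax_balanced_pos[OF q(2)]
  have "badd (q i) b (q' i) b' \<le> - x i \<or> (\<not> b' \<and> \<bar>q i\<bar> \<le> \<bar>q' i\<bar>)"
    using badd_case3[OF bp x(2) y(2) yi pos] .
  then show ?thesis
  proof
    assume "badd (q i) b (q' i) b' \<le> - x i"
    then show ?thesis
      by (intro up_extI[OF relax.comp[OF q]]) (use tx x y in \<open>simp_all add: lsum_def\<close>)
  next
    assume *: "\<not> b' \<and> \<bar>q i\<bar> \<le> \<bar>q' i\<bar>"
    then have "q' \<in> S" using relax_unbalanced[OF S q(2)] by blast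
    then have "lsum q' q \<in> S" using relax_lsum[OF S q(1)] * by blast
    then show ?thesis
    proof (rule up_extI[OF relax.base])
      fix k assume k: "k \<noteq> i"
      have "lsum x y k = lsum y x k" by (rule lsum_commute_off[OF o k])
      then show "((lsum x y)(i := t)) k = lsum q' q k" using k x y by (simp add: lsum_def)
    next
      have "lsum q' q i = q' i" using * by (simp add: lsum_def)
      then show "lsum q' q i \<le> ((lsum x y)(i := t)) i" using y(2) yi tx by simp
    qed
  qed
qed

lemma tcone_up_ext:
  assumes S: "tcone S"
  shows "tcone (up_ext S i)"
  unfolding tcone_def
proof (intro conjI ballI allI impI)
  show "(\<lambda>_. 0) \<in> up_ext S i" by (rule subsetD[OF up_ext_subset tcone_zero[OF S]])
next
  fix x and c :: real assume "x \<in> up_ext S i" and c: "c > 0"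
  then obtain q b where "(q, b) \<in> relax S i" "\<And>k. k \<noteq> i \<Longrightarrow> x k = q k" "q i \<le> x i"
    unfolding up_ext_def by blast
  then show "(\<lambda>k. c * x k) \<in> up_ext S i"
    by (intro up_extI[OF relax.scale[OF _ c]]) (use c in simp_all)
next
  fix x y assume "x \<in> up_ext S i" "y \<in> up_ext S i"
  then obtain q b q' b' where q: "(q, b) \<in> relax S i" "(q', b') \<in> relax S i"
    and x: "\<And>k. k \<noteq> i \<Longrightarrow> x k = q k" "q i \<le> x i" and y: "\<And>k. k \<noteq> i \<Longrightarrow> y k = q' k" "q' i \<le> y i"
    unfolding up_ext_def by blast
  note bp = relax_balanced_pos[OF q(1)] relax_balanced_pos[OF q(2)]
  have "badd (q i) b (q' i) b' \<le> lsum x y i \<or> (\<not> b \<and> \<bar>q' i\<bar> \<le> \<bar>q i\<bar> \<and> \<bar>y i\<bar> \<le> \<bar>x i\<bar>)"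
    using badd_case1[OF bp x(2) y(2)] by (simp only: lsum_def)
  then show "lsum x y \<in> up_ext S i"
  proof
    assume "badd (q i) b (q' i) b' \<le> lsum x y i"
    then show ?thesis
      by (intro up_extI[OF relax.comp[OF q]]) (use x y in \<open>simp_all add: lsum_def\<close>)
  next
    assume *: "\<not> b \<and> \<bar>q' i\<bar> \<le> \<bar>q i\<bar> \<and> \<bar>y i\<bar> \<le> \<bar>x i\<bar>"
    then have "q \<in> S" using relax_unbalanced[OF S q(1)] by blast
    then have "lsum q q' \<in> S" using relax_lsum[OF S q(2)] * by blast
    then show ?thesis
      by (rule up_extI[OF relax.base]) (use x y * in \<open>simp_all add: lsum_def\<close>)
  qed
next
  fix x y l t assume "x \<in> up_ext S i" "y \<in> up_ext S i" and o: "opp_only x y l" and t: "\<bar>t\<bar> \<le> \<bar>x l\<bar>"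
  then obtain q b q' b' where q: "(q, b) \<in> relax S i" "(q', b') \<in> relax S i"
    and x: "\<And>k. k \<noteq> i \<Longrightarrow> x k = q k" "q i \<le> x i" and y: "\<And>k. k \<noteq> i \<Longrightarrow> y k = q' k" "q' i \<le> y i"
    unfolding up_ext_def by blast
  note bp = relax_balanced_pos[OF q(1)] relax_balanced_pos[OF q(2)]
  have xl: "x l \<noteq> 0" "y l = - x l" and op: "\<And>k. k \<noteq> l \<Longrightarrow> y k = - x k \<Longrightarrow> x k = 0"
    using o unfolding opp_only_def by blast+
  show "(lsum x y)(l := t) \<in> up_ext S i"
  proof (cases "l = i")
    case False
    have qo: "opp_only_off i q q' l"
      unfolding opp_only_off_def using xl op x(1) y(1) False by metis
    have "badd (q i) b (q' i) b' \<le> lsum x y i"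
      using badd_case2[OF bp x(2) y(2)] op[of i] False by (simp only: lsum_def) blast
    moreover have "\<bar>t\<bar> \<le> \<bar>q l\<bar>" using t x(1)[OF False] by simp
    ultimately show ?thesis
      by (intro up_extI[OF relax.elim[OF q qo]]) (use x y False in \<open>auto simp add: lsum_def\<close>)
  next
    case True
    show ?thesis
    proof (cases "x i > 0")
      case pos: True
      show ?thesis unfolding True
        by (rule up_ext_elim_at[OF S q x y _ _ pos]) (use o t True in simp_all)
    next
      case False
      then have pos: "y i > 0" using xl True by simp
      have o': "opp_only y x l" using opp_only_commute[THEN iffD1, OF o] .
      show ?thesis unfolding elim_commute[OF o] unfolding True
        by (rule up_ext_elim_at[OF S q(2,1) y x _ _ pos]) (use o' t True xl in simp_all)
    qed
  qed
qed

section \<open>Sign changes of coordinates\<close>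

definition reflect :: "('i \<Rightarrow> real) \<Rightarrow> ('i \<Rightarrow> real) \<Rightarrow> 'i \<Rightarrow> real" where
  "reflect \<sigma> x = (\<lambda>k. \<sigma> k * x k)"

lemma abs_reflect:
  assumes "\<And>k. \<bar>\<sigma> k\<bar> = 1"
  shows "\<bar>reflect \<sigma> x k\<bar> = \<bar>x k\<bar>"
  unfolding reflect_def abs_mult assms by simp

lemma reflect_lsum:
  assumes "\<And>k. \<bar>\<sigma> k\<bar> = 1"
  shows "reflect \<sigma> (lsum x y) = lsum (reflect \<sigma> x) (reflect \<sigma> y)"
  unfolding lsum_def abs_reflect[of \<sigma>, OF assms] by (auto simp: reflect_def)

lemma reflect_reflect:
  assumes "\<And>k. \<bar>\<sigma> k\<bar> = 1"
  shows "reflect \<sigma> (reflect \<sigma> x) = x"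
proof
  fix k
  have "\<sigma> k * \<sigma> k = 1" using abs_mult_self_eq[of "\<sigma> k"] assms by simp
  then show "reflect \<sigma> (reflect \<sigma> x) k = x k" by (simp add: reflect_def mult.assoc[symmetric])
qed

lemma reflect_opp_only:
  assumes "\<And>k. \<bar>\<sigma> k\<bar> = 1" "opp_only x y l"
  shows "opp_only (reflect \<sigma> x) (reflect \<sigma> y) l"
proof -
  have nz: "\<sigma> k \<noteq> 0" for k using assms(1)[of k] by auto
  then have "\<sigma> k * y k = - (\<sigma> k * x k) \<longleftrightarrow> y k = - x k" for k
    using mult_left_cancel[of "\<sigma> k" "y k" "- x k"] by simp
  with nz show ?thesis using assms(2) unfolding opp_only_def reflect_def by simp
qed

lemma tcone_reflect:
  assumes s: "\<And>k. \<bar>\<sigma> k\<bar> = 1" and S: "tcone S"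
  shows "tcone {x. reflect \<sigma> x \<in> S}"
  unfolding tcone_def
proof (intro conjI ballI allI impI)
  show "(\<lambda>_. 0) \<in> {x. reflect \<sigma> x \<in> S}" using tcone_zero[OF S] by (simp add: reflect_def)
next
  fix x and c :: real assume "x \<in> {x. reflect \<sigma> x \<in> S}" "c > 0"
  then show "(\<lambda>k. c * x k) \<in> {x. reflect \<sigma> x \<in> S}"
    using tcone_scale[OF S, of "reflect \<sigma> x" c] by (simp add: reflect_def mult.left_commute)
next
  fix x y assume "x \<in> {x. reflect \<sigma> x \<in> S}" "y \<in> {x. reflect \<sigma> x \<in> S}"
  then show "lsum x y \<in> {x. reflect \<sigma> x \<in> S}"
    unfolding mem_Collect_eq reflect_lsum[of \<sigma>, OF s] by (rule tcone_lsum[OF S])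
next
  fix x y l t
  assume xy: "x \<in> {x. reflect \<sigma> x \<in> S}" "y \<in> {x. reflect \<sigma> x \<in> S}" and o: "opp_only x y l" and t: "\<bar>t\<bar> \<le> \<bar>x l\<bar>"
  have "\<bar>\<sigma> l * t\<bar> \<le> \<bar>reflect \<sigma> x l\<bar>" using t unfolding abs_reflect[of \<sigma>, OF s] abs_mult s by simp
  then have "(lsum (reflect \<sigma> x) (reflect \<sigma> y))(l := \<sigma> l * t) \<in> S"
    using tcone_elim[OF S _ _ reflect_opp_only[of \<sigma>, OF s o]] xy by simp
  moreover have "(lsum (reflect \<sigma> x) (reflect \<sigma> y))(l := \<sigma> l * t) = reflect \<sigma> ((lsum x y)(l := t))"
    unfolding reflect_lsum[of \<sigma>, OF s, symmetric] by (auto simp: reflect_def fun_eq_iff)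
  ultimately show "(lsum x y)(l := t) \<in> {x. reflect \<sigma> x \<in> S}" by simp
qed

definition neg_at :: "'i \<Rightarrow> ('i \<Rightarrow> real) \<Rightarrow> 'i \<Rightarrow> real" where
  "neg_at i x = x(i := - x i)"

lemma neg_at_reflect: "neg_at i = reflect (\<lambda>k. if k = i then -1 else 1)"
  by (auto simp: neg_at_def reflect_def fun_eq_iff)

lemma tcone_neg_at: "tcone S \<Longrightarrow> tcone {x. neg_at i x \<in> S}"
  unfolding neg_at_reflect by (rule tcone_reflect) simp_all

lemma badd_neg:
  assumes "b \<Longrightarrow> w > 0" "b' \<Longrightarrow> w' > 0"
  shows "bbal (if b then w else - w) b (if b' then w' else - w') b' = bbal w b w' b'"
    and "badd (if b then w else - w) b (if b' then w' else - w') b' =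
      (if bbal w b w' b' then badd w b w' b' else - badd w b w' b')"
  using assms unfolding bbal_def badd_def by (smt (verit))+

text \<open>A balanced entry is its own negative and keeps its positive norm, whereas an unbalanced
  entry changes its sign. With this distinction relaxation commutes with the reflection at
  \<open>i\<close>.\<close>

lemma relax_neg_at:
  assumes "(x, b) \<in> relax {x. neg_at i x \<in> S} i"
  shows "(if b then x else neg_at i x, b) \<in> relax S i"
  using assms
proof (induction rule: relax.induct)
  case (base x)
  then show ?case by (auto intro: relax.base)
next
  case (scale x b c)
  have "(\<lambda>k. c * (if b then x else neg_at i x) k, b) \<in> relax S i"
    by (rule relax.scale) (use scale in auto)
  moreover have "(\<lambda>k. c * (if b then x else neg_at i x) k) =
      (if b then (\<lambda>k. c * x k) else neg_at i (\<lambda>k. c * x k))"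
    by (auto simp: neg_at_def fun_eq_iff)
  ultimately show ?case by simp
next
  case (comp x b y b')
  have bn: "bbal (if b then x i else - x i) b (if b' then y i else - y i) b' = bbal (x i) b (y i) b'"
    "badd (if b then x i else - x i) b (if b' then y i else - y i) b' =
      (if bbal (x i) b (y i) b' then badd (x i) b (y i) b' else - badd (x i) b (y i) b')"
    by (rule badd_neg[of b "x i" b' "y i"],
        rule relax_balanced_pos[OF comp.hyps(1)], assumption,
        rule relax_balanced_pos[OF comp.hyps(2)], assumption)+
  have v: "(if c then u else neg_at i u) i = (if c then u i else - u i)" for c u
    by (simp add: neg_at_def)
  have off: "(if c then u else neg_at i u) k = u k" if "k \<noteq> i" for c u k
    using that by (simp add: neg_at_def)
  let ?z = "(lsum x y)(i := badd (x i) b (y i) b')"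
  have "((lsum (if b then x else neg_at i x) (if b' then y else neg_at i y))
     (i := (if bbal (x i) b (y i) b' then badd (x i) b (y i) b' else - badd (x i) b (y i) b')),
     bbal (x i) b (y i) b') \<in> relax S i" (is "(?u, _) \<in> _")
    using relax.comp[OF comp.IH] unfolding v bn .
  note m = this
  have "?u k = (if bbal (x i) b (y i) b' then ?z else neg_at i ?z) k" for k
  proof (cases "k = i")
    case True
    then show ?thesis by (simp add: neg_at_def)
  next
    case False
    then show ?thesis unfolding off[OF False] by (simp add: lsum_def off)
  qed
  then have "?u = (if bbal (x i) b (y i) b' then ?z else neg_at i ?z)" by (rule ext)
  from m[unfolded this] show ?case unfolding fun_upd_def .
next
  case (elim x b y b' l t)
  have bn: "bbal (if b then x i else - x i) b (if b' then y i else - y i) b' = bbal (x i) b (y i) b'"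
    "badd (if b then x i else - x i) b (if b' then y i else - y i) b' =
      (if bbal (x i) b (y i) b' then badd (x i) b (y i) b' else - badd (x i) b (y i) b')"
    by (rule badd_neg[of b "x i" b' "y i"],
        rule relax_balanced_pos[OF elim.hyps(1)], assumption,
        rule relax_balanced_pos[OF elim.hyps(2)], assumption)+
  have v: "(if c then u else neg_at i u) i = (if c then u i else - u i)" for c u
    by (simp add: neg_at_def)
  have off: "(if c then u else neg_at i u) k = u k" if "k \<noteq> i" for c u k
    using that by (simp add: neg_at_def)
  let ?z = "(lsum x y)(l := t, i := badd (x i) b (y i) b')"
  have li: "l \<noteq> i" using elim.hyps(3) by (simp add: opp_only_off_def)
  have o: "opp_only_off i (if b then x else neg_at i x) (if b' then y else neg_at i y) l"
    using elim.hyps(3) unfolding opp_only_off_def by (simp add: off)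
  have t: "\<bar>t\<bar> \<le> \<bar>(if b then x else neg_at i x) l\<bar>" using elim.hyps(4) off[OF li] by simp
  have "((lsum (if b then x else neg_at i x) (if b' then y else neg_at i y))
     (l := t, i := (if bbal (x i) b (y i) b' then badd (x i) b (y i) b' else - badd (x i) b (y i) b')),
     bbal (x i) b (y i) b') \<in> relax S i" (is "(?u, _) \<in> _")
    using relax.elim[OF elim.IH o t] unfolding v bn .
  note m = this
  have "?u k = (if bbal (x i) b (y i) b' then ?z else neg_at i ?z) k" for k
  proof (cases "k = i")
    case True
    then show ?thesis by (simp add: neg_at_def)
  next
    case False
    then show ?thesis unfolding off[OF False] by (simp add: lsum_def off)
  qed
  then have "?u = (if bbal (x i) b (y i) b' then ?z else neg_at i ?z)" by (rule ext)
  from m[unfolded this] show ?case unfolding fun_upd_def .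
qed

section \<open>Convexity along coordinate lines\<close>

lemma tcone_between_shrink:
  assumes S: "tcone S" and x: "x \<in> S" "x(i := w) \<in> S" and v: "\<bar>x i\<bar> < \<bar>v\<bar>" "\<bar>v\<bar> \<le> \<bar>w\<bar>" "v * w > 0"
  shows "x(i := v) \<in> S"
proof -
  have w: "w \<noteq> 0" using v(3) by auto
  define c where "c = v / w"
  have c: "c > 0" "c * w = v"
    using v(3) w by (simp_all add: c_def zero_less_divide_iff zero_less_mult_iff)
  have "\<bar>c\<bar> = \<bar>v\<bar> / \<bar>w\<bar>" unfolding c_def by (rule abs_divide)
  also have "\<dots> \<le> 1" using v(2) by (simp only: divide_le_eq_1) simp
  finally have c1: "c \<le> 1" by simp
  have "lsum x (\<lambda>k. c * (x(i := w)) k) \<in> S"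
    by (rule tcone_lsum[OF S x(1) tcone_scale[OF S x(2) c(1)]])
  moreover have "lsum x (\<lambda>k. c * (x(i := w)) k) k = (x(i := v)) k" for k
  proof (cases "k = i")
    case True
    then show ?thesis using v c by (simp add: lsum_def)
  next
    case False
    have "\<bar>c * x k\<bar> \<le> \<bar>x k\<bar>" using c c1 by (simp add: abs_mult mult_left_le_one_le)
    then show ?thesis using False by (simp add: lsum_def)
  qed
  ultimately show ?thesis by (metis ext)
qed

lemma tcone_between_elim:
  assumes S: "tcone S" and x: "x \<in> S" "x(i := w) \<in> S" and v: "\<bar>v\<bar> \<le> \<bar>x i\<bar>" "\<bar>x i\<bar> \<le> \<bar>w\<bar>" "x i * w < 0"
  shows "x(i := v) \<in> S"
proof -
  have w: "w \<noteq> 0" "x i \<noteq> 0" using v(3) by auto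
  define c where "c = - x i / w"
  have c: "c > 0" "c * w = - x i"
    using v(3) w by (simp_all add: c_def divide_less_0_iff mult_less_0_iff)
  have "\<bar>c\<bar> = \<bar>x i\<bar> / \<bar>w\<bar>" unfolding c_def abs_divide by simp
  also have "\<dots> \<le> 1" using v(2) by (simp only: divide_le_eq_1) simp
  finally have c1: "c \<le> 1" by simp
  define y where "y = (\<lambda>k. c * (x(i := w)) k)"
  have y: "y \<in> S" unfolding y_def by (rule tcone_scale[OF S x(2) c(1)])
  have cx: "x k = 0" if "c * x k = - x k" for k
  proof -
    have "(c + 1) * x k = 0" using that by (simp add: algebra_simps)
    then show ?thesis using c by simp
  qed
  have "opp_only x y i" unfolding opp_only_def y_def using w c cx by simp
  then have "(lsum x y)(i := v) \<in> S" using tcone_elim[OF S x(1) y] v(1) by blast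
  moreover have "((lsum x y)(i := v)) k = (x(i := v)) k" for k
  proof (cases "k = i")
    case False
    have "\<bar>c * x k\<bar> \<le> \<bar>x k\<bar>" using c c1 by (simp add: abs_mult mult_left_le_one_le)
    then show ?thesis using False by (simp add: lsum_def y_def)
  qed simp
  ultimately show ?thesis by (metis ext)
qed

text \<open>A value larger in norm than one endpoint is reached by shrinking the other endpoint to
  it; the unshrunk endpoint restores the remaining coordinates. Values of small norm between
  endpoints of opposite signs come from shrinking the longer endpoint until the two cancel, which
  then happens at \<open>i\<close> alone.\<close>

lemma tcone_between:
  assumes S: "tcone S" and x: "x \<in> S" "x(i := w) \<in> S" and v: "x i \<le> v" "v \<le> w"
  shows "x(i := v) \<in> S"
proof -
  have x': "(x(i := w))(i := x i) \<in> S" using x by simp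
  consider "v = x i" | "v = w" | "x i < v" "v < w" using v by linarith
  then show ?thesis
  proof cases
    case 3
    consider "v > 0" "\<bar>x i\<bar> < v" | "v < 0" "\<bar>w\<bar> < \<bar>v\<bar>"
      | "x i < 0" "w > 0" "\<bar>v\<bar> \<le> \<bar>x i\<bar>" "\<bar>v\<bar> \<le> \<bar>w\<bar>" using 3 by linarith
    then show ?thesis
    proof cases
      case 1
      then show ?thesis using tcone_between_shrink[OF S x, of v] 3 by simp
    next
      case 2
      then show ?thesis using tcone_between_shrink[OF S x(2) x', of v] 3 by (simp add: mult_neg_neg)
    next
      case 3
      then have "x i * w < 0" "w * x i < 0" by (simp_all add: mult_neg_pos mult_pos_neg)
      then show ?thesis
        using tcone_between_elim[OF S x, of v] tcone_between_elim[OF S x(2) x', of v] 3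
        by (cases "\<bar>x i\<bar> \<le> \<bar>w\<bar>") simp_all
    qed
  qed (use x in simp_all)
qed

text \<open>The counterpart of \<open>tcone_between_shrink\<close> for a possibly balanced
  \<open>x\<close>. Here the shrunk member of \<open>S\<close> itself is the mask, so
  \<open>v\<close> has to dominate \<open>x i\<close>.\<close>

lemma relax_lsum_scaled:
  assumes S: "tcone S" and x: "(x, b) \<in> relax S i" and y: "x(i := w) \<in> S"
    and v: "\<bar>x i\<bar> \<le> \<bar>v\<bar>" "\<bar>v\<bar> \<le> \<bar>w\<bar>" "v * w > 0"
  shows "x(i := v) \<in> S"
proof -
  have w: "w \<noteq> 0" using v(3) by auto
  define c where "c = v / w"
  have c: "c > 0" "c * w = v"
    using v(3) w by (simp_all add: c_def zero_less_divide_iff zero_less_mult_iff)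
  have "\<bar>c\<bar> = \<bar>v\<bar> / \<bar>w\<bar>" unfolding c_def by (rule abs_divide)
  also have "\<dots> \<le> 1" using v(2) by (simp only: divide_le_eq_1) simp
  finally have c1: "c \<le> 1" by simp
  have "lsum (\<lambda>k. c * (x(i := w)) k) x \<in> S"
    by (rule relax_lsum[OF S x tcone_scale[OF S y c(1)]]) (use v c in simp)
  moreover have "lsum (\<lambda>k. c * (x(i := w)) k) x k = (x(i := v)) k" for k
  proof (cases "k = i")
    case True
    then show ?thesis using v c by (simp add: lsum_def)
  next
    case False
    have "\<bar>c * x k\<bar> < \<bar>x k\<bar> \<or> c * x k = x k"
      using c c1 by (cases "x k = 0 \<or> c = 1") (auto simp add: abs_mult)
    then show ?thesis using False by (auto simp add: lsum_def)
  qed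
  ultimately show ?thesis by (metis ext)
qed

text \<open>Hence a point outside \<open>S\<close> is missed by the upward or by the downward
  extension at \<open>i\<close>, which decides the sign of the unit vector to adjoin. The witnesses
  \<open>q\<close> and \<open>p\<close> agree with \<open>z\<close> off \<open>i\<close> and enclose
  \<open>z i\<close>. They cannot both be balanced, as this would make \<open>z i\<close> positive
  and negative; an unbalanced one lies in \<open>S\<close>, and \<open>z\<close> is interpolated on
  the coordinate line.\<close>

lemma up_ext_both:
  assumes S: "tcone S" and z: "z \<in> up_ext S i" "neg_at i z \<in> up_ext {x. neg_at i x \<in> S} i"
  shows "z \<in> S"
proof -
  from z(1) obtain q b where q: "(q, b) \<in> relax S i" "\<And>k. k \<noteq> i \<Longrightarrow> z k = q k" "q i \<le> z i"
    unfolding up_ext_def by blast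
  from z(2) obtain r b' where r: "(r, b') \<in> relax {x. neg_at i x \<in> S} i"
    "\<And>k. k \<noteq> i \<Longrightarrow> neg_at i z k = r k" "r i \<le> neg_at i z i"
    unfolding up_ext_def by blast
  note rp = relax_balanced_pos[OF r(1)]
  note qp = relax_balanced_pos[OF q(1)]
  define p where "p = (if b' then r else neg_at i r)"
  have p: "(p, b') \<in> relax S i" using relax_neg_at[OF r(1)] by (simp add: p_def)
  have poff: "z k = p k" if "k \<noteq> i" for k using r(2)[OF that] that by (simp add: p_def neg_at_def)
  have pi: "z i \<le> (if b' then - p i else p i)" using r(3) by (simp add: p_def neg_at_def)
  have zq: "z = q(i := z i)" using q(2) by auto
  have zp: "z = p(i := z i)" using poff by auto
  have qp_eq: "p = q(i := p i)" "q = p(i := q i)" using q(2) poff by auto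
  show ?thesis
  proof (cases b)
    case True
    then have "q i > 0" using qp by simp
    then have nb': "\<not> b'" using rp pi q(3) by (auto simp: p_def)
    then have "p \<in> S" using relax_unbalanced[OF S p] by simp
    then have "q(i := p i) \<in> S" using qp_eq by simp
    then have "q(i := z i) \<in> S"
      by (rule relax_lsum_scaled[OF S q(1)]) (use \<open>q i > 0\<close> nb' pi q(3) in auto)
    then show ?thesis using zq by simp
  next
    case nb: False
    then have qS: "q \<in> S" using relax_unbalanced[OF S q(1)] by simp
    show ?thesis
    proof (cases b')
      case True
      then have "p i > 0" using rp by (simp add: p_def)
      moreover have "p(i := q i) \<in> S" using qS qp_eq by simp
      then have "p(i := z i) \<in> S"
        by (rule relax_lsum_scaled[OF S p])
          (use \<open>p i > 0\<close> True pi q(3) in \<open>auto intro: mult_neg_neg\<close>)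
      then show ?thesis using zp by simp
    next
      case False
      then have "p \<in> S" using relax_unbalanced[OF S p] by simp
      then have "q(i := p i) \<in> S" using qp_eq by simp
      then have "q(i := z i) \<in> S"
        by (rule tcone_between[OF S qS]) (use False pi q(3) in auto)
      then show ?thesis using zq by simp
    qed
  qed
qed

section \<open>Adjoining unit vectors\<close>

definition uvec :: "'i \<Rightarrow> real \<Rightarrow> 'i \<Rightarrow> real" where
  "uvec i v = (\<lambda>k. if k = i then v else 0)"

lemma uvec_in_up_ext:
  assumes "tcone S" "0 \<le> v"
  shows "uvec i v \<in> up_ext S i"
  by (rule up_extI[OF relax.base[OF tcone_zero[OF assms(1)]]]) (use assms in \<open>simp_all add: uvec_def\<close>)

lemma tcone_extend_unit:
  assumes S: "tcone S" and z: "z \<notin> S"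
  obtains S' s where "S \<subseteq> S'" "tcone S'" "z \<notin> S'" "\<bar>s\<bar> = 1" "uvec i s \<in> S'"
proof (cases "z \<in> up_ext S i")
  case False
  show ?thesis
    by (rule that[OF up_ext_subset tcone_up_ext[OF S] False, of 1]) (simp_all add: uvec_in_up_ext[OF S])
next
  case True
  let ?S = "{x. neg_at i x \<in> S}"
  have S': "tcone ?S" by (rule tcone_neg_at[OF S])
  have nn: "neg_at i (neg_at i x) = x" for x by (simp add: neg_at_def fun_eq_iff)
  have "neg_at i z \<notin> up_ext ?S i" using up_ext_both[OF S True] z by blast
  moreover have "S \<subseteq> {x. neg_at i x \<in> up_ext ?S i}"
    using up_ext_subset[of ?S i] by (auto simp: nn)
  moreover have "neg_at i (uvec i (-1)) = uvec i 1" by (auto simp: neg_at_def uvec_def fun_eq_iff)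
  then have "uvec i (-1) \<in> {x. neg_at i x \<in> up_ext ?S i}" using uvec_in_up_ext[OF S', of 1 i] by simp
  ultimately show ?thesis
    using that[of "{x. neg_at i x \<in> up_ext ?S i}" "-1"] tcone_neg_at[OF tcone_up_ext[OF S'], of i i] by simp
qed

lemma tcone_extend_units:
  assumes "finite I" and S: "tcone S" and z: "z \<notin> S"
  shows "\<exists>S' s. S \<subseteq> S' \<and> tcone S' \<and> z \<notin> S' \<and> (\<forall>i. \<bar>s i\<bar> = 1) \<and> (\<forall>i\<in>I. uvec i (s i) \<in> S')"
  using assms(1)
proof (induction I)
  case empty
  show ?case by (rule exI[of _ S], rule exI[of _ "\<lambda>_. 1"]) (use S z in simp)
next
  case (insert i I)
  then obtain S' s where S': "S \<subseteq> S'" "tcone S'" "z \<notin> S'" "\<And>i. \<bar>s i\<bar> = 1" "\<And>i. i \<in> I \<Longrightarrow> uvec i (s i) \<in> S'"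
    by blast
  obtain S'' v where S'': "S' \<subseteq> S''" "tcone S''" "z \<notin> S''" "\<bar>v\<bar> = 1" "uvec i v \<in> S''"
    using tcone_extend_unit[OF S'(2,3)] by metis
  show ?case
    by (rule exI[of _ S''], rule exI[of _ "s(i := v)"]) (use S' S'' insert.hyps in auto)
qed

section \<open>Separation of points from tropical cones\<close>

text \<open>Supplies the value of the eliminated variable in both Fourier-Motzkin arguments, the
  tropical and the linear one.\<close>

lemma exists_between_finite:
  fixes A U :: "'a::{linorder, zero} set"
  assumes "finite A" "finite U" "\<And>l u. l \<in> A \<Longrightarrow> u \<in> U \<Longrightarrow> l \<le> u" "\<And>u. u \<in> U \<Longrightarrow> 0 \<le> u"
  shows "\<exists>t\<ge>0. (\<forall>l\<in>A. l \<le> t) \<and> (\<forall>u\<in>U. t \<le> u)"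
proof (intro exI conjI ballI)
  show "0 \<le> Max (insert 0 A)" using assms(1) by simp
  show "l \<le> Max (insert 0 A)" if "l \<in> A" for l using assms(1) that by simp
  show "Max (insert 0 A) \<le> u" if "u \<in> U" for u using assms that by simp
qed

text \<open>A largest term dominates for all indices at once. In this form every negative term is a
  condition of its own, which suits elimination.\<close>

lemma tnonneg_iff:
  fixes a x :: "'i::finite \<Rightarrow> real"
  shows "tnonneg a x \<longleftrightarrow> (\<forall>i. \<exists>m. - (a i * x i) \<le> a m * x m)"
proof
  assume "tnonneg a x"
  then obtain k where k: "\<And>i. \<bar>a i * x i\<bar> \<le> a k * x k" unfolding tnonneg_def by blast
  show "\<forall>i. \<exists>m. - (a i * x i) \<le> a m * x m"
  proof
    fix i show "\<exists>m. - (a i * x i) \<le> a m * x m" using k[of i] by (intro exI[of _ k]) linarith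
  qed
next
  assume *: "\<forall>i. \<exists>m. - (a i * x i) \<le> a m * x m"
  let ?R = "range (\<lambda>i. a i * x i)"
  have "Max ?R \<in> ?R" by (rule Max_in) auto
  then obtain k where k: "Max ?R = a k * x k" by blast
  have le: "a i * x i \<le> a k * x k" for i unfolding k[symmetric] by (rule Max_ge) auto
  have "\<bar>a i * x i\<bar> \<le> a k * x k" for i
  proof -
    obtain m where "- (a i * x i) \<le> a m * x m" using * by blast
    then show ?thesis using le[of m] le[of i] by linarith
  qed
  then show "tnonneg a x" unfolding tnonneg_def by blast
qed

lemma tnonneg_reflect: "tnonneg (reflect s a) x \<longleftrightarrow> tnonneg a (reflect s x)"
  by (simp add: tnonneg_def reflect_def mult_ac)

text \<open>An increase in norm is a left sum with a multiple of the unit vector. Otherwise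
  \<open>x l\<close> is negative, and \<open>v\<close> resolves the cancellation of \<open>x\<close>
  with \<open>- x l\<close> times the unit vector, which meets \<open>x\<close> at no other
  coordinate.\<close>

lemma tcone_raise_at:
  assumes S: "tcone S" and u: "uvec l 1 \<in> S" and x: "x \<in> S" and v: "x l \<le> v"
  shows "x(l := v) \<in> S"
proof (cases "v = x l")
  case False
  have eq: "(\<lambda>k. c * uvec l 1 k) = uvec l c" for c by (auto simp: uvec_def)
  have u: "uvec l c \<in> S" if "c > 0" for c
    using tcone_scale[OF S u that] unfolding eq .
  show ?thesis
  proof (cases "\<bar>x l\<bar> < \<bar>v\<bar>")
    case True
    then have "v > 0" using v by linarith
    then have "lsum x (uvec l v) \<in> S" by (intro tcone_lsum[OF S x] u)
    moreover have "lsum x (uvec l v) = x(l := v)"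
      using True by (auto simp: lsum_def uvec_def fun_eq_iff)
    ultimately show ?thesis by simp
  next
    case le: False
    have neg: "x l < 0" using False le v by linarith
    have "opp_only x (uvec l (- x l)) l" using neg by (auto simp: opp_only_def uvec_def)
    then have "(lsum x (uvec l (- x l)))(l := v) \<in> S"
      using tcone_elim[OF S x u[of "- x l"]] neg le by auto
    moreover have "(lsum x (uvec l (- x l)))(l := v) = x(l := v)"
      by (auto simp: lsum_def uvec_def fun_eq_iff)
    ultimately show ?thesis by simp
  qed
qed (use x in simp)

text \<open>The tropical sum with each balanced entry replaced by its largest resolution, the
  positive norm; a set closed under raising contains this resolution.\<close>

definition upper_sum :: "('i \<Rightarrow> real) \<Rightarrow> ('i \<Rightarrow> real) \<Rightarrow> 'i \<Rightarrow> real" where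
  "upper_sum x y k = badd (x k) False (y k) False"

lemma upper_sum_eq_lsum:
  "upper_sum x y k = (if y k = - x k then \<bar>x k\<bar> else lsum x y k)"
  unfolding upper_sum_def badd_def lsum_def by (smt (verit))

lemma badd_le_max: "badd w False w' False \<le> max w w'"
  unfolding badd_def by (smt (verit))

locale up_tcone =
  fixes S :: "('i::finite \<Rightarrow> real) set"
  assumes S: "tcone S" and unit_mem: "\<And>i. uvec i 1 \<in> S"
begin

lemma raise:
  assumes x: "x \<in> S" and le: "\<And>k. x k \<le> y k"
  shows "y \<in> S"
proof -
  have "(\<lambda>k. if k \<in> J then y k else x k) \<in> S" if "finite J" for J
    using that
  proof (induction J)
    case (insert j J)
    then have "(\<lambda>k. if k \<in> J then y k else x k)(j := y j) \<in> S"
      by (intro tcone_raise_at[OF S unit_mem]) (use le in auto)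
    moreover have "(\<lambda>k. if k \<in> J then y k else x k)(j := y j) = (\<lambda>k. if k \<in> insert j J then y k else x k)"
      by auto
    ultimately show ?case by simp
  qed (use x in simp)
  from this[of UNIV] show ?thesis by simp
qed

lemma nonneg_mem: "(\<And>k. 0 \<le> y k) \<Longrightarrow> y \<in> S"
  by (rule raise[OF tcone_zero[OF S]])

lemma upper_sum_mem:
  assumes "x \<in> S" "y \<in> S"
  shows "upper_sum x y \<in> S"
proof -
  let ?x = "\<lambda>k. if y k = - x k then \<bar>x k\<bar> else x k"
  have "?x \<in> S" by (rule raise[OF assms(1)]) auto
  then have "lsum ?x y \<in> S" by (rule tcone_lsum[OF S _ assms(2)])
  moreover have "lsum ?x y = upper_sum x y"
    by (auto simp: fun_eq_iff upper_sum_eq_lsum) (auto simp: lsum_def)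
  ultimately show ?thesis by simp
qed

text \<open>Cancellations away from \<open>j\<close> are removed beforehand by raising both vectors
  to the positive norm there, so that \<open>j\<close> is the only one left.\<close>

lemma upper_sum_elim:
  assumes "x \<in> S" "y \<in> S" "y j = - x j" "x j \<noteq> 0"
  shows "(upper_sum x y)(j := 0) \<in> S"
proof -
  let ?x = "\<lambda>k. if k \<noteq> j \<and> y k = - x k then \<bar>x k\<bar> else x k"
  let ?y = "\<lambda>k. if k \<noteq> j \<and> y k = - x k then \<bar>x k\<bar> else y k"
  have x: "?x \<in> S" by (rule raise[OF assms(1)]) auto
  have y: "?y \<in> S" by (rule raise[OF assms(2)]) auto
  have "opp_only ?x ?y j" unfolding opp_only_def using assms(3,4) by auto
  from tcone_elim[OF S x y this, of 0] have "(lsum ?x ?y)(j := 0) \<in> S" by simp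
  moreover have "(lsum ?x ?y)(j := 0) = (upper_sum x y)(j := 0)"
    by (auto simp: fun_eq_iff upper_sum_eq_lsum) (auto simp: lsum_def)
  ultimately show ?thesis by simp
qed

end

text \<open>A vector \<open>s\<close> together with a coefficient \<open>r\<close> of a constant: the pairs whose constant may be
  replaced by \<open>p\<close>.\<close>

definition liftable :: "('i \<Rightarrow> real) set \<Rightarrow> ('i \<Rightarrow> real) \<Rightarrow> ('i \<Rightarrow> real) \<Rightarrow> real \<Rightarrow> bool" where
  "liftable S p s r \<longleftrightarrow> 0 \<le> r \<and> lsum (\<lambda>i. r * p i) s \<in> S"

text \<open>For nonnegative \<open>r\<close> this is the condition of \<open>tnonneg_iff\<close> for
  \<open>s\<close> extended by a constant coordinate with entry \<open>r\<close> and coefficient 1.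
  The coefficients \<open>a\<close> are the unknowns of the elimination.\<close>

definition solves :: "('i \<Rightarrow> real) \<Rightarrow> ('i \<Rightarrow> real) \<Rightarrow> real \<Rightarrow> bool" where
  "solves a s r \<longleftrightarrow> (\<forall>i. - (a i * s i) \<le> r \<or> (\<exists>m. - (a i * s i) \<le> a m * s m))"

lemma solves_scale:
  assumes "c > 0" "solves a (\<lambda>i. c * s i) (c * r)"
  shows "solves a s r"
proof -
  have 1: "- (a i * (c * s i)) \<le> c * v \<longleftrightarrow> - (a i * s i) \<le> v" for i v
    using mult_le_cancel_left_pos[OF assms(1), of "- (a i * s i)" v] by (simp add: mult.left_commute)
  have 2: "- (a i * (c * s i)) \<le> a m * (c * s m) \<longleftrightarrow> - (a i * s i) \<le> a m * s m" for i m
    using 1[of i "a m * s m"] by (simp add: mult.left_commute)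
  show ?thesis using assms(2) unfolding solves_def 1 2 .
qed

lemma liftable_scale:
  assumes "tcone S" "liftable S p s r" "c > 0"
  shows "liftable S p (\<lambda>i. c * s i) (c * r)"
proof -
  have "(\<lambda>k. c * lsum (\<lambda>i. r * p i) s k) \<in> S"
    using tcone_scale[OF assms(1) _ assms(3)] assms(2) unfolding liftable_def by blast
  then have "lsum (\<lambda>k. c * (r * p k)) (\<lambda>k. c * s k) \<in> S" unfolding lsum_scale[OF assms(3)] .
  then show ?thesis using assms unfolding liftable_def by (simp add: mult.assoc)
qed

text \<open>Replacing the constant by \<open>p\<close> respects tropical addition up to an increase,
  and an increase is harmless in an upward closed set.\<close>

lemma lsum_badd_le:
  fixes A B s t :: real
  assumes "0 \<le> A" "0 \<le> B"
  defines "x \<equiv> (if \<bar>s\<bar> \<le> \<bar>A\<bar> then A else s)" and "y \<equiv> (if \<bar>t\<bar> \<le> \<bar>B\<bar> then B else t)"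
    and "u \<equiv> badd s False t False"
  shows "badd x False y False \<le> (if \<bar>u\<bar> \<le> \<bar>max A B\<bar> then max A B else u)"
  using assms(1,2) unfolding assms(3-) badd_def by (smt (verit))

section \<open>Fourier-Motzkin elimination in an upward closed cone\<close>

context up_tcone
begin

lemma liftable_drop:
  assumes h: "liftable S p t r" and p: "\<And>i. 0 \<le> p i" and t: "t j \<le> 0"
  shows "liftable S p (t(j := 0)) r"
proof -
  have r: "0 \<le> r" using h by (simp add: liftable_def)
  have "lsum (\<lambda>i. r * p i) (t(j := 0)) \<in> S"
  proof (rule raise[of "lsum (\<lambda>i. r * p i) t"])
    show "lsum (\<lambda>i. r * p i) t \<in> S" using h by (simp add: liftable_def)
    fix k
    have "0 \<le> r * p k" using r p by simp
    then show "lsum (\<lambda>i. r * p i) t k \<le> lsum (\<lambda>i. r * p i) (t(j := 0)) k"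
      using t by (cases "k = j") (simp_all add: lsum_def)
  qed
  then show ?thesis using r by (simp add: liftable_def)
qed

lemma liftable_elim:
  assumes h: "liftable S p s r" "liftable S p t r'" and p: "\<And>i. 0 \<le> p i" and j: "s j = 1" "t j = - 1"
  shows "liftable S p ((upper_sum s t)(j := 0)) (max r r')"
proof -
  define x y where "x = lsum (\<lambda>i. r * p i) s" and "y = lsum (\<lambda>i. r' * p i) t"
  have xy: "x \<in> S" "y \<in> S" and r: "0 \<le> r" "0 \<le> r'" using h by (simp_all add: liftable_def x_def y_def)
  let ?w = "lsum (\<lambda>i. max r r' * p i) ((upper_sum s t)(j := 0))"
  have m: "max r r' * p i = max (r * p i) (r' * p i)" for i
    using p[of i] by (simp add: max_mult_distrib_right)
  have nn: "0 \<le> r * p i" "0 \<le> r' * p i" for i using r p by simp_all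
  have off: "upper_sum x y i \<le> ?w i" if "i \<noteq> j" for i
  proof -
    have u: "((upper_sum s t)(j := 0)) i = badd (s i) False (t i) False" using that by (simp add: upper_sum_def)
    have e: "upper_sum x y i = badd (x i) False (y i) False" by (rule upper_sum_def)
    show ?thesis using lsum_badd_le[OF nn(1)[of i] nn(2)[of i], of "s i" "t i"]
      unfolding e lsum_def u m unfolding x_def y_def lsum_def .
  qed
  have wj: "?w j = max (r * p j) (r' * p j)" unfolding m using nn[of j] by (simp add: lsum_def le_max_iff_disj)
  have xj: "x j = (if 1 \<le> r * p j then r * p j else 1)" "y j = (if 1 \<le> r' * p j then r' * p j else - 1)"
    unfolding x_def y_def lsum_def using j nn[of j] by simp_all
  have "?w \<in> S"
  \<comment> \<open>If neither constant covers the unit entry at \<open>j\<close>, the two lifts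
    really cancel there. Otherwise the lifted constant already bounds their sum at \<open>j\<close>
    and no elimination takes place.\<close>
  proof (cases "r * p j < 1 \<and> r' * p j < 1")
    case True
    then have "(upper_sum x y)(j := 0) \<in> S" by (intro upper_sum_elim[OF xy]) (use xj in simp_all)
    then show ?thesis
      by (rule raise) (use off wj nn[of j] in auto)
  next
    case False
    then have "upper_sum x y j \<le> ?w j"
      unfolding wj upper_sum_def xj badd_def by (smt (verit))
    then have "upper_sum x y k \<le> ?w k" for k using off by (cases "k = j") auto
    then show ?thesis using raise[OF upper_sum_mem[OF xy]] by blast
  qed
  then show ?thesis using r by (simp add: liftable_def)
qed

text \<open>When only \<open>k\<close> is left, its coefficient must exceed
  \<open>1 / \<kappa>\<close> and be at most \<open>r / (- s k)\<close>. If these conditions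
  clashed, the lift of \<open>(s, r)\<close>, scaled to the entry \<open>- \<kappa>\<close> at
  \<open>k\<close>, would lie below \<open>p(k := - \<kappa>)\<close> and force this point into
  \<open>S\<close>.\<close>

lemma fourier_motzkin_base:
  assumes p: "\<And>i. 0 \<le> p i" "p k = 0" and \<kappa>: "\<kappa> > 0" and z: "p(k := - \<kappa>) \<notin> S"
    and h: "liftable S p s r" and s: "\<And>i. i \<noteq> k \<Longrightarrow> s i = 0" and sk: "s k < 0"
  shows "1 / \<kappa> < r / (- s k)"
proof (rule ccontr)
  assume "\<not> ?thesis"
  then have le: "r * \<kappa> \<le> - s k" using \<kappa> sk by (simp add: field_simps)
  define c where "c = \<kappa> / (- s k)"
  have c: "c > 0" "c * s k = - \<kappa>" "c * r \<le> 1" using \<kappa> sk le by (simp_all add: c_def field_simps)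
  have "(\<lambda>i. c * lsum (\<lambda>i. r * p i) s i) \<in> S"
    using h by (intro tcone_scale[OF S _ c(1)]) (simp add: liftable_def)
  then have "p(k := - \<kappa>) \<in> S"
  proof (rule raise)
    fix i
    show "c * lsum (\<lambda>i. r * p i) s i \<le> (p(k := - \<kappa>)) i"
    proof (cases "i = k")
      case True
      then show ?thesis using p(2) sk c by (simp add: lsum_def)
    next
      case False
      have "c * (r * p i) \<le> p i" using mult_right_mono[OF c(3) p(1)[of i]] by (simp add: mult.assoc)
      then show ?thesis using False s by (simp add: lsum_def)
    qed
  qed
  then show False using z by blast
qed

text \<open>Suppose that the lower bound \<open>\<beta> = - (b i * s i)\<close> imposed by
  \<open>s\<close> on the coefficient of \<open>j\<close> exceeded the upper bound imposed by
  \<open>t\<close>. Then the negative term at \<open>i\<close> would survive in the upper sum, while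
  its positive terms and the constant stay below \<open>\<beta>\<close>, and the combined pair would
  not be solved.\<close>

lemma fourier_motzkin_bound:
  assumes b: "\<And>i. 0 \<le> b i" and j: "s j = 1" "t j = - 1" and r: "0 \<le> r" "0 \<le> r'"
    and solves: "solves b ((upper_sum s t)(j := 0)) (max r r')"
    and i: "i \<noteq> j" and bad: "r < - (b i * s i)" "\<And>m. m \<noteq> j \<Longrightarrow> b m * s m < - (b i * s i)"
  shows "- (b i * s i) \<le> r' \<or> (\<exists>m. m \<noteq> j \<and> - (b i * s i) \<le> b m * t m)"
proof (rule ccontr)
  define \<beta> where "\<beta> = - (b i * s i)"
  assume "\<not> ?thesis"
  then have t: "r' < \<beta>" "\<And>m. m \<noteq> j \<Longrightarrow> b m * t m < \<beta>" unfolding \<beta>_def by force+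
  have s: "r < \<beta>" "\<And>m. m \<noteq> j \<Longrightarrow> b m * s m < \<beta>" using bad unfolding \<beta>_def by blast+
  have "\<beta> > 0" using s(1) r by simp
  then have bi: "b i > 0" using b[of i] by (cases "b i = 0") (auto simp: \<beta>_def less_le)
  have si: "s i < 0" using \<open>\<beta> > 0\<close> bi by (simp add: \<beta>_def zero_less_mult_iff mult_less_0_iff)
  have "b i * t i < b i * (- s i)" using t(2)[OF i] by (simp add: \<beta>_def)
  then have ti: "t i < - s i" using bi by (simp only: mult_less_cancel_left_pos)
  have "upper_sum s t i \<le> s i" unfolding upper_sum_def badd_def using si ti by (smt (verit))
  then have "b i * upper_sum s t i \<le> b i * s i" using bi by simp
  then have ui: "\<beta> \<le> - (b i * ((upper_sum s t)(j := 0)) i)" using i by (simp add: \<beta>_def)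
  have "b m * ((upper_sum s t)(j := 0)) m < \<beta>" for m
  proof (cases "m = j")
    case True
    then show ?thesis using \<open>\<beta> > 0\<close> by simp
  next
    case False
    have "b m * upper_sum s t m \<le> b m * max (s m) (t m)"
      by (rule mult_left_mono[OF _ b]) (simp add: upper_sum_def badd_le_max)
    then show ?thesis using s(2)[OF False] t(2)[OF False] False by (auto simp: max_def split: if_splits)
  qed
  moreover have "max r r' < \<beta>" using s t by simp
  ultimately show False using solves ui unfolding solves_def by (meson le_less_trans not_le order_trans)
qed

lemma fourier_motzkin_step:
  fixes b :: "'i \<Rightarrow> real"
  assumes b: "\<And>i. 0 \<le> b i" and F: "finite F" and r: "\<And>s r. (s, r) \<in> F \<Longrightarrow> 0 \<le> r"
    and norm: "\<And>s r. (s, r) \<in> F \<Longrightarrow> s j = 0 \<or> s j = 1 \<or> s j = - 1"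
    and zero: "\<And>s r. (s, r) \<in> F \<Longrightarrow> s j = 0 \<Longrightarrow> solves b s r"
    and neg: "\<And>s r. (s, r) \<in> F \<Longrightarrow> s j = - 1 \<Longrightarrow> solves b (s(j := 0)) r"
    and pair: "\<And>s r t r'. (s, r) \<in> F \<Longrightarrow> (t, r') \<in> F \<Longrightarrow> s j = 1 \<Longrightarrow> t j = - 1 \<Longrightarrow>
      solves b ((upper_sum s t)(j := 0)) (max r r')"
  shows "\<exists>\<eta>\<ge>0. \<forall>(s, r)\<in>F. solves (b(j := \<eta>)) s r"
proof -
  \<comment> \<open>Lower bounds for \<open>\<eta>\<close>: negative terms of vectors with entry 1
    at \<open>j\<close> that only the new term can dominate.\<close>
  define A where "A = {- (b i * s i) | i s r. (s, r) \<in> F \<and> s j = 1 \<and> i \<noteq> j \<and> r < - (b i * s i) \<and>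
    (\<forall>m. m \<noteq> j \<longrightarrow> b m * s m < - (b i * s i))}"
  \<comment> \<open>Upper bounds for \<open>\<eta>\<close>: if the entry at \<open>j\<close> is -1,
    the new term is negative and must be dominated by another term or by the constant.\<close>
  define \<pi> where "\<pi> t r' = Max (insert r' ((\<lambda>m. b m * t m) ` (- {j})))" for t r'
  define U where "U = {\<pi> t r' | t r'. (t, r') \<in> F \<and> t j = - 1}"
  have "A \<subseteq> (\<lambda>(i, s, r). - (b i * s i)) ` (UNIV \<times> F)" unfolding A_def by force
  then have "finite A" using F by (meson finite_SigmaI finite_imageI finite_subset finite)
  moreover have "U \<subseteq> (\<lambda>(t, r). \<pi> t r) ` F" unfolding U_def by force
  then have "finite U" using F by (meson finite_imageI finite_subset)
  moreover have "l \<le> u" if lA: "l \<in> A" and uU: "u \<in> U" for l u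
  proof -
    obtain i s q where s: "l = - (b i * s i)" "(s, q) \<in> F" "s j = 1" "i \<noteq> j" "q < - (b i * s i)"
      "\<And>m. m \<noteq> j \<Longrightarrow> b m * s m < - (b i * s i)" using lA unfolding A_def by blast
    obtain t q' where t: "u = \<pi> t q'" "(t, q') \<in> F" "t j = - 1" using uU unfolding U_def by blast
    have "- (b i * s i) \<le> q' \<or> (\<exists>m. m \<noteq> j \<and> - (b i * s i) \<le> b m * t m)"
      by (rule fourier_motzkin_bound[OF b s(3) t(3) r[OF s(2)] r[OF t(2)] pair[OF s(2) t(2) s(3) t(3)] s(4-6)])
    moreover have "q' \<le> \<pi> t q'" "m \<noteq> j \<Longrightarrow> b m * t m \<le> \<pi> t q'" for m
      unfolding \<pi>_def by (rule Max_ge; simp)+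
    ultimately show ?thesis unfolding s(1) t(1) by (meson order_trans)
  qed
  moreover have "0 \<le> u" if uU: "u \<in> U" for u
  proof -
    obtain t q' where t: "u = \<pi> t q'" "(t, q') \<in> F" using uU unfolding U_def by blast
    have "q' \<le> \<pi> t q'" unfolding \<pi>_def by (rule Max_ge) simp_all
    then show ?thesis using r[OF t(2)] t(1) by simp
  qed
  ultimately obtain \<eta> where \<eta>: "0 \<le> \<eta>" "\<And>l. l \<in> A \<Longrightarrow> l \<le> \<eta>" "\<And>u. u \<in> U \<Longrightarrow> \<eta> \<le> u"
    using exists_between_finite[of A U] by blast
  have "solves (b(j := \<eta>)) s q" if sF: "(s, q) \<in> F" for s q
  proof -
    consider "s j = 0" | "s j = 1" | "s j = - 1" using norm[OF sF] by blast
    then show ?thesis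
    proof cases
      case 1
      then have eq: "(b(j := \<eta>)) i * s i = b i * s i" for i by (cases "i = j") simp_all
      show ?thesis using zero[OF sF 1] unfolding solves_def eq .
    next
      case 2
      show ?thesis unfolding solves_def
      proof
        fix i
        show "- ((b(j := \<eta>)) i * s i) \<le> q \<or> (\<exists>m. - ((b(j := \<eta>)) i * s i) \<le> (b(j := \<eta>)) m * s m)"
        proof (cases "i = j")
          case True
          then have "- ((b(j := \<eta>)) i * s i) \<le> q" using 2 \<eta>(1) r[OF sF] by simp
          then show ?thesis ..
        next
          case i: False
          show ?thesis
          proof (cases "- (b i * s i) \<in> A")
            case True
            then have "- ((b(j := \<eta>)) i * s i) \<le> (b(j := \<eta>)) j * s j" using \<eta>(2) 2 i by simp
            then show ?thesis by blast
          next
            case False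
            then have "- (b i * s i) \<le> q \<or> (\<exists>m. m \<noteq> j \<and> - (b i * s i) \<le> b m * s m)"
              using sF 2 i unfolding A_def by (simp add: not_less[symmetric]) blast
            then show ?thesis using i by auto
          qed
        qed
      qed
    next
      case 3
      have "\<eta> \<le> \<pi> s q" using \<eta>(3) sF 3 unfolding U_def by blast
      moreover have "\<pi> s q \<in> insert q ((\<lambda>m. b m * s m) ` (- {j}))" unfolding \<pi>_def by (rule Max_in) simp_all
      ultimately have \<eta>le: "\<eta> \<le> q \<or> (\<exists>m. m \<noteq> j \<and> \<eta> \<le> b m * s m)" by auto
      show ?thesis unfolding solves_def
      proof
        fix i
        show "- ((b(j := \<eta>)) i * s i) \<le> q \<or> (\<exists>m. - ((b(j := \<eta>)) i * s i) \<le> (b(j := \<eta>)) m * s m)"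
        proof (cases "i = j")
          case True
          then show ?thesis using \<eta>le 3 by auto
        next
          case i: False
          have "- (b i * s i) \<le> q \<or> (\<exists>m. - (b i * s i) \<le> b m * (s(j := 0)) m)"
            using neg[OF sF 3] i unfolding solves_def by (metis fun_upd_other)
          then have "- (b i * s i) \<le> q \<or> (\<exists>m. m \<noteq> j \<and> - (b i * s i) \<le> b m * s m)"
            using r[OF sF] by (metis fun_upd_other fun_upd_same mult_zero_right order_trans)
          then show ?thesis using i by auto
        qed
      qed
    qed
  qed
  then show ?thesis using \<eta>(1) by blast
qed

text \<open>Induction on the variables \<open>J\<close> besides \<open>k\<close>, over all finite
  systems. The bound on \<open>a k\<close> makes the negative term of the excluded point exceed the
  coefficient 1 of the constant.\<close>

lemma fourier_motzkin:
  assumes p: "\<And>i. 0 \<le> p i" "p k = 0" and \<kappa>: "\<kappa> > 0" and z: "p(k := - \<kappa>) \<notin> S"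
    and "finite J" "finite F" "k \<notin> J"
    and h: "\<And>s r. (s, r) \<in> F \<Longrightarrow> liftable S p s r"
    and supp: "\<And>s r i. (s, r) \<in> F \<Longrightarrow> i \<notin> J \<Longrightarrow> i \<noteq> k \<Longrightarrow> s i = 0"
  shows "\<exists>a. (\<forall>i. 0 \<le> a i) \<and> 1 < a k * \<kappa> \<and> (\<forall>(s, r)\<in>F. solves a s r)"
  using assms(5-)
proof (induction J arbitrary: F)
  case empty
  \<comment> \<open>\<open>2 / \<kappa>\<close> is a default that keeps \<open>C\<close> nonempty if
    no pair bounds the coefficient of \<open>k\<close>; it also exceeds
    \<open>1 / \<kappa>\<close>.\<close>
  define C where "C = insert (2 / \<kappa>) ((\<lambda>f. snd f / (- fst f k)) ` {f \<in> F. fst f k < 0})"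
  have C: "finite C" "C \<noteq> {}" using empty.prems(1) by (simp_all add: C_def)
  have gt: "1 / \<kappa> < c" if cC: "c \<in> C" for c
  proof -
    consider "c = 2 / \<kappa>" | f where "f \<in> F" "fst f k < 0" "c = snd f / (- fst f k)"
      using cC unfolding C_def by blast
    then show ?thesis
    proof cases
      case 1
      then show ?thesis using \<kappa> by (simp add: divide_strict_right_mono)
    next
      case 2
      show ?thesis unfolding 2(3)
        by (rule fourier_motzkin_base[where s = "fst f" and r = "snd f", OF p \<kappa> z _ _ 2(2)]) (use 2(1) empty.prems(3,4)[of "fst f" "snd f"] in simp_all)
    qed
  qed
  define m where "m = Min C"
  have m: "1 / \<kappa> < m" unfolding m_def using C gt Min_in by blast
  then have m0: "0 < m" using \<kappa> by (meson divide_pos_pos less_trans zero_less_one)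
  have "solves (uvec k m) s r" if sr: "(s, r) \<in> F" for s r
    unfolding solves_def
  proof
    fix i
    have r: "0 \<le> r" using empty.prems(3)[OF sr] by (simp add: liftable_def)
    have "- (uvec k m i * s i) \<le> r"
    proof (cases "i = k \<and> s k < 0")
      case True
      then have "r / (- s k) \<in> C" unfolding C_def using sr by force
      then have "m \<le> r / (- s k)" unfolding m_def using C by simp
      then have "m * (- s k) \<le> r" using True by (simp only: pos_le_divide_eq neg_0_less_iff_less)
      then show ?thesis using True by (simp add: uvec_def)
    next
      case False
      then have "0 \<le> uvec k m i * s i" using m0 by (auto simp: uvec_def)
      then show ?thesis using r by linarith
    qed
    then show "- (uvec k m i * s i) \<le> r \<or> (\<exists>n. - (uvec k m i * s i) \<le> uvec k m n * s n)" ..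
  qed
  moreover have "1 < m * \<kappa>" using m \<kappa> by (simp add: pos_divide_less_eq)
  ultimately show ?case using m0 by (intro exI[of _ "uvec k m"]) (auto simp: uvec_def)
next
  case (insert j J)
  have kj: "j \<noteq> k" "k \<notin> J" using insert.prems by auto
  \<comment> \<open>Entries of absolute value 1 at \<open>j\<close> make any positive entry cancel
    any negative one exactly.\<close>
  define nrm where "nrm = (\<lambda>(s, r::real). if s j = 0 then (s, r) else (\<lambda>i. (1 / \<bar>s j\<bar>) * s i, (1 / \<bar>s j\<bar>) * r))"
  define G where "G = nrm ` F"
  have G: "finite G" using insert.prems unfolding G_def by simp
  have Gh: "liftable S p s r" "s j = 0 \<or> s j = 1 \<or> s j = - 1" "\<And>i. i \<notin> insert j J \<Longrightarrow> i \<noteq> k \<Longrightarrow> s i = 0"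
    if sr: "(s, r) \<in> G" for s r
  proof -
    obtain s' r' where f: "(s', r') \<in> F" "(s, r) = nrm (s', r')" using sr unfolding G_def by auto
    have h': "liftable S p s' r'" "\<And>i. i \<notin> insert j J \<Longrightarrow> i \<noteq> k \<Longrightarrow> s' i = 0"
      using insert.prems(3,4)[OF f(1)] by blast+
    have "liftable S p s r \<and> (s j = 0 \<or> s j = 1 \<or> s j = - 1) \<and> (\<forall>i. i \<notin> insert j J \<longrightarrow> i \<noteq> k \<longrightarrow> s i = 0)"
    proof (cases "s' j = 0")
      case True
      then show ?thesis using f(2) h' by (simp add: nrm_def)
    next
      case False
      then have e: "s = (\<lambda>i. (1 / \<bar>s' j\<bar>) * s' i)" "r = (1 / \<bar>s' j\<bar>) * r'" using f(2) by (simp_all add: nrm_def)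
      have "liftable S p s r" unfolding e by (rule liftable_scale[OF S h'(1)]) (use False in simp)
      moreover have "s j = 1 \<or> s j = - 1" unfolding e using False by (auto simp: abs_if)
      ultimately show ?thesis using h'(2) by (simp add: e(1))
    qed
    then show "liftable S p s r" "s j = 0 \<or> s j = 1 \<or> s j = - 1"
      "\<And>i. i \<notin> insert j J \<Longrightarrow> i \<noteq> k \<Longrightarrow> s i = 0" by blast+
  qed
  \<comment> \<open>The eliminated system. A negative entry at \<open>j\<close> may be dropped,
    which raises the vector. Vectors with a positive entry occur only combined with negative ones,
    since on their own they are solved by a large coefficient of \<open>j\<close>.\<close>
  define Z where "Z = {f \<in> G. fst f j = 0}"
  define N where "N = (\<lambda>f. ((fst f)(j := 0), snd f)) ` {f \<in> G. fst f j = - 1}"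
  define E where "E = (\<lambda>(f, g). ((upper_sum (fst f) (fst g))(j := 0), max (snd f) (snd g))) `
    ({f \<in> G. fst f j = 1} \<times> {f \<in> G. fst f j = - 1})"
  have fin: "finite (Z \<union> N \<union> E)" using G unfolding Z_def N_def E_def by simp
  have memb: "liftable S p s r \<and> (\<forall>i. i \<notin> J \<longrightarrow> i \<noteq> k \<longrightarrow> s i = 0)" if sr: "(s, r) \<in> Z \<union> N \<union> E" for s r
  proof -
    consider "(s, r) \<in> Z" | "(s, r) \<in> N" | "(s, r) \<in> E" using sr by blast
    then consider "(s, r) \<in> G" "s j = 0" | t where "(t, r) \<in> G" "t j = - 1" "s = t(j := 0)"
      | u q t q' where "(u, q) \<in> G" "(t, q') \<in> G" "u j = 1" "t j = - 1" "s = (upper_sum u t)(j := 0)" "r = max q q'"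
    proof cases
      case 1
      then show thesis using that(1) unfolding Z_def by auto
    next
      case 2
      then obtain f where f: "f \<in> G" "fst f j = - 1" "s = (fst f)(j := 0)" "r = snd f" unfolding N_def by blast
      have "(fst f, r) \<in> G" unfolding f(4) using f(1) by simp
      then show thesis by (rule that(2)[of "fst f", OF _ f(2,3)])
    next
      case 3
      then obtain w where w: "w \<in> {f \<in> G. fst f j = 1} \<times> {f \<in> G. fst f j = - 1}"
        "(s, r) = (case w of (f, g) \<Rightarrow> ((upper_sum (fst f) (fst g))(j := 0), max (snd f) (snd g)))"
        unfolding E_def by (rule imageE)
      obtain f g where fg: "w = (f, g)" by (cases w)
      have f: "f \<in> G" "g \<in> G" "fst f j = 1" "fst g j = - 1" using w(1) unfolding fg by simp_all
      have f': "s = (upper_sum (fst f) (fst g))(j := 0)" "r = max (snd f) (snd g)"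
        using w(2) unfolding fg prod.case prod.inject by blast+
      have "(fst f, snd f) \<in> G" "(fst g, snd g) \<in> G" using f(1,2) by simp_all
      then show thesis by (rule that(3)[of "fst f" "snd f" "fst g" "snd g", OF _ _ f(3,4) f'])
    qed
    then show ?thesis
    proof cases
      case 1
      have "s i = 0" if "i \<notin> J" "i \<noteq> k" for i
        using Gh(3)[OF 1(1), of i] 1(2) that by (cases "i = j") simp_all
      then show ?thesis using Gh(1)[OF 1(1)] by blast
    next
      case 2
      have "liftable S p s r" unfolding 2(3) by (rule liftable_drop[OF Gh(1)[OF 2(1)] p(1)]) (use 2 in simp)
      then show ?thesis using Gh(3)[OF 2(1)] 2(3) by simp
    next
      case 3
      have "liftable S p s r" unfolding 3(5,6) by (rule liftable_elim[OF Gh(1)[OF 3(1)] Gh(1)[OF 3(2)] p(1) 3(3,4)])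
      then show ?thesis
        using Gh(3)[OF 3(1)] Gh(3)[OF 3(2)] 3(5) by (simp add: upper_sum_def badd_def)
    qed
  qed
  obtain b where b: "\<And>i. 0 \<le> b i" "1 < b k * \<kappa>" "\<And>s r. (s, r) \<in> Z \<union> N \<union> E \<Longrightarrow> solves b s r"
  proof -
    have "\<exists>a. (\<forall>i. 0 \<le> a i) \<and> 1 < a k * \<kappa> \<and> (\<forall>(s, r)\<in>Z \<union> N \<union> E. solves a s r)"
      by (rule insert.IH[OF fin kj(2)]) (use memb in blast)+
    then show thesis using that by blast
  qed
  have "\<exists>\<eta>\<ge>0. \<forall>(s, r)\<in>G. solves (b(j := \<eta>)) s r"
  proof (rule fourier_motzkin_step[OF b(1) G])
    fix s r assume sr: "(s, r) \<in> G"
    show "0 \<le> r" using Gh(1)[OF sr] by (simp add: liftable_def)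
    show "s j = 0 \<or> s j = 1 \<or> s j = - 1" by (rule Gh(2)[OF sr])
    show "solves b s r" if "s j = 0" using b(3)[of s r] sr that by (simp add: Z_def)
    show "solves b (s(j := 0)) r" if sj: "s j = - 1"
    proof (rule b(3))
      have "(s(j := 0), r) \<in> N" unfolding N_def using sr sj by force
      then show "(s(j := 0), r) \<in> Z \<union> N \<union> E" by blast
    qed
    show "solves b ((upper_sum s t)(j := 0)) (max r r')" if t: "(t, r') \<in> G" "s j = 1" "t j = - 1" for t r'
    proof (rule b(3))
      have "((upper_sum s t)(j := 0), max r r') \<in> E" unfolding E_def using sr t by force
      then show "((upper_sum s t)(j := 0), max r r') \<in> Z \<union> N \<union> E" by blast
    qed
  qed
  then obtain \<eta> where \<eta>: "0 \<le> \<eta>" "\<And>s r. (s, r) \<in> G \<Longrightarrow> solves (b(j := \<eta>)) s r" by blast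
  have "solves (b(j := \<eta>)) s r" if sr: "(s, r) \<in> F" for s r
  proof (cases "s j = 0")
    case True
    have "nrm (s, r) \<in> G" unfolding G_def using sr by (rule imageI)
    then have "(s, r) \<in> G" using True by (simp add: nrm_def)
    then show ?thesis by (rule \<eta>(2))
  next
    case False
    have eq: "nrm (s, r) = (\<lambda>i. (1 / \<bar>s j\<bar>) * s i, (1 / \<bar>s j\<bar>) * r)" using False by (simp add: nrm_def)
    have "nrm (s, r) \<in> G" unfolding G_def using sr by (rule imageI)
    from \<eta>(2)[OF this[unfolded eq]] show ?thesis by (rule solves_scale[rotated]) (use False in simp)
  qed
  moreover have "\<forall>i. 0 \<le> (b(j := \<eta>)) i" "1 < (b(j := \<eta>)) k * \<kappa>" using b(1,2) \<eta>(1) kj by simp_all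
  ultimately show ?case by blast
qed

text \<open>The vectors that keep only one negative entry of \<open>z\<close> each restore
  \<open>z\<close> by left sums, so they cannot all belong to \<open>S\<close>.\<close>

lemma single_negative:
  assumes z: "z \<notin> S"
  obtains k where "z k < 0" "(\<lambda>i. if i = k then z k else max (z i) 0) \<notin> S"
proof (rule ccontr)
  assume "\<not> thesis"
  note nothesis = this that
  have *: "(\<lambda>i. if i = k then z k else max (z i) 0) \<in> S" if "z k < 0" for k
    using that nothesis by blast
  have "(\<lambda>i. if z i < 0 \<and> i \<notin> B then 0 else z i) \<in> S" if "finite B" for B
    using that
  proof (induction B)
    case empty
    show ?case by (rule nonneg_mem) auto
  next
    case (insert k B)
    show ?case
    proof (cases "z k < 0")
      case True
      have "lsum (\<lambda>i. if z i < 0 \<and> i \<notin> B then 0 else z i) (\<lambda>i. if i = k then z k else max (z i) 0) \<in> S"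
        by (rule tcone_lsum[OF S insert.IH *[OF True]])
      moreover have "lsum (\<lambda>i. if z i < 0 \<and> i \<notin> B then 0 else z i) (\<lambda>i. if i = k then z k else max (z i) 0)
          = (\<lambda>i. if z i < 0 \<and> i \<notin> insert k B then 0 else z i)"
        using True insert.hyps by (auto simp: lsum_def fun_eq_iff)
      ultimately show ?thesis by simp
    next
      case False
      then have "(\<lambda>i. if z i < 0 \<and> i \<notin> B then 0 else z i) = (\<lambda>i. if z i < 0 \<and> i \<notin> insert k B then 0 else z i)"
        by auto
      then show ?thesis using insert.IH by simp
    qed
  qed
  from this[of UNIV] show False using z by simp
qed

lemma separation:
  assumes F: "finite F" "F \<subseteq> S" and z: "z \<notin> S"
  shows "\<exists>a. (\<forall>f\<in>F. tnonneg a f) \<and> \<not> tnonneg a z"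
proof -
  obtain k where k: "z k < 0" "(\<lambda>i. if i = k then z k else max (z i) 0) \<notin> S"
    using single_negative[OF z] .
  define p where "p = (\<lambda>i. if i = k then 0 else max (z i) 0)"
  have p: "\<And>i. 0 \<le> p i" "p k = 0" by (simp_all add: p_def)
  have "p(k := - (- z k)) = (\<lambda>i. if i = k then z k else max (z i) 0)" by (auto simp: p_def)
  then have pz: "p(k := - (- z k)) \<notin> S" using k(2) by simp
  \<comment> \<open>The pairs with constant 0 are the inequalities for \<open>F\<close>. The pair
    with entry \<open>- p i\<close> and constant 1 demands \<open>a i * p i \<le> 1\<close>; its
    lift is \<open>p\<close> itself, which is nonnegative and hence in \<open>S\<close>.\<close>
  define G where "G = (\<lambda>f. (f, 0)) ` F \<union> range (\<lambda>i. (uvec i (- p i), 1::real))"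
  have "\<exists>a. (\<forall>i. 0 \<le> a i) \<and> 1 < a k * (- z k) \<and> (\<forall>(s, r)\<in>G. solves a s r)"
  proof (rule fourier_motzkin[OF p _ pz, of "UNIV - {k}"])
    show "finite G" using F by (simp add: G_def)
    fix s r assume "(s, r) \<in> G"
    then consider "s \<in> F" "r = 0" | i where "s = uvec i (- p i)" "r = 1" unfolding G_def by auto
    then show "liftable S p s r"
    proof cases
      case 1
      have "lsum (\<lambda>i. 0) s = s" by (auto simp: lsum_def fun_eq_iff)
      then show ?thesis using 1 F by (auto simp: liftable_def)
    next
      case 2
      have "lsum p s = p" unfolding 2 by (auto simp: lsum_def uvec_def fun_eq_iff)
      then show ?thesis using 2 nonneg_mem[OF p(1)] by (simp add: liftable_def)
    qed
  qed (use k in auto)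
  then obtain a where a: "\<And>i. 0 \<le> a i" "1 < a k * (- z k)" and solves: "\<And>s r. (s, r) \<in> G \<Longrightarrow> solves a s r"
    by blast
  have "tnonneg a f" if "f \<in> F" for f
    unfolding tnonneg_iff
  proof
    fix i
    have "solves a f 0" using solves that by (simp add: G_def)
    then have "- (a i * f i) \<le> 0 \<or> (\<exists>m. - (a i * f i) \<le> a m * f m)" unfolding solves_def by blast
    then show "\<exists>m. - (a i * f i) \<le> a m * f m"
    proof
      assume "- (a i * f i) \<le> 0"
      then show ?thesis by (intro exI[of _ i]) simp
    qed
  qed
  \<comment> \<open>The positive terms of \<open>z\<close> are at most 1, whereas its negative term
    at \<open>k\<close> exceeds 1 in norm.\<close>
  moreover have "\<not> tnonneg a z"
  proof
    assume "tnonneg a z"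
    then obtain m where m: "\<And>i. \<bar>a i * z i\<bar> \<le> a m * z m" unfolding tnonneg_def by blast
    have gt: "1 < a m * z m" using m[of k] a(2) by linarith
    have mk: "m \<noteq> k" using gt k(1) a(1)[of k] by (metis mult_nonneg_nonpos less_imp_le not_le order_trans zero_le_one not_less)
    have "z m > 0" using gt a(1)[of m] by (metis mult_nonneg_nonpos not_le order_trans zero_le_one not_less)
    then have "p m = z m" using mk by (simp add: p_def)
    have "solves a (uvec m (- p m)) 1" by (rule solves) (simp add: G_def)
    then have "- (a m * uvec m (- p m) m) \<le> 1 \<or> (\<exists>n. - (a m * uvec m (- p m) m) \<le> a n * uvec m (- p m) n)"
      unfolding solves_def by blast
    moreover have "a n * uvec m (- p m) n \<le> 1" for n
    proof -
      have "a n * uvec m (- p m) n \<le> 0" using a(1) p(1) by (simp add: uvec_def mult_nonneg_nonpos)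
      then show ?thesis by simp
    qed
    ultimately have "- (a m * uvec m (- p m) m) \<le> 1" by (meson order_trans)
    then have "a m * p m \<le> 1" by (simp add: uvec_def)
    then show False using gt \<open>p m = z m\<close> by simp
  qed
  ultimately show ?thesis by blast
qed

end

theorem tcone_separation:
  fixes S :: "('i::finite \<Rightarrow> real) set"
  assumes S: "tcone S" and F: "finite F" "F \<subseteq> S" and z: "z \<notin> S"
  shows "\<exists>a. (\<forall>f\<in>F. tnonneg a f) \<and> \<not> tnonneg a z"
proof -
  obtain S' s where S': "S \<subseteq> S'" "tcone S'" "z \<notin> S'" "\<And>i. \<bar>s i\<bar> = 1" "\<And>i. uvec i (s i) \<in> S'"
    using tcone_extend_units[OF finite S z, of UNIV] by auto
  have ff: "reflect s (reflect s x) = x" for x by (rule reflect_reflect[of s, OF S'(4)])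
  have "reflect s (uvec i 1) = uvec i (s i)" for i by (auto simp: reflect_def uvec_def)
  then interpret up_tcone "{x. reflect s x \<in> S'}"
    using tcone_reflect[of s, OF S'(4) S'(2)] S'(5) by unfold_locales simp_all
  have "\<exists>a. (\<forall>f\<in>reflect s ` F. tnonneg a f) \<and> \<not> tnonneg a (reflect s z)"
    by (rule separation) (use F S' ff in auto)
  then show ?thesis unfolding ball_simps tnonneg_reflect[symmetric] by blast
qed

section \<open>Tropical double description in the nonnegative orthant\<close>

text \<open>On the nonnegative orthant a tropical inequality compares two max-linear forms, given by
  the positive and by the negative part of its coefficients.\<close>

definition pos_max :: "('i::finite \<Rightarrow> real) \<Rightarrow> ('i \<Rightarrow> real) \<Rightarrow> real" where
  "pos_max a x = Max (range (\<lambda>i. max (a i) 0 * x i))"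

lemma pos_max_le_iff: "pos_max a x \<le> c \<longleftrightarrow> (\<forall>i. max (a i) 0 * x i \<le> c)"
  unfolding pos_max_def by (subst Max_le_iff) auto

lemma pos_max_ge: "max (a i) 0 * x i \<le> pos_max a x"
  unfolding pos_max_def by (rule Max_ge) auto

lemma pos_max_attained: obtains i where "pos_max a x = max (a i) 0 * x i"
proof -
  have "pos_max a x \<in> range (\<lambda>i. max (a i) 0 * x i)" unfolding pos_max_def by (rule Max_in) auto
  then show thesis using that by blast
qed

lemma pos_max_nonneg: "(\<And>i. 0 \<le> x i) \<Longrightarrow> 0 \<le> pos_max a x"
  using pos_max_ge[of a _ x] by (meson max.cobounded2 mult_nonneg_nonneg order_trans)

lemma pos_max_max: "pos_max a (\<lambda>i. max (x i) (y i)) = max (pos_max a x) (pos_max a y)"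
proof (rule antisym)
  show "pos_max a (\<lambda>i. max (x i) (y i)) \<le> max (pos_max a x) (pos_max a y)"
    unfolding pos_max_le_iff
  proof
    fix i
    have "max (a i) 0 * max (x i) (y i) = max (max (a i) 0 * x i) (max (a i) 0 * y i)"
      by (rule max_mult_distrib_left[THEN trans]) simp
    then show "max (a i) 0 * max (x i) (y i) \<le> max (pos_max a x) (pos_max a y)"
      using pos_max_ge[of a i x] pos_max_ge[of a i y] by (simp add: le_max_iff_disj) linarith
  qed
  have "pos_max a x \<le> pos_max a (\<lambda>i. max (x i) (y i))" "pos_max a y \<le> pos_max a (\<lambda>i. max (x i) (y i))"
    unfolding pos_max_le_iff
    by (auto intro!: order_trans[OF _ pos_max_ge[of a _ "\<lambda>i. max (x i) (y i)"]] mult_left_mono)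
  then show "max (pos_max a x) (pos_max a y) \<le> pos_max a (\<lambda>i. max (x i) (y i))" by simp
qed

lemma pos_max_scale: "0 \<le> c \<Longrightarrow> pos_max a (\<lambda>i. c * x i) = c * pos_max a x"
proof (rule antisym)
  assume c: "0 \<le> c"
  show "pos_max a (\<lambda>i. c * x i) \<le> c * pos_max a x"
    unfolding pos_max_le_iff
  proof
    fix i show "max (a i) 0 * (c * x i) \<le> c * pos_max a x"
      using mult_left_mono[OF pos_max_ge[of a i x] c] by (simp add: mult.left_commute)
  qed
  obtain i where "pos_max a x = max (a i) 0 * x i" by (rule pos_max_attained)
  then show "c * pos_max a x \<le> pos_max a (\<lambda>i. c * x i)"
    using pos_max_ge[of a i "\<lambda>i. c * x i"] by (simp add: mult.left_commute)
qed

lemma pos_max_zero: "pos_max a (\<lambda>_. 0) = 0"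
  using pos_max_scale[of 0 a "\<lambda>_. 0"] by simp

lemma tnonneg_pos_max:
  assumes x: "\<And>i. 0 \<le> x i"
  shows "tnonneg a x \<longleftrightarrow> pos_max (\<lambda>i. - a i) x \<le> pos_max a x"
proof
  assume "tnonneg a x"
  then obtain k where k: "\<And>i. \<bar>a i * x i\<bar> \<le> a k * x k" unfolding tnonneg_def by blast
  have ak: "a k * x k \<le> pos_max a x"
    using pos_max_ge[of a k x] mult_right_mono[OF max.cobounded1[of "a k" 0] x[of k]] by linarith
  show "pos_max (\<lambda>i. - a i) x \<le> pos_max a x"
    unfolding pos_max_le_iff
  proof
    fix i
    show "max (- a i) 0 * x i \<le> pos_max a x"
      using k[of i] ak pos_max_nonneg[of x a, OF x] by (cases "a i \<ge> 0") (simp_all add: max_def)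
  qed
next
  assume le: "pos_max (\<lambda>i. - a i) x \<le> pos_max a x"
  obtain k where k: "pos_max a x = max (a k) 0 * x k" by (rule pos_max_attained)
  have ge: "\<bar>a i * x i\<bar> \<le> pos_max a x" for i
    using pos_max_ge[of a i x] pos_max_ge[of "\<lambda>i. - a i" i x] le x[of i]
    by (cases "a i \<ge> 0") (simp_all add: max_def abs_mult)
  show "tnonneg a x"
  proof (cases "a k \<ge> 0")
    case True
    then have "pos_max a x = a k * x k" using k by simp
    then show ?thesis using ge unfolding tnonneg_def by metis
  next
    case False
    then have "pos_max a x = 0" using k by simp
    then have z: "a i * x i = 0" for i using ge[of i] by linarith
    show ?thesis unfolding tnonneg_def by (simp only: z abs_zero order_refl simp_thms)
  qed
qed

lemma max_zero_right: "(\<And>i. 0 \<le> y i) \<Longrightarrow> (\<lambda>i. max (y i) 0) = (y :: 'i \<Rightarrow> real)"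
  by (simp add: max_absorb1)

inductive_set mspan :: "('i \<Rightarrow> real) set \<Rightarrow> ('i \<Rightarrow> real) set" for G where
  zero: "(\<lambda>_. 0) \<in> mspan G"
| gen: "g \<in> G \<Longrightarrow> 0 \<le> c \<Longrightarrow> (\<lambda>i. c * g i) \<in> mspan G"
| max: "x \<in> mspan G \<Longrightarrow> y \<in> mspan G \<Longrightarrow> (\<lambda>i. max (x i) (y i)) \<in> mspan G"

lemma mspan_base: "g \<in> G \<Longrightarrow> g \<in> mspan G"
  using mspan.gen[of g G 1] by simp

lemma mspan_nonneg:
  assumes "x \<in> mspan G" "\<forall>g\<in>G. \<forall>i. 0 \<le> g i"
  shows "0 \<le> x i"
  using assms by (induction rule: mspan.induct) (simp_all add: le_max_iff_disj)

lemma mspan_scale: "x \<in> mspan G \<Longrightarrow> 0 \<le> c \<Longrightarrow> (\<lambda>i. c * x i) \<in> mspan G"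
proof (induction rule: mspan.induct)
  case zero
  then show ?case using mspan.zero by simp
next
  case (gen g d)
  then have "(\<lambda>i. (c * d) * g i) \<in> mspan G" by (intro mspan.gen) auto
  then show ?case by (simp add: mult.assoc)
next
  case (max x y)
  then have "(\<lambda>i. max (c * x i) (c * y i)) \<in> mspan G" by (intro mspan.max) auto
  then show ?case using max.prems by (simp add: max_mult_distrib_left)
qed

lemma mspan_mono: "x \<in> mspan G \<Longrightarrow> G \<subseteq> mspan H \<Longrightarrow> x \<in> mspan H"
  by (induction rule: mspan.induct) (auto intro: mspan.intros mspan_scale)

lemma mspan_decomp:
  assumes "z \<in> mspan G" "\<forall>g\<in>G. \<forall>i. 0 \<le> g i" "G \<subseteq> A \<union> B"
  shows "\<exists>x\<in>mspan A. \<exists>y\<in>mspan B. z = (\<lambda>i. max (x i) (y i))"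
  using assms(1)
proof (induction rule: mspan.induct)
  case zero
  show ?case by (rule bexI[OF bexI[OF _ mspan.zero] mspan.zero]) simp
next
  case (gen g c)
  then have nn: "0 \<le> c * g i" for i using assms(2) by simp
  consider "g \<in> A" | "g \<in> B" using gen assms(3) by blast
  then show ?case
  proof cases
    case 1
    show ?thesis
      by (rule bexI[OF bexI[OF _ mspan.zero] mspan.gen[OF 1 gen(2)]]) (use nn in \<open>simp add: max_absorb1\<close>)
  next
    case 2
    show ?thesis
      by (rule bexI[OF bexI[OF _ mspan.gen[OF 2 gen(2)]] mspan.zero]) (use nn in \<open>simp add: max_absorb2\<close>)
  qed
next
  case (max x y)
  then obtain u v u' v' where u: "u \<in> mspan A" "v \<in> mspan B" "x = (\<lambda>i. max (u i) (v i))"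
    and u': "u' \<in> mspan A" "v' \<in> mspan B" "y = (\<lambda>i. max (u' i) (v' i))" by blast
  show ?case
    by (rule bexI[OF bexI[OF _ mspan.max[OF u(2) u'(2)]] mspan.max[OF u(1) u'(1)]])
      (simp add: u(3) u'(3) max.left_commute max.assoc)
qed

text \<open>A maximum is attained by one of its terms, so the form depends on a single multiple of
  one generator below \<open>y\<close>.\<close>

lemma pos_max_mspan_attained:
  assumes "y \<in> mspan A" "\<forall>g\<in>A. \<forall>i. 0 \<le> g i"
  shows "pos_max a y = 0 \<or> (\<exists>g\<in>A. \<exists>c\<ge>0. (\<forall>i. c * g i \<le> y i) \<and> pos_max a y = c * pos_max a g)"
  using assms(1)
proof (induction rule: mspan.induct)
  case zero
  show ?case by (simp add: pos_max_zero)
next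
  case (gen g c)
  then show ?case using pos_max_scale[of c a g] by blast
next
  case (max x y)
  have "pos_max a (\<lambda>i. max (x i) (y i)) = pos_max a x \<or> pos_max a (\<lambda>i. max (x i) (y i)) = pos_max a y"
    unfolding pos_max_max by (simp add: max_def)
  then show ?case using max.IH by (metis (no_types, lifting) le_max_iff_disj)
qed

text \<open>For a single \<open>c * h\<close> choose a term \<open>d * g\<close> of \<open>y\<close>
  at which the form of \<open>a\<close> is attained. The combination of \<open>g\<close> and
  \<open>h\<close>, scaled by \<open>c / pos_max a g\<close>, is the maximum of \<open>c * h\<close>
  and a multiple of \<open>g\<close> that stays below \<open>d * g\<close>, hence below
  \<open>y\<close>; joining it to \<open>y\<close> therefore adds exactly
  \<open>c * h\<close>.\<close>

lemma max_in_mspan: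
  fixes G H :: "('i::finite \<Rightarrow> real) set"
  assumes z: "z \<in> mspan B" and y: "y \<in> mspan A"
    and A: "\<forall>g\<in>A. \<forall>i. 0 \<le> g i" and B: "\<forall>h\<in>B. \<forall>i. 0 \<le> h i"
    and bad: "\<And>h. h \<in> B \<Longrightarrow> pos_max a h < pos_max a' h"
    and AH: "A \<subseteq> H"
    and comb: "\<And>g h. g \<in> A \<Longrightarrow> h \<in> B \<Longrightarrow> (\<lambda>i. max (pos_max a g * h i) (pos_max a' h * g i)) \<in> H"
    and le: "pos_max a' z \<le> pos_max a y"
  shows "(\<lambda>i. max (y i) (z i)) \<in> mspan H"
proof -
  have yH: "y \<in> mspan H" by (rule mspan_mono[OF y]) (use AH mspan_base in blast)
  have y0: "0 \<le> y i" for i by (rule mspan_nonneg[OF y A])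
  show ?thesis using z le
  proof (induction rule: mspan.induct)
    case zero
    then show ?case using yH max_zero_right[of y, OF y0] by simp
  next
    case (gen h c)
    show ?case
    proof (cases "c = 0")
      case True
      then show ?thesis using yH max_zero_right[of y, OF y0] by simp
    next
      case False
      then have c: "c > 0" using gen by simp
      have h: "0 < pos_max a' h" using bad[OF gen(1)] pos_max_nonneg[of h a] B gen(1) by fastforce
      have le: "c * pos_max a' h \<le> pos_max a y" using gen.prems pos_max_scale[of c a' h] c by simp
      then have "pos_max a y \<noteq> 0" using c h by (metis mult_pos_pos not_le)
      then obtain g d where g: "g \<in> A" "d \<ge> 0" "\<And>i. d * g i \<le> y i" "pos_max a y = d * pos_max a g"
        using pos_max_mspan_attained[OF y A] by blast
      have g0: "pos_max a g > 0"
        using \<open>pos_max a y \<noteq> 0\<close> g pos_max_nonneg[of g a] A by (metis less_le mult_zero_right)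
      have "(\<lambda>i. (c / pos_max a g) * max (pos_max a g * h i) (pos_max a' h * g i)) \<in> mspan H"
        by (rule mspan.gen[OF comb[OF g(1) gen(1)]]) (use c g0 in simp)
      from mspan.max[OF yH this]
      have "(\<lambda>i. max (y i) ((c / pos_max a g) * max (pos_max a g * h i) (pos_max a' h * g i))) \<in> mspan H" .
      moreover have "max (y i) ((c / pos_max a g) * max (pos_max a g * h i) (pos_max a' h * g i)) = max (y i) (c * h i)" for i
      proof -
        have 1: "(c / pos_max a g) * max (pos_max a g * h i) (pos_max a' h * g i) =
            max (c * h i) ((c * pos_max a' h / pos_max a g) * g i)"
          using c g0 by (simp add: max_mult_distrib_left)
        have "c * pos_max a' h / pos_max a g \<le> d" using le g(4) g0 by (simp add: pos_divide_le_eq)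
        then have "(c * pos_max a' h / pos_max a g) * g i \<le> d * g i" by (rule mult_right_mono) (use A g(1) in blast)
        then have "(c * pos_max a' h / pos_max a g) * g i \<le> y i" using g(3)[of i] by linarith
        then show ?thesis unfolding 1 by (simp add: max_def)
      qed
      ultimately show ?thesis by simp
    qed
  next
    case (max u v)
    have "(\<lambda>i. max (y i) (u i)) \<in> mspan H" "(\<lambda>i. max (y i) (v i)) \<in> mspan H"
      using max.prems by (simp_all add: pos_max_max max.IH)
    from mspan.max[OF this]
    have "(\<lambda>i. max (max (y i) (u i)) (max (y i) (v i))) \<in> mspan H" .
    moreover have "max (max (y i) (u i)) (max (y i) (v i)) = max (y i) (max (u i) (v i))" for i
      by (simp add: max_def)
    ultimately show ?case by simp
  qed
qed

text \<open>Violating generators are replaced by combinations with satisfying ones. The factors are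
  chosen so that the positive form of the multiple of \<open>g\<close> equals the negative form of
  the multiple of \<open>h\<close>.\<close>

lemma mspan_halfspace:
  fixes G :: "('i::finite \<Rightarrow> real) set"
  assumes G: "finite G" "\<forall>g\<in>G. \<forall>i. 0 \<le> g i"
  shows "\<exists>H. finite H \<and> (\<forall>h\<in>H. \<forall>i. 0 \<le> h i) \<and> (\<forall>x. x \<in> mspan H \<longleftrightarrow> x \<in> mspan G \<and> tnonneg a x)"
proof -
  let ?a = "\<lambda>i. - a i"
  define A B where "A = {g \<in> G. pos_max ?a g \<le> pos_max a g}" and "B = {h \<in> G. pos_max a h < pos_max ?a h}"
  define H where "H = A \<union> (\<lambda>(g, h) i. max (pos_max a g * h i) (pos_max ?a h * g i)) ` (A \<times> B)"
  have A0: "\<forall>g\<in>A. \<forall>i. 0 \<le> g i" using G by (simp add: A_def)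
  have B0: "\<forall>g\<in>B. \<forall>i. 0 \<le> g i" using G by (simp add: B_def)
  have comb: "(\<lambda>i. max (pos_max a g * h i) (pos_max ?a h * g i)) \<in> H" if "g \<in> A" "h \<in> B" for g h
    unfolding H_def using that by force
  have H: "finite H" unfolding H_def A_def B_def using G by simp
  have Hcases: "h \<in> A \<or> (\<exists>g\<in>A. \<exists>f\<in>B. h = (\<lambda>i. max (pos_max a g * f i) (pos_max ?a f * g i)))" if "h \<in> H" for h
    using that unfolding H_def by auto
  have H_props: "(\<forall>i. 0 \<le> h i) \<and> h \<in> mspan G \<and> pos_max ?a h \<le> pos_max a h" if hH: "h \<in> H" for h
    using Hcases[OF hH]
  proof
    assume "h \<in> A"
    then show ?thesis using G mspan_base by (auto simp: A_def)
  next
    assume "\<exists>g\<in>A. \<exists>f\<in>B. h = (\<lambda>i. max (pos_max a g * f i) (pos_max ?a f * g i))"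
    then obtain g f where g: "g \<in> A" "f \<in> B" "h = (\<lambda>i. max (pos_max a g * f i) (pos_max ?a f * g i))" by blast
    have p: "0 \<le> pos_max a g" "0 \<le> pos_max ?a f" by (rule pos_max_nonneg; use g A0 B0 in blast)+
    have gf: "pos_max ?a g \<le> pos_max a g" "pos_max a f < pos_max ?a f" "g \<in> G" "f \<in> G" using g by (simp_all add: A_def B_def)
    have "h \<in> mspan G" unfolding g(3) by (intro mspan.max mspan.gen gf p)
    moreover have "pos_max ?a h \<le> pos_max a h"
      unfolding g(3) pos_max_max using p pos_max_scale[of "pos_max a g" _ f] pos_max_scale[of "pos_max ?a f" _ g]
        mult_left_mono[OF gf(1) p(2)] by (simp add: mult.commute le_max_iff_disj)
    ultimately show ?thesis using mspan_nonneg[of h G] G(2) by blast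
  qed
  have "x \<in> mspan H \<longleftrightarrow> x \<in> mspan G \<and> tnonneg a x" for x
  proof
    assume x: "x \<in> mspan H"
    have "x \<in> mspan G" by (rule mspan_mono[OF x]) (use H_props in blast)
    moreover have x0: "0 \<le> x i" for i by (rule mspan_nonneg[OF x]) (use H_props in blast)
    moreover have "pos_max ?a x \<le> pos_max a x" using x
    proof (induction rule: mspan.induct)
      case zero
      show ?case by (simp add: pos_max_zero)
    next
      case (gen h c)
      then show ?case using H_props[of h] by (simp add: pos_max_scale mult_left_mono)
    next
      case (max x y)
      then show ?case by (auto simp: pos_max_max le_max_iff_disj)
    qed
    ultimately show "x \<in> mspan G \<and> tnonneg a x" using tnonneg_pos_max[of x a] by blast
  next
    assume *: "x \<in> mspan G \<and> tnonneg a x"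
    have "G \<subseteq> A \<union> B" by (auto simp: A_def B_def)
    then obtain y z where y: "y \<in> mspan A" and z: "z \<in> mspan B" and x: "x = (\<lambda>i. max (y i) (z i))"
      using mspan_decomp[of x G A B] * G(2) by blast
    have "0 \<le> x i" for i using mspan_nonneg[of x G] * G(2) by blast
    then have "pos_max ?a x \<le> pos_max a x" using tnonneg_pos_max[of x a] * by blast
    then have le: "max (pos_max ?a y) (pos_max ?a z) \<le> max (pos_max a y) (pos_max a z)" unfolding x pos_max_max .
    \<comment> \<open>On the span of the violators the negative form is strictly larger unless both
      vanish. In the inequality for \<open>x\<close> the negative form of \<open>z\<close> must
      therefore be compensated by \<open>y\<close>.\<close>
    have "pos_max ?a z > pos_max a z \<or> pos_max ?a z = 0 \<and> pos_max a z = 0" using z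
    proof (induction rule: mspan.induct)
      case zero
      show ?case by (simp add: pos_max_zero)
    next
      case (gen h c)
      then show ?case using pos_max_scale[OF gen(2), of _ h] by (cases "c = 0") (simp_all add: B_def)
    next
      case (max u v)
      have "0 \<le> pos_max a' u" "0 \<le> pos_max a' v" for a'
        using pos_max_nonneg mspan_nonneg[OF max.hyps(1) B0] mspan_nonneg[OF max.hyps(2) B0] by blast+
      then show ?case using max.IH unfolding pos_max_max by (smt (verit))
    qed
    moreover have "0 \<le> pos_max a y" by (rule pos_max_nonneg, rule mspan_nonneg[OF y A0])
    ultimately have "pos_max ?a z \<le> pos_max a y" using le by linarith
    then show "x \<in> mspan H" unfolding x
      by (intro max_in_mspan[OF z y A0 B0 _ _ comb]) (auto simp: B_def H_def)
  qed
  then show ?thesis using H H_props by blast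
qed

lemma mspan_units:
  fixes x :: "'i::finite \<Rightarrow> real"
  assumes "\<And>i. 0 \<le> x i"
  shows "x \<in> mspan (range (\<lambda>i. uvec i 1))"
proof -
  have "(\<lambda>i. if i \<in> J then x i else 0) \<in> mspan (range (\<lambda>i. uvec i 1))" if "finite J" for J
    using that
  proof (induction J)
    case empty
    then show ?case using mspan.zero by simp
  next
    case (insert j J)
    have "(\<lambda>i. max (if i \<in> J then x i else 0) (x j * uvec j 1 i)) \<in> mspan (range (\<lambda>i. uvec i 1))"
      by (intro mspan.max insert.IH mspan.gen) (use assms in auto)
    moreover have "max (if i \<in> J then x i else 0) (x j * uvec j 1 i) = (if i \<in> insert j J then x i else 0)" for i
      using insert.hyps assms by (auto simp: uvec_def max_def intro: antisym)
    ultimately show ?case by simp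
  qed
  from this[of UNIV] show ?thesis by simp
qed

theorem mspan_finite_generation:
  fixes C :: "('i::finite \<Rightarrow> real) set"
  assumes "finite C"
  shows "\<exists>G. finite G \<and> (\<forall>g\<in>G. \<forall>i. 0 \<le> g i) \<and> (\<forall>x. x \<in> mspan G \<longleftrightarrow> (\<forall>i. 0 \<le> x i) \<and> (\<forall>a\<in>C. tnonneg a x))"
  using assms
proof (induction C)
  case empty
  let ?U = "range (\<lambda>i::'i. uvec i (1::real))"
  have U: "\<forall>g\<in>?U. \<forall>i. 0 \<le> g i" by (auto simp: uvec_def)
  have "x \<in> mspan ?U \<longleftrightarrow> (\<forall>i. 0 \<le> x i)" for x
    using mspan_units[of x] mspan_nonneg[of x, OF _ U] by (intro iffI allI) simp_all
  then show ?case using U by (intro exI[of _ ?U]) simp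
next
  case (insert a C)
  then obtain G where G: "finite G" "\<forall>g\<in>G. \<forall>i. 0 \<le> g i"
    "\<forall>x. x \<in> mspan G \<longleftrightarrow> (\<forall>i. 0 \<le> x i) \<and> (\<forall>a\<in>C. tnonneg a x)" by (elim exE conjE)
  obtain H where H: "finite H" "\<forall>h\<in>H. \<forall>i. 0 \<le> h i" "\<forall>x. x \<in> mspan H \<longleftrightarrow> x \<in> mspan G \<and> tnonneg a x"
    using mspan_halfspace[OF G(1,2), of a] by (elim exE conjE)
  have "\<forall>x. x \<in> mspan H \<longleftrightarrow> (\<forall>i. 0 \<le> x i) \<and> (\<forall>a\<in>insert a C. tnonneg a x)"
    unfolding H(3)[rule_format] G(3)[rule_format] ball_simps by blast
  with H(1,2) show ?case by (intro exI[of _ H] conjI)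
qed

section \<open>The Minkowski--Weyl theorem over an ordered field\<close>

definition dot :: "('i::finite \<Rightarrow> 'k::linordered_field) \<Rightarrow> ('i \<Rightarrow> 'k) \<Rightarrow> 'k" where
  "dot a x = (\<Sum>i\<in>UNIV. a i * x i)"

lemma dot_commute: "dot a x = dot x a"
  by (simp add: dot_def mult.commute)

lemma dot_add: "dot a (\<lambda>i. x i + y i) = dot a x + dot a y"
  by (simp add: dot_def distrib_left sum.distrib)

lemma dot_scale: "dot a (\<lambda>i. c * x i) = c * dot a x"
  by (simp add: dot_def sum_distrib_left mult.left_commute)

lemma dot_zero: "dot a (\<lambda>_. 0) = 0"
  by (simp add: dot_def)

lemma dot_unit: "dot a (\<lambda>k. if k = i then c else 0) = a i * c"
  by (simp add: dot_def if_distrib cong: if_cong)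

inductive_set cspan :: "('i \<Rightarrow> 'k::linordered_field) set \<Rightarrow> ('i \<Rightarrow> 'k) set" for G where
  zero: "(\<lambda>_. 0) \<in> cspan G"
| gen: "g \<in> G \<Longrightarrow> 0 \<le> c \<Longrightarrow> (\<lambda>i. c * g i) \<in> cspan G"
| add: "x \<in> cspan G \<Longrightarrow> y \<in> cspan G \<Longrightarrow> (\<lambda>i. x i + y i) \<in> cspan G"

lemma cspan_base: "g \<in> G \<Longrightarrow> g \<in> cspan G"
  using cspan.gen[of g G 1] by simp

lemma cspan_scale: "x \<in> cspan G \<Longrightarrow> 0 \<le> c \<Longrightarrow> (\<lambda>i. c * x i) \<in> cspan G"
proof (induction rule: cspan.induct)
  case zero
  then show ?case using cspan.zero by simp
next
  case (gen g d)
  then have "(\<lambda>i. (c * d) * g i) \<in> cspan G" by (intro cspan.gen) auto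
  then show ?case by (simp add: mult.assoc)
next
  case (add x y)
  then have "(\<lambda>i. c * x i + c * y i) \<in> cspan G" by (intro cspan.add) auto
  then show ?case by (simp add: distrib_left)
qed

lemma cspan_mono: "x \<in> cspan G \<Longrightarrow> G \<subseteq> cspan H \<Longrightarrow> x \<in> cspan H"
  by (induction rule: cspan.induct) (auto intro: cspan.intros cspan_scale)

lemma cspan_dot_nonneg: "x \<in> cspan G \<Longrightarrow> (\<And>g. g \<in> G \<Longrightarrow> 0 \<le> dot a g) \<Longrightarrow> 0 \<le> dot a x"
  by (induction rule: cspan.induct) (auto simp: dot_zero dot_add dot_scale)

lemma cspan_decomp:
  assumes "z \<in> cspan G" "G \<subseteq> A \<union> B"
  shows "\<exists>x\<in>cspan A. \<exists>y\<in>cspan B. z = (\<lambda>i. x i + y i)"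
  using assms(1)
proof (induction rule: cspan.induct)
  case zero
  show ?case by (rule bexI[OF bexI[OF _ cspan.zero] cspan.zero]) simp
next
  case (gen g c)
  consider "g \<in> A" | "g \<in> B" using gen assms(2) by blast
  then show ?case
  proof cases
    case 1
    show ?thesis by (rule bexI[OF bexI[OF _ cspan.zero] cspan.gen[OF 1 gen(2)]]) simp
  next
    case 2
    show ?thesis by (rule bexI[OF bexI[OF _ cspan.gen[OF 2 gen(2)]] cspan.zero]) simp
  qed
next
  case (add x y)
  then obtain u v u' v' where u: "u \<in> cspan A" "v \<in> cspan B" "x = (\<lambda>i. u i + v i)"
    and u': "u' \<in> cspan A" "v' \<in> cspan B" "y = (\<lambda>i. u' i + v' i)" by blast
  show ?case
    by (rule bexI[OF bexI[OF _ cspan.add[OF u(2) u'(2)]] cspan.add[OF u(1) u'(1)]])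
      (simp add: u(3) u'(3) algebra_simps)
qed

text \<open>The amount \<open>c\<close> of the negative generator is distributed over the summands
  of \<open>y\<close>, each taking no more than its value under \<open>d\<close> can compensate. A
  single generator absorbs its share through its combination with \<open>h\<close>, on which
  \<open>d\<close> vanishes.\<close>

lemma cspan_add_negative_gen:
  assumes y: "y \<in> cspan H" and H: "\<And>g. g \<in> H \<Longrightarrow> 0 \<le> dot d g" and h: "dot d h < 0"
    and comb: "\<And>g. g \<in> H \<Longrightarrow> 0 < dot d g \<Longrightarrow> (\<lambda>i. dot d g * h i - dot d h * g i) \<in> H"
    and c: "0 \<le> c" "c * (- dot d h) \<le> dot d y"
  shows "(\<lambda>i. y i + c * h i) \<in> cspan H"
  using y c
proof (induction arbitrary: c rule: cspan.induct)
  case zero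
  then have "c = 0" using h by (simp add: dot_zero zero_le_mult_iff)
  then show ?case using cspan.zero by simp
next
  case (gen g b)
  show ?case
  proof (cases "c = 0")
    case True
    then show ?thesis using cspan.gen[OF gen(1,2)] by simp
  next
    case False
    then have c: "c > 0" using gen by simp
    have le: "c * (- dot d h) \<le> b * dot d g" using gen by (simp add: dot_scale)
    have "0 < c * (- dot d h)" using c h by (simp add: mult_less_0_iff)
    then have g: "0 < dot d g" using le H[OF gen(1)] gen(2) by (metis less_le mult_zero_right not_le)
    define e where "e = c / dot d g"
    have e: "0 \<le> e" "e * dot d g = c" using c g by (simp_all add: e_def)
    have "e * (- dot d h) \<le> b" using le g by (simp add: e_def field_simps)
    then have b: "0 \<le> b + e * dot d h" by simp
    have "(\<lambda>i. (b + e * dot d h) * g i + e * (dot d g * h i - dot d h * g i)) \<in> cspan H"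
      by (intro cspan.add cspan.gen gen(1) b comb g e(1))
    moreover have "(b + e * dot d h) * g i + e * (dot d g * h i - dot d h * g i) = b * g i + (e * dot d g) * h i" for i
      by (simp add: algebra_simps)
    ultimately show ?thesis by (simp add: e(2))
  qed
next
  case (add x y)
  define c1 where "c1 = min c (dot d x / (- dot d h))"
  have dx: "0 \<le> dot d x" "0 \<le> dot d y" using add.hyps H cspan_dot_nonneg by blast+
  have c1: "0 \<le> c1" "0 \<le> c - c1" using add.prems dx h by (simp_all add: c1_def divide_nonneg_neg)
  have "c1 * (- dot d h) \<le> dot d x"
  proof -
    have "c1 \<le> dot d x / (- dot d h)" by (simp add: c1_def)
    then show ?thesis using h by (simp only: pos_le_divide_eq neg_0_less_iff_less)
  qed
  moreover have "(c - c1) * (- dot d h) \<le> dot d y"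
  proof (cases "c \<le> dot d x / (- dot d h)")
    case True
    then show ?thesis using dx by (simp add: c1_def min_def)
  next
    case False
    then have "c1 * (- dot d h) = dot d x" using h by (simp add: c1_def min_def)
    then show ?thesis using add.prems by (simp add: dot_add algebra_simps)
  qed
  ultimately have "(\<lambda>i. (x i + c1 * h i) + (y i + (c - c1) * h i)) \<in> cspan H"
    using c1 by (intro cspan.add add.IH) simp_all
  moreover have "(x i + c1 * h i) + (y i + (c - c1) * h i) = x i + y i + c * h i" for i
    by (simp add: algebra_simps)
  ultimately show ?case by simp
qed

lemma cspan_halfspace:
  fixes G :: "('i::finite \<Rightarrow> 'k::linordered_field) set"
  assumes G: "finite G"
  shows "\<exists>H. finite H \<and> (\<forall>x. x \<in> cspan H \<longleftrightarrow> x \<in> cspan G \<and> 0 \<le> dot d x)"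
proof -
  define A B where "A = {g \<in> G. 0 \<le> dot d g}" and "B = {h \<in> G. dot d h < 0}"
  define H where "H = A \<union> (\<lambda>(g, h) i. dot d g * h i - dot d h * g i) ` (A \<times> B)"
  have comb: "(\<lambda>i. dot d g * h i - dot d h * g i) \<in> H" if "g \<in> A" "h \<in> B" for g h
    unfolding H_def using that by force
  have Hcases: "h \<in> A \<or> (\<exists>g\<in>A. \<exists>f\<in>B. h = (\<lambda>i. dot d g * f i - dot d f * g i))" if "h \<in> H" for h
    using that unfolding H_def by auto
  have dcomb: "dot d (\<lambda>i. dot d g * f i - dot d f * g i) = 0" for g f
    using dot_add[of d "\<lambda>i. dot d g * f i" "\<lambda>i. (- dot d f) * g i"] dot_scale[of d "dot d g" f]
      dot_scale[of d "- dot d f" g] by (simp add: mult.commute)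
  have H: "finite H" unfolding H_def A_def B_def using G by simp
  have H_props: "h \<in> cspan G \<and> 0 \<le> dot d h" if hH: "h \<in> H" for h
    using Hcases[OF hH]
  proof
    assume "h \<in> A"
    then show ?thesis using cspan_base by (auto simp: A_def)
  next
    assume "\<exists>g\<in>A. \<exists>f\<in>B. h = (\<lambda>i. dot d g * f i - dot d f * g i)"
    then obtain g f where g: "g \<in> A" "f \<in> B" "h = (\<lambda>i. dot d g * f i - dot d f * g i)" by blast
    have "(\<lambda>i. dot d g * f i + (- dot d f) * g i) \<in> cspan G"
      by (intro cspan.add cspan.gen) (use g in \<open>auto simp: A_def B_def\<close>)
    then show ?thesis using dcomb[of g f] by (simp add: g(3))
  qed
  have "x \<in> cspan H \<longleftrightarrow> x \<in> cspan G \<and> 0 \<le> dot d x" for x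
  proof
    assume x: "x \<in> cspan H"
    show "x \<in> cspan G \<and> 0 \<le> dot d x"
      using cspan_mono[OF x, of G] cspan_dot_nonneg[OF x, of d] H_props by blast
  next
    assume *: "x \<in> cspan G \<and> 0 \<le> dot d x"
    have "G \<subseteq> A \<union> B" by (auto simp: A_def B_def)
    then obtain y z where y: "y \<in> cspan A" and z: "z \<in> cspan B" and x: "x = (\<lambda>i. y i + z i)"
      using cspan_decomp[of x G A B] * by blast
    have y': "y \<in> cspan H" by (rule cspan_mono[OF y]) (auto simp: H_def intro: cspan_base)
    have neg: "dot d w \<le> 0" if "w \<in> cspan B" for w
      using that by (induction rule: cspan.induct)
        (auto simp: dot_zero dot_scale dot_add B_def mult_nonneg_nonpos)
    \<comment> \<open>The summands of \<open>z\<close> can be added one after the other without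
      leaving the halfspace, because \<open>d\<close> is nonpositive on whatever is still to be
      added.\<close>
    have "(\<lambda>i. y i + z i) \<in> cspan H" if "y \<in> cspan H" "0 \<le> dot d y + dot d z" for y
      using z that
    proof (induction arbitrary: y rule: cspan.induct)
      case zero
      then show ?case by simp
    next
      case (gen h c)
      have h: "h \<in> B" "dot d h < 0" using gen(1) by (simp_all add: B_def)
      show ?case
      proof (rule cspan_add_negative_gen[OF gen.prems(1) _ h(2) _ gen(2)])
        show "0 \<le> dot d g" if "g \<in> H" for g using H_props[OF that] by simp
        show "(\<lambda>i. dot d g * h i - dot d h * g i) \<in> H" if gH: "g \<in> H" "0 < dot d g" for g
        proof -
          have "g \<in> A" using Hcases[OF gH(1)] gH(2) dcomb by auto
          then show ?thesis using comb h by blast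
        qed
        show "c * (- dot d h) \<le> dot d y" using gen.prems by (simp add: dot_scale)
      qed
    next
      case (add u v)
      have "dot d v \<le> 0" using neg add.hyps by blast
      then have "(\<lambda>i. y i + u i) \<in> cspan H" using add.prems by (intro add.IH) (simp_all add: dot_add)
      then have "(\<lambda>i. (y i + u i) + v i) \<in> cspan H"
        using add.prems by (intro add.IH(2)) (simp_all add: dot_add add.assoc)
      then show ?case by (simp add: add.assoc)
    qed
    from this[OF y'] show "x \<in> cspan H" using * unfolding x by (simp add: dot_add)
  qed
  then show ?thesis using H by blast
qed

definition signed_units :: "('i \<Rightarrow> 'k::linordered_field) set" where
  "signed_units = range (\<lambda>i k. if k = i then 1 else 0) \<union> range (\<lambda>i k. if k = i then - 1 else 0)"

lemma finite_signed_units: "finite (signed_units :: ('i::finite \<Rightarrow> 'k::linordered_field) set)"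
  by (simp add: signed_units_def)

lemma cspan_signed_units:
  fixes x :: "'i::finite \<Rightarrow> 'k::linordered_field"
  shows "x \<in> cspan signed_units"
proof -
  have "(\<lambda>i. if i \<in> J then x i else 0) \<in> cspan signed_units" if "finite J" for J
    using that
  proof (induction J)
    case empty
    then show ?case using cspan.zero by simp
  next
    case (insert j J)
    have "\<exists>s. (\<lambda>k. if k = j then s else 0) \<in> signed_units \<and> s * \<bar>x j\<bar> = x j"
      by (cases "0 \<le> x j") (auto intro: exI[of _ 1] exI[of _ "-1"] simp: signed_units_def)
    then obtain s where s: "(\<lambda>k. if k = j then s else 0) \<in> signed_units" "s * \<bar>x j\<bar> = x j" by blast
    have "(\<lambda>i. (if i \<in> J then x i else 0) + \<bar>x j\<bar> * (if i = j then s else 0)) \<in> cspan signed_units"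
      by (intro cspan.add insert.IH cspan.gen s) simp
    moreover have "(if i \<in> J then x i else 0) + \<bar>x j\<bar> * (if i = j then s else 0) = (if i \<in> insert j J then x i else 0)" for i
      using insert.hyps s(2) by (auto simp: mult.commute)
    ultimately show ?case by simp
  qed
  from this[of UNIV] show ?thesis by simp
qed

theorem polyhedral_cone_finitely_generated:
  fixes D :: "('i::finite \<Rightarrow> 'k::linordered_field) set"
  assumes "finite D"
  shows "\<exists>G. finite G \<and> (\<forall>x. x \<in> cspan G \<longleftrightarrow> (\<forall>d\<in>D. 0 \<le> dot d x))"
  using assms
proof (induction D)
  case empty
  then show ?case using finite_signed_units cspan_signed_units by (intro exI[of _ signed_units]) auto
next
  case (insert d D)
  then obtain G where "finite G" "\<And>x. x \<in> cspan G \<longleftrightarrow> (\<forall>d\<in>D. 0 \<le> dot d x)" by blast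
  then show ?case using cspan_halfspace[of G d] by (auto simp: conj_commute)
qed

text \<open>Presents the enlarged cone as a projection along \<open>t\<close>, the variable that
  \<open>finitely_generated_cone_polyhedral\<close> eliminates.\<close>

lemma cspan_insert:
  "x \<in> cspan (insert g G) \<longleftrightarrow> (\<exists>t\<ge>0. (\<lambda>i. x i - t * g i) \<in> cspan G)"
proof
  assume "x \<in> cspan (insert g G)"
  then show "\<exists>t\<ge>0. (\<lambda>i. x i - t * g i) \<in> cspan G"
  proof (induction rule: cspan.induct)
    case zero
    show ?case by (rule exI[of _ 0]) (simp add: cspan.zero)
  next
    case (gen h c)
    show ?case
    proof (cases "h = g")
      case True
      then show ?thesis using gen by (intro exI[of _ c]) (simp add: cspan.zero)
    next
      case False
      then show ?thesis using gen cspan.gen[of h G c] by (intro exI[of _ 0]) simp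
    qed
  next
    case (add x y)
    then obtain s t where s: "s \<ge> 0" "(\<lambda>i. x i - s * g i) \<in> cspan G"
      and t: "t \<ge> 0" "(\<lambda>i. y i - t * g i) \<in> cspan G" by blast
    have "(\<lambda>i. x i - s * g i + (y i - t * g i)) \<in> cspan G" by (rule cspan.add[OF s(2) t(2)])
    moreover have "x i - s * g i + (y i - t * g i) = x i + y i - (s + t) * g i" for i
      by (simp add: algebra_simps)
    ultimately show ?case using s(1) t(1) by (intro exI[of _ "s + t"]) simp
  qed
next
  assume "\<exists>t\<ge>0. (\<lambda>i. x i - t * g i) \<in> cspan G"
  then obtain t where t: "t \<ge> 0" "(\<lambda>i. x i - t * g i) \<in> cspan G" by blast
  have "(\<lambda>i. x i - t * g i) \<in> cspan (insert g G)"
    by (rule cspan_mono[OF t(2)]) (auto intro: cspan_base)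
  then have "(\<lambda>i. (x i - t * g i) + t * g i) \<in> cspan (insert g G)"
    by (intro cspan.add cspan.gen t(1) \<open>(\<lambda>i. x i - t * g i) \<in> cspan (insert g G)\<close>) simp
  then show "x \<in> cspan (insert g G)" by simp
qed

text \<open>Acts as Farkas' lemma: a vector outside a finitely generated cone violates one of
  finitely many inequalities valid on the cone.\<close>

theorem finitely_generated_cone_polyhedral:
  fixes G :: "('i::finite \<Rightarrow> 'k::linordered_field) set"
  assumes "finite G"
  shows "\<exists>D. finite D \<and> (\<forall>x. x \<in> cspan G \<longleftrightarrow> (\<forall>d\<in>D. 0 \<le> dot d x))"
  using assms
proof (induction G)
  case empty
  have "x = (\<lambda>_. 0)" if "\<forall>d\<in>signed_units. 0 \<le> dot d x" for x :: "'i \<Rightarrow> 'k"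
  proof
    fix i
    have "0 \<le> dot (\<lambda>k. if k = i then 1 else 0) x" "0 \<le> dot (\<lambda>k. if k = i then - 1 else 0) x"
      using that by (auto simp: signed_units_def)
    then show "x i = 0" by (simp add: dot_commute[of _ x] dot_unit)
  qed
  moreover have "x = (\<lambda>_. 0)" if "x \<in> cspan {}" for x :: "'i \<Rightarrow> 'k"
    using that by (induction rule: cspan.induct) auto
  ultimately have "x \<in> cspan {} \<longleftrightarrow> (\<forall>d\<in>signed_units. 0 \<le> dot d x)" for x :: "'i \<Rightarrow> 'k"
    using cspan.zero[of "{}"] dot_zero by (metis order_refl)
  then show ?case using finite_signed_units by blast
next
  case (insert g G)
  then obtain D where D: "finite D" "\<And>x. x \<in> cspan G \<longleftrightarrow> (\<forall>d\<in>D. 0 \<le> dot d x)" by blast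
  \<comment> \<open>Rows with nonnegative value at \<open>g\<close> express that the upper bounds on
    \<open>t\<close> admit a nonnegative value; the combinations express that no lower bound exceeds
    an upper one.\<close>
  define E where "E = {d \<in> D. 0 \<le> dot d g} \<union>
    (\<lambda>(d, e) i. dot d g * e i - dot e g * d i) ` ({d \<in> D. 0 < dot d g} \<times> {e \<in> D. dot e g < 0})"
  have E: "finite E" unfolding E_def using D(1) by simp
  have dotE: "dot (\<lambda>i. dot d g * e i - dot e g * d i) x = dot d g * dot e x - dot e g * dot d x" for d e x
    using dot_add[of x "\<lambda>i. dot d g * e i" "\<lambda>i. (- dot e g) * d i"] dot_scale[of x "dot d g" e]
      dot_scale[of x "- dot e g" d] by (simp add: dot_commute[of x])
  have dsub: "dot d (\<lambda>i. x i - t * g i) = dot d x - t * dot d g" for d x t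
    using dot_add[of d x "\<lambda>i. (- t) * g i"] dot_scale[of d "- t" g] by simp
  have "x \<in> cspan (insert g G) \<longleftrightarrow> (\<forall>d\<in>E. 0 \<le> dot d x)" for x
  proof
    assume "x \<in> cspan (insert g G)"
    then obtain t where t: "t \<ge> 0" "(\<lambda>i. x i - t * g i) \<in> cspan G" unfolding cspan_insert by blast
    then have le: "t * dot d g \<le> dot d x" if "d \<in> D" for d
      using D(2)[of "\<lambda>i. x i - t * g i"] that by (auto simp: dsub)
    show "\<forall>d\<in>E. 0 \<le> dot d x"
    proof
      fix d assume "d \<in> E"
      then consider "d \<in> D" "0 \<le> dot d g"
        | b e where "b \<in> D" "0 < dot b g" "e \<in> D" "dot e g < 0" "d = (\<lambda>i. dot b g * e i - dot e g * b i)"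
        unfolding E_def by auto
      then show "0 \<le> dot d x"
      proof cases
        case 1
        then show ?thesis using le[OF 1(1)] t(1) by (meson mult_nonneg_nonneg order_trans)
      next
        case 2
        have "dot b g * (t * dot e g) \<le> dot b g * dot e x" using le[OF 2(3)] 2(2) by simp
        moreover have "dot e g * dot b x \<le> dot e g * (t * dot b g)" using le[OF 2(1)] 2(4) by simp
        ultimately show ?thesis unfolding 2(5) dotE by (simp add: algebra_simps)
      qed
    qed
  next
    assume *: "\<forall>d\<in>E. 0 \<le> dot d x"
    let ?A = "(\<lambda>d. dot d x / dot d g) ` {d \<in> D. dot d g < 0}"
    let ?U = "(\<lambda>d. dot d x / dot d g) ` {d \<in> D. 0 < dot d g}"
    have "\<exists>t\<ge>0. (\<forall>l\<in>?A. l \<le> t) \<and> (\<forall>u\<in>?U. t \<le> u)"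
    proof (rule exists_between_finite)
      show "0 \<le> u" if "u \<in> ?U" for u
        using that * by (auto simp: E_def intro!: divide_nonneg_pos)
      fix l u assume "l \<in> ?A" "u \<in> ?U"
      then obtain d e where d: "d \<in> D" "0 < dot d g" "u = dot d x / dot d g"
        and e: "e \<in> D" "dot e g < 0" "l = dot e x / dot e g" by auto
      have "(\<lambda>i. dot d g * e i - dot e g * d i) \<in> E" unfolding E_def using d e by force
      then have "0 \<le> dot (\<lambda>i. dot d g * e i - dot e g * d i) x" using * by blast
      then have "dot e g * dot d x \<le> dot d g * dot e x" unfolding dotE by simp
      then show "l \<le> u" unfolding d(3) e(3) using d(2) e(2)
        by (simp add: pos_le_divide_eq neg_divide_le_eq mult.commute)
    qed (use D(1) in simp_all)
    then obtain t where t: "0 \<le> t" "\<And>d. d \<in> D \<Longrightarrow> dot d g < 0 \<Longrightarrow> dot d x / dot d g \<le> t"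
      "\<And>d. d \<in> D \<Longrightarrow> 0 < dot d g \<Longrightarrow> t \<le> dot d x / dot d g" by auto
    have "t * dot d g \<le> dot d x" if d: "d \<in> D" for d
    proof (cases "dot d g" "0::'k" rule: linorder_cases)
      case less
      then show ?thesis using t(2)[OF d] by (simp add: neg_divide_le_eq)
    next
      case equal
      then show ?thesis using * d by (simp add: E_def)
    next
      case greater
      then show ?thesis using t(3)[OF d] by (simp add: pos_le_divide_eq)
    qed
    then have "(\<lambda>i. x i - t * g i) \<in> cspan G" unfolding D(2) by (simp add: dsub)
    then show "x \<in> cspan (insert g G)" unfolding cspan_insert using t(1) by blast
  qed
  then show ?case using E by blast
qed

section \<open>Signed valuations of polyhedra\<close>

text \<open>The signed valuation in the real encoding, where it is multiplicative; see
  \<open>to_real_sval\<close> and \<open>rval_mult\<close>.\<close>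

definition rval :: "puiseux \<Rightarrow> real" where
  "rval f = (if f = 0 then 0 else if 0 < f then exp (lead_exp f) else - exp (lead_exp f))"

lemma rval_zero [simp]: "rval 0 = 0"
  by (simp add: rval_def)

lemma puiseux_less_0_iff: "0 < (f :: puiseux) \<longleftrightarrow> puiseux_pos f"
  by (simp add: less_puiseux_def)

lemma lead_exp_uminus: "lead_exp (- f) = lead_exp f"
  by (simp add: lead_exp_def)

lemma rval_uminus: "rval (- f) = - rval f"
  by (auto simp: rval_def lead_exp_uminus)

lemma rval_pos: "0 < f \<Longrightarrow> rval f = exp (lead_exp f)"
  by (simp add: rval_def)

lemma rval_sign: "0 < rval f \<longleftrightarrow> 0 < f" "rval f < 0 \<longleftrightarrow> f < 0" "rval f = 0 \<longleftrightarrow> f = 0"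
  by (auto simp: rval_def not_less intro: le_neq_trans)

lemma lead_exp_mult:
  assumes "f \<noteq> 0" "g \<noteq> 0"
  shows "lead_exp (f * g) = lead_exp f + lead_exp g"
proof (rule lead_exp_eqI)
  show "pcoeff (f * g) (lead_exp f + lead_exp g) \<noteq> 0"
    using pcoeff_times_lead(1)[of "lead_exp f" f "lead_exp g" g] pcoeff_gt_lead_exp
      pcoeff_lead_exp[OF assms(1)] pcoeff_lead_exp[OF assms(2)] by simp
  show "pcoeff (f * g) b = 0" if "lead_exp f + lead_exp g < b" for b
    by (rule pcoeff_times_lead(2)[OF pcoeff_gt_lead_exp pcoeff_gt_lead_exp that])
qed

lemma rval_mult: "rval (f * g) = rval f * rval g"
proof -
  have pos: "rval (f * g) = rval f * rval g" if "0 < f" "0 < g" for f g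
    using that by (simp add: rval_pos lead_exp_mult exp_add)
  consider "f = 0" | "g = 0" | "0 < f" "0 < g" | "f < 0" "0 < g" | "0 < f" "g < 0" | "f < 0" "g < 0"
    by (metis linorder_cases)
  then show ?thesis
  proof cases
    case 3
    then show ?thesis by (rule pos)
  next
    case 4
    then show ?thesis using pos[of "- f" g] by (simp add: rval_uminus)
  next
    case 5
    then show ?thesis using pos[of f "- g"] by (simp add: rval_uminus)
  next
    case 6
    then show ?thesis using pos[of "- f" "- g"] by (simp add: rval_uminus)
  qed simp_all
qed

lemma pcoeff_of_nat_mult: "pcoeff (of_nat n * f) a = real n * pcoeff f a"
  by (induction n) (simp_all add: distrib_right)

lemma of_nat_mult_less:
  assumes "0 < f" "0 < g" "rval f < rval g"
  shows "of_nat n * f < g"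
proof -
  have le: "lead_exp f < lead_exp g" using assms by (simp add: rval_pos)
  have g: "pcoeff g (lead_exp g) > 0" using assms(2) by (simp add: puiseux_less_0_iff puiseux_pos_def)
  have "\<forall>b>lead_exp g. pcoeff (g - of_nat n * f) b = 0"
    using le by (simp add: pcoeff_of_nat_mult pcoeff_gt_lead_exp)
  moreover have "pcoeff (g - of_nat n * f) (lead_exp g) > 0"
    using le g by (simp add: pcoeff_of_nat_mult pcoeff_gt_lead_exp)
  ultimately show ?thesis unfolding less_puiseux_def puiseux_pos_iff by blast
qed

lemma less_of_nat_mult:
  assumes "0 < f" "0 < g" "rval f \<le> rval g"
  shows "\<exists>n. f < of_nat n * g"
proof -
  have le: "lead_exp f \<le> lead_exp g" using assms by (simp add: rval_pos)
  have g: "pcoeff g (lead_exp g) > 0" using assms(2) by (simp add: puiseux_less_0_iff puiseux_pos_def)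
  obtain n where n: "pcoeff f (lead_exp g) / pcoeff g (lead_exp g) < real n"
    using reals_Archimedean2 by blast
  have "\<forall>b>lead_exp g. pcoeff (of_nat n * g - f) b = 0"
    using le by (simp add: pcoeff_of_nat_mult pcoeff_gt_lead_exp)
  moreover have "pcoeff (of_nat n * g - f) (lead_exp g) > 0"
    using n g by (simp add: pcoeff_of_nat_mult pos_divide_less_eq)
  ultimately show ?thesis unfolding less_puiseux_def puiseux_pos_iff by blast
qed

text \<open>An integer factor cannot bridge different leading exponents, so a box with integer
  factors fixes the valuation.\<close>

lemma rval_squeeze:
  assumes m: "0 < m" and y: "y \<le> of_nat n * m" "m \<le> of_nat n * y"
  shows "rval y = rval m"
proof -
  have "0 < of_nat n * y" using m y(2) by (rule less_le_trans)
  then have y0: "0 < y" by (metis mult_pos_pos mult_zero_right not_less_iff_gr_or_eq of_nat_0_le_iff zero_less_mult_iff not_le)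
  have "\<not> rval m < rval y" using of_nat_mult_less[OF m y0, of n] y(1) by (meson not_le)
  moreover have "\<not> rval y < rval m" using of_nat_mult_less[OF y0 m, of n] y(2) by (meson not_le)
  ultimately show ?thesis by simp
qed

definition rlift :: "real \<Rightarrow> puiseux" where
  "rlift r = (if r = 0 then 0 else pmonom (sgn r) (ln \<bar>r\<bar>))"

lemma lead_exp_pmonom: "c \<noteq> 0 \<Longrightarrow> lead_exp (pmonom c a) = a"
  by (rule lead_exp_eqI) simp_all

lemma rval_rlift: "rval (rlift r) = r"
proof (cases "r = 0")
  case False
  have nz: "pmonom (sgn r) (ln \<bar>r\<bar>) \<noteq> 0"
  proof
    assume "pmonom (sgn r) (ln \<bar>r\<bar>) = 0"
    then have "pcoeff (pmonom (sgn r) (ln \<bar>r\<bar>)) (ln \<bar>r\<bar>) = 0" by (simp only: zero_puiseux.rep_eq)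
    then show False using False by (simp add: sgn_0_0)
  qed
  have "0 < pmonom (sgn r) (ln \<bar>r\<bar>) \<longleftrightarrow> 0 < r"
    using nz False by (simp add: puiseux_less_0_iff puiseux_pos_def lead_exp_pmonom sgn_0_0)
  then show ?thesis using nz False by (simp add: rlift_def rval_def lead_exp_pmonom sgn_0_0)
qed (simp add: rlift_def)

lemma rlift_pos: "0 < r \<Longrightarrow> 0 < rlift r"
  using rval_sign(1)[of "rlift r"] by (simp add: rval_rlift)

lemma sum_nonneg_dominated:
  fixes t :: "'i::finite \<Rightarrow> puiseux"
  assumes "0 \<le> (\<Sum>i\<in>UNIV. t i)"
  shows "\<exists>m. - rval (t i) \<le> rval (t m)"
proof (rule ccontr)
  assume "\<not> ?thesis"
  then have lt: "rval (t m) < - rval (t i)" for m by (meson not_le)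
  have "rval (t i) < 0" using lt[of i] by linarith
  then have ti: "0 < - t i" by (simp add: rval_sign)
  \<comment> \<open>The number of other terms. With the factor \<open>c + 1\<close> they compensate
    at most \<open>c\<close> of the \<open>c + 1\<close> copies of \<open>t i\<close>.\<close>
  define c where "c = card (UNIV - {i})"
  have le: "of_nat (c + 1) * t m \<le> - t i" for m
  proof (cases "0 < t m")
    case True
    show ?thesis
      by (rule less_imp_le, rule of_nat_mult_less[OF True ti]) (use lt[of m] in \<open>simp add: rval_uminus\<close>)
  next
    case False
    then have "of_nat (c + 1) * t m \<le> 0" by (simp add: mult_nonneg_nonpos)
    then show ?thesis using ti by (meson less_imp_le order_trans)
  qed
  have "(\<Sum>m\<in>UNIV - {i}. of_nat (c + 1) * t m) \<le> of_nat c * (- t i)"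
    unfolding c_def[symmetric] using sum_bounded_above[of "UNIV - {i}" "\<lambda>m. of_nat (c + 1) * t m" "- t i"] le
    by (simp add: c_def)
  moreover have "(\<Sum>m\<in>UNIV. of_nat (c + 1) * t m) = of_nat (c + 1) * t i + (\<Sum>m\<in>UNIV - {i}. of_nat (c + 1) * t m)"
    by (rule sum.remove) simp_all
  ultimately have "(\<Sum>m\<in>UNIV. of_nat (c + 1) * t m) \<le> of_nat (c + 1) * t i + of_nat c * (- t i)" by simp
  also have "\<dots> = t i" by (simp add: algebra_simps)
  also have "\<dots> < 0" using ti by simp
  finally have "of_nat (c + 1) * (\<Sum>m\<in>UNIV. t m) < 0" by (simp only: sum_distrib_left)
  moreover have "0 \<le> of_nat (c + 1) * (\<Sum>m\<in>UNIV. t m)" using assms by (intro mult_nonneg_nonneg of_nat_0_le_iff)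
  ultimately show False by simp
qed

lemma dot_nonneg_tnonneg: "0 \<le> dot g y \<Longrightarrow> tnonneg (\<lambda>o'. rval (g o')) (\<lambda>o'. rval (y o'))"
  unfolding tnonneg_iff rval_mult[symmetric] dot_def using sum_nonneg_dominated by blast

definition ocons :: "'a \<Rightarrow> ('n \<Rightarrow> 'a) \<Rightarrow> 'n option \<Rightarrow> 'a" where
  "ocons c x = (\<lambda>k. case k of None \<Rightarrow> c | Some i \<Rightarrow> x i)"

lemma ocons_simps [simp]: "ocons c x None = c" "ocons c x (Some i) = x i"
  by (simp_all add: ocons_def)

lemma dot_option: "dot a y = a None * y None + (\<Sum>i\<in>UNIV. a (Some i) * y (Some i))"
proof -
  have "dot a y = a None * y None + (\<Sum>i\<in>range Some. a i * y i)"
    unfolding dot_def UNIV_option_conv by (rule sum.insert) auto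
  also have "(\<Sum>i\<in>range Some. a i * y i) = (\<Sum>i\<in>UNIV. a (Some i) * y (Some i))"
    by (subst sum.reindex) simp_all
  finally show ?thesis .
qed

text \<open>The sum of the terms \<open>t\<close> is tested with weights \<open>n\<close> on positive and \<open>1 / n\<close> on negative terms,
  while the constant term keeps the weight \<open>1\<close>.\<close>

lemma weighted_sum_nonneg:
  fixes t :: "'n::finite option \<Rightarrow> puiseux"
  assumes k: "\<And>i. \<bar>rval (t i)\<bar> \<le> rval (t k)"
  shows "\<exists>M>0. \<forall>n\<ge>M. \<forall>w. w None = 1 \<longrightarrow>
    (\<forall>i. (0 < t (Some i) \<longrightarrow> w (Some i) = of_nat n) \<and> (t (Some i) < 0 \<longrightarrow> w (Some i) = 1 / of_nat n)) \<longrightarrow>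
    0 \<le> dot t w"
proof (cases "t k = 0")
  case True
  then have "t i = 0" for i using k[of i] rval_sign(3)[of "t i"] by simp
  then show ?thesis by (intro exI[of _ 1]) (simp add: dot_def)
next
  case False
  then have tk: "0 < t k" using k[of k] rval_sign[of "t k"] by (metis abs_ge_zero le_less order_trans)
  have "\<exists>M. \<bar>t i\<bar> \<le> of_nat M * t k" for i
  proof (cases "t i = 0")
    case False
    then have "0 < \<bar>t i\<bar>" by simp
    moreover have "rval \<bar>t i\<bar> \<le> rval (t k)" using k[of i] by (auto simp add: abs_if rval_uminus rval_sign)
    ultimately show ?thesis using less_of_nat_mult[of "\<bar>t i\<bar>" "t k"] tk less_imp_le by blast
  qed (auto intro: exI[of _ 0])
  then obtain M where M: "\<And>i. \<bar>t i\<bar> \<le> of_nat (M i) * t k" by metis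
  define C where "C = (\<Sum>i\<in>UNIV. M i)"
  show ?thesis
  proof (intro exI[of _ "C + 1"] conjI allI impI)
    fix n and w :: "'n option \<Rightarrow> puiseux"
    assume n: "C + 1 \<le> n" and w0: "w None = 1"
      and w: "\<forall>i. (0 < t (Some i) \<longrightarrow> w (Some i) = of_nat n) \<and> (t (Some i) < 0 \<longrightarrow> w (Some i) = 1 / of_nat n)"
    have n0: "0 < (of_nat n :: puiseux)" using n by simp
    have n1: "1 / (of_nat n :: puiseux) \<le> 1" using n n0 by (simp add: pos_divide_le_eq)
    \<comment> \<open>The dominating term has weight \<open>of_nat n * e\<close>, and other negative
      terms have weight at most \<open>e\<close>. The value \<open>1 / of_nat n\<close> occurs when
      the constant term dominates, as its weight is fixed to 1.\<close>
    define e :: puiseux where "e = (if k = None then 1 / of_nat n else 1)"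
    have e: "0 < e" unfolding e_def using n0 by simp
    have wk: "w k = of_nat n * e" using w0 w tk n0 by (cases k) (simp_all add: e_def)
    have term_ge: "- (e * (of_nat (M i) * t k)) \<le> t i * w i" if ik: "i \<noteq> k" for i
    proof -
      have pos: "0 \<le> e * (of_nat (M i) * t k)" using e tk by (intro mult_nonneg_nonneg) simp_all
      show ?thesis
      proof (cases "t i < 0")
        case True
        have "w i \<le> e"
        proof (cases i)
          case None
          then show ?thesis using w0 ik by (simp add: e_def)
        next
          case (Some j)
          then show ?thesis using w True n1 by (simp add: e_def)
        qed
        moreover have "0 \<le> w i"
        proof (cases i)
          case (Some j)
          then show ?thesis using w True n0 by (simp add: less_imp_le)
        qed (simp add: w0)
        ultimately have "\<bar>t i\<bar> * w i \<le> (of_nat (M i) * t k) * e"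
          using M[of i] e by (intro mult_mono) (auto intro: order_trans)
        then show ?thesis using True by (simp add: mult.commute)
      next
        case False
        have "0 \<le> t i * w i"
        proof (cases i)
          case None
          then show ?thesis using w0 False by simp
        next
          case (Some j)
          then show ?thesis using w False n0 by (cases "t i = 0") (auto intro!: mult_nonneg_nonneg simp: not_less le_less)
        qed
        then show ?thesis using pos by (meson neg_le_0_iff_le order_trans)
      qed
    qed
    have "(\<Sum>i\<in>UNIV - {k}. - (e * (of_nat (M i) * t k))) \<le> (\<Sum>i\<in>UNIV - {k}. t i * w i)"
      by (rule sum_mono) (use term_ge in blast)
    moreover have "(\<Sum>i\<in>UNIV - {k}. - (e * (of_nat (M i) * t k))) = - (e * t k * of_nat (\<Sum>i\<in>UNIV - {k}. M i))"
      by (simp add: sum_negf sum_distrib_left mult_ac)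
    moreover have "(\<Sum>i\<in>UNIV - {k}. M i) \<le> n"
    proof -
      have "(\<Sum>i\<in>UNIV - {k}. M i) \<le> C" unfolding C_def by (rule sum_mono2) auto
      then show ?thesis using n by simp
    qed
    then have "(of_nat (\<Sum>i\<in>UNIV - {k}. M i) :: puiseux) \<le> of_nat n" by (simp only: of_nat_le_iff)
    then have "e * t k * of_nat (\<Sum>i\<in>UNIV - {k}. M i) \<le> e * t k * of_nat n"
      using e tk by (intro mult_left_mono) simp_all
    moreover have "dot t w = t k * w k + (\<Sum>i\<in>UNIV - {k}. t i * w i)"
      unfolding dot_def by (rule sum.remove) simp_all
    ultimately show "0 \<le> dot t w" unfolding wk by (simp add: mult_ac)
  qed simp
qed

text \<open>\<open>\<tau>\<close> selects the coordinates to be enlarged in absolute value. The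
  valuation does not change, but for a suitable \<open>\<tau>\<close> the positive terms of an
  inequality grow relative to the constant and the negative ones shrink.\<close>

definition test_point :: "('n \<Rightarrow> real) \<Rightarrow> nat \<Rightarrow> ('n \<Rightarrow> bool) \<Rightarrow> 'n \<Rightarrow> puiseux" where
  "test_point x n \<tau> = (\<lambda>i. rlift (x i) * (if \<tau> i then of_nat n else 1 / of_nat n))"

lemma test_point_nonneg:
  fixes g :: "'n::finite option \<Rightarrow> puiseux"
  assumes "tnonneg (\<lambda>k. rval (g k)) (ocons 1 x)"
  shows "\<exists>M>0. \<forall>n\<ge>M. \<forall>\<tau>. (\<forall>i. (0 < rval (g (Some i)) * x i \<longrightarrow> \<tau> i) \<and> (rval (g (Some i)) * x i < 0 \<longrightarrow> \<not> \<tau> i)) \<longrightarrow>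
    0 \<le> dot g (ocons 1 (test_point x n \<tau>))"
proof -
  define t where "t = (\<lambda>k. g k * ocons 1 (\<lambda>i. rlift (x i)) k)"
  have t: "rval (t k) = rval (g k) * ocons 1 x k" for k
  proof (cases k)
    case None
    have "rval 1 = 1" using rval_rlift[of 1] rval_mult[of 1 1] rval_sign(3)[of 1] by simp
    then show ?thesis using None by (simp add: t_def)
  next
    case (Some i)
    then show ?thesis by (simp add: t_def rval_mult rval_rlift)
  qed
  obtain k where "\<And>i. \<bar>rval (t i)\<bar> \<le> rval (t k)" using assms unfolding tnonneg_def t by blast
  from weighted_sum_nonneg[of t, OF this] obtain M where M: "M > 0"
    and nn: "\<And>n w. n \<ge> M \<Longrightarrow> w None = 1 \<Longrightarrow>
      (\<And>i. (0 < t (Some i) \<longrightarrow> w (Some i) = of_nat n) \<and> (t (Some i) < 0 \<longrightarrow> w (Some i) = 1 / of_nat n)) \<Longrightarrow>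
      0 \<le> dot t w" by blast
  show ?thesis
  proof (intro exI[of _ M] conjI allI impI M)
    fix n \<tau>
    assume n: "M \<le> n" and \<tau>: "\<forall>i. (0 < rval (g (Some i)) * x i \<longrightarrow> \<tau> i) \<and> (rval (g (Some i)) * x i < 0 \<longrightarrow> \<not> \<tau> i)"
    have "0 \<le> dot t (ocons 1 (\<lambda>i. if \<tau> i then of_nat n else 1 / of_nat n))"
    proof (rule nn[OF n])
      fix i
      show "(0 < t (Some i) \<longrightarrow> ocons 1 (\<lambda>i. if \<tau> i then of_nat n else 1 / of_nat n) (Some i) = of_nat n) \<and>
        (t (Some i) < 0 \<longrightarrow> ocons 1 (\<lambda>i. if \<tau> i then of_nat n else 1 / of_nat n) (Some i) = 1 / of_nat n)"
        using \<tau> t[of "Some i"] rval_sign[of "t (Some i)"] by simp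
    qed simp
    also have "dot t (ocons 1 (\<lambda>i. if \<tau> i then of_nat n else 1 / of_nat n)) = dot g (ocons 1 (test_point x n \<tau>))"
      unfolding dot_option t_def test_point_def by (simp add: mult.assoc)
    finally show "0 \<le> dot g (ocons 1 (test_point x n \<tau>))" .
  qed
qed

lemma rval_of_nat: "0 < n \<Longrightarrow> rval (of_nat n) = 1"
  using rval_squeeze[of 1 "of_nat n" n] rval_rlift[of 1] rval_mult[of 1 1] rval_sign(3)[of 1]
  by (simp add: of_nat_mult[symmetric] del: of_nat_mult)

lemma rval_one: "rval 1 = 1"
  using rval_mult[of 1 1] rval_sign(3)[of 1] by simp

lemma rval_test_point:
  assumes "0 < n"
  shows "rval (test_point x n \<tau> i) = x i"
proof -
  have "rval (1 / of_nat n) * rval (of_nat n) = rval 1"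
    unfolding rval_mult[symmetric] using assms by simp
  then have "rval (1 / of_nat n) = 1" using rval_of_nat[OF assms] rval_one by simp
  then show ?thesis by (simp add: test_point_def rval_mult rval_rlift rval_of_nat[OF assms])
qed

text \<open>For one inequality a lift can be adapted to its signs: exactly the coordinates with
  positive terms are enlarged. Several inequalities make conflicting demands on the lift, which is
  why polyhedra need boxes.\<close>

theorem rval_halfspace:
  fixes g :: "'n::finite option \<Rightarrow> puiseux"
  shows "(\<exists>y. 0 \<le> dot g (ocons 1 y) \<and> (\<forall>i. rval (y i) = x i)) \<longleftrightarrow> tnonneg (\<lambda>k. rval (g k)) (ocons 1 x)"
proof
  assume "\<exists>y. 0 \<le> dot g (ocons 1 y) \<and> (\<forall>i. rval (y i) = x i)"
  then obtain y where y: "0 \<le> dot g (ocons 1 y)" "\<And>i. rval (y i) = x i" by blast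
  have "(\<lambda>k. rval (ocons 1 y k)) = ocons 1 x"
    using y(2) by (auto simp: fun_eq_iff ocons_def rval_one split: option.split)
  then show "tnonneg (\<lambda>k. rval (g k)) (ocons 1 x)" using dot_nonneg_tnonneg[OF y(1)] by simp
next
  assume "tnonneg (\<lambda>k. rval (g k)) (ocons 1 x)"
  from test_point_nonneg[OF this] obtain M where M: "M > 0"
    and nn: "\<And>\<tau>. (\<forall>i. (0 < rval (g (Some i)) * x i \<longrightarrow> \<tau> i) \<and> (rval (g (Some i)) * x i < 0 \<longrightarrow> \<not> \<tau> i)) \<Longrightarrow>
      0 \<le> dot g (ocons 1 (test_point x M \<tau>))" by blast
  have "0 \<le> dot g (ocons 1 (test_point x M (\<lambda>i. 0 < rval (g (Some i)) * x i)))"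
    by (rule nn) auto
  then show "\<exists>y. 0 \<le> dot g (ocons 1 y) \<and> (\<forall>i. rval (y i) = x i)"
    by (intro exI[of _ "test_point x M (\<lambda>i. 0 < rval (g (Some i)) * x i)"] conjI allI rval_test_point[OF M])
qed

section \<open>Boxes of lifts and valuations of polyhedra\<close>

definition two_term :: "'k::zero \<Rightarrow> 'n \<Rightarrow> 'k \<Rightarrow> 'n option \<Rightarrow> 'k" where
  "two_term c i d = ocons c (\<lambda>j. if j = i then d else 0)"

lemma dot_two_term:
  fixes y :: "'n::finite option \<Rightarrow> 'k::linordered_field"
  shows "dot (two_term c i d) y = c * y None + d * y (Some i)"
  unfolding dot_option two_term_def by (simp add: if_distrib[of "\<lambda>u. u * _"] cong: if_cong)

text \<open>The vectors of the cone over \<open>box_rows x n\<close> have the signs of \<open>x\<close> and coordinates within a factor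
  \<open>n\<close> of the lift of \<open>x\<close>.\<close>

definition box_rows :: "('n \<Rightarrow> real) \<Rightarrow> nat \<Rightarrow> ('n option \<Rightarrow> puiseux) set" where
  "box_rows x n = (\<Union>i. if x i = 0 then {two_term 0 i 1, two_term 0 i (- 1)}
     else {two_term (of_nat n * rlift \<bar>x i\<bar>) i (- rlift (sgn (x i))), two_term (- rlift \<bar>x i\<bar>) i (of_nat n * rlift (sgn (x i)))})"

lemma rlift_zero [simp]: "rlift 0 = 0"
  by (simp add: rlift_def)

lemma rlift_one [simp]: "rlift 1 = 1"
  by (rule puiseux_eqI) (simp add: rlift_def)

lemma rlift_minus_one [simp]: "rlift (- 1) = - 1"
  by (rule puiseux_eqI) (simp add: rlift_def)

lemma rlift_sgn_mult: "rlift (sgn r) * rlift r = rlift \<bar>r\<bar>"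
proof -
  have "rlift (- r) = - rlift r"
    by (rule puiseux_eqI) (simp add: rlift_def)
  then show ?thesis by (cases r "0::real" rule: linorder_cases) simp_all
qed

lemma finite_box_rows: "finite (box_rows x n :: ('n::finite option \<Rightarrow> puiseux) set)"
  unfolding box_rows_def by (rule finite_UN_I) simp_all

lemma box_rows_rval:
  fixes y :: "'n::finite \<Rightarrow> puiseux"
  assumes "\<And>r. r \<in> box_rows x n \<Longrightarrow> 0 \<le> dot r (ocons 1 y)"
  shows "rval (y i) = x i"
proof (cases "x i = 0")
  case True
  then have "two_term 0 i 1 \<in> box_rows x n" "two_term 0 i (- 1) \<in> box_rows x n" unfolding box_rows_def by force+
  from assms[OF this(1)] assms[OF this(2)] show ?thesis using True by (simp add: dot_two_term)
next
  case False
  let ?s = "rlift (sgn (x i))"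
  have "two_term (of_nat n * rlift \<bar>x i\<bar>) i (- ?s) \<in> box_rows x n" "two_term (- rlift \<bar>x i\<bar>) i (of_nat n * ?s) \<in> box_rows x n"
    unfolding box_rows_def using False by force+
  from assms[OF this(1)] assms[OF this(2)]
  have "?s * y i \<le> of_nat n * rlift \<bar>x i\<bar>" "rlift \<bar>x i\<bar> \<le> of_nat n * (?s * y i)"
    by (simp_all add: dot_two_term mult.assoc)
  from rval_squeeze[OF _ this] have "rval (?s * y i) = \<bar>x i\<bar>"
    using False by (simp add: rval_rlift rlift_pos)
  then have "sgn (x i) * rval (y i) = \<bar>x i\<bar>" by (simp add: rval_mult rval_rlift)
  then show ?thesis using False by (cases "0 < x i") simp_all
qed

lemma box_rows_test_point:
  fixes x :: "'n::finite \<Rightarrow> real"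
  assumes r: "r \<in> box_rows x n" and n: "0 < n"
  shows "0 \<le> dot r (ocons 1 (test_point x n \<tau>))"
proof -
  have n1: "(1::puiseux) \<le> of_nat n" using n by simp
  have n0: "(0::puiseux) < of_nat n" using n by simp
  obtain i where i: "r \<in> (if x i = 0 then {two_term 0 i 1, two_term 0 i (- 1)}
     else {two_term (of_nat n * rlift \<bar>x i\<bar>) i (- rlift (sgn (x i))), two_term (- rlift \<bar>x i\<bar>) i (of_nat n * rlift (sgn (x i)))})"
    using r unfolding box_rows_def by blast
  define m where "m = rlift \<bar>x i\<bar>"
  define w :: puiseux where "w = (if \<tau> i then of_nat n else 1 / of_nat n)"
  have nn: "(1::puiseux) / of_nat n \<le> 1" using n1 n0 by (simp add: pos_divide_le_eq)
  have w: "w \<le> of_nat n" "1 \<le> of_nat n * w"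
    using n1 order_trans[OF nn n1] n0 mult_mono[OF n1 n1] by (auto simp: w_def)
  have sm: "rlift (sgn (x i)) * test_point x n \<tau> i = m * w"
    unfolding test_point_def m_def w_def rlift_sgn_mult[symmetric] by (simp only: mult.assoc)
  show ?thesis
  proof (cases "x i = 0")
    case True
    then show ?thesis using i by (auto simp: dot_two_term test_point_def)
  next
    case False
    then have m: "0 \<le> m" unfolding m_def using rlift_pos[of "\<bar>x i\<bar>"] by simp
    have 1: "m * w \<le> m * of_nat n" "m * 1 \<le> m * (of_nat n * w)"
      using mult_left_mono[OF w(1) m] mult_left_mono[OF w(2) m] by simp_all
    consider "r = two_term (of_nat n * m) i (- rlift (sgn (x i)))" | "r = two_term (- m) i (of_nat n * rlift (sgn (x i)))"
      using i False unfolding m_def by auto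
    then show ?thesis
    proof cases
      case 1
      then have "dot r (ocons 1 (test_point x n \<tau>)) = of_nat n * m - rlift (sgn (x i)) * test_point x n \<tau> i"
        by (simp add: dot_two_term)
      then show ?thesis using \<open>m * w \<le> m * of_nat n\<close> unfolding sm by (simp add: mult.commute)
    next
      case 2
      then have "dot r (ocons 1 (test_point x n \<tau>)) = of_nat n * (rlift (sgn (x i)) * test_point x n \<tau> i) - m"
        by (simp add: dot_two_term mult.assoc)
      then show ?thesis using \<open>m * 1 \<le> m * (of_nat n * w)\<close> unfolding sm by (simp add: mult.left_commute)
    qed
  qed
qed

definition sign_rows :: "('i \<Rightarrow> bool) \<Rightarrow> ('i \<Rightarrow> 'k::linordered_field) set" where
  "sign_rows \<sigma> = range (\<lambda>i k. if k = i then (if \<sigma> i then 1 else - 1) else 0)"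

lemma sign_rows_iff:
  fixes f :: "'i::finite \<Rightarrow> 'k::linordered_field"
  shows "(\<forall>d\<in>sign_rows \<sigma>. 0 \<le> dot d f) \<longleftrightarrow> (\<forall>i. if \<sigma> i then 0 \<le> f i else f i \<le> 0)"
  by (auto simp: sign_rows_def dot_commute[of _ f] dot_unit split: if_splits)

text \<open>The rows that cut out \<open>rval ` P\<close> are the generators of the intersections of the dual cone of \<open>P\<close>
  with the orthants: the value at a test point adapted to an orthant is nonnegative on that whole
  intersection as soon as it is nonnegative on the generators, so that Farkas' lemma over the
  Puiseux series applies.\<close>

theorem rval_polyhedron:
  fixes D :: "('n::finite option \<Rightarrow> puiseux) set"
  assumes D: "finite D"
  shows "\<exists>E. finite E \<and> (\<forall>x. (\<exists>y. (\<forall>g\<in>D. 0 \<le> dot g (ocons 1 y)) \<and> (\<forall>i. rval (y i) = x i)) \<longleftrightarrow>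
    (\<forall>g\<in>E. tnonneg (\<lambda>k. rval (g k)) (ocons 1 x)))"
proof -
  \<comment> \<open>The dual cone is generated by \<open>D\<close>. A description by inequalities is
    needed to cut it with the orthants and to obtain generators of the pieces.\<close>
  obtain D' where D': "finite D'" "\<And>f. f \<in> cspan D \<longleftrightarrow> (\<forall>d\<in>D'. 0 \<le> dot d f)"
    using finitely_generated_cone_polyhedral[OF D] by blast
  have "\<exists>G. finite G \<and> (\<forall>f. f \<in> cspan G \<longleftrightarrow> (\<forall>d\<in>D' \<union> sign_rows \<sigma>. 0 \<le> dot d f))" for \<sigma> :: "'n option \<Rightarrow> bool"
    by (rule polyhedral_cone_finitely_generated) (simp add: D' sign_rows_def)
  then obtain G where G: "\<And>\<sigma>. finite (G \<sigma>)"
    "\<And>\<sigma> f. f \<in> cspan (G \<sigma>) \<longleftrightarrow> (\<forall>d\<in>D' \<union> sign_rows (\<sigma> :: 'n option \<Rightarrow> bool). 0 \<le> dot d f)" by metis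
  have G_iff: "f \<in> cspan (G \<sigma>) \<longleftrightarrow> f \<in> cspan D \<and> (\<forall>i. if \<sigma> i then 0 \<le> f i else f i \<le> 0)" for \<sigma> f
    unfolding G(2) D'(2) ball_Un sign_rows_iff ..
  define E where "E = (\<Union>\<sigma>. G \<sigma>)"
  have E: "finite E" unfolding E_def using G(1) by simp
  have "(\<exists>y. (\<forall>g\<in>D. 0 \<le> dot g (ocons 1 y)) \<and> (\<forall>i. rval (y i) = x i)) \<longleftrightarrow>
    (\<forall>g\<in>E. tnonneg (\<lambda>k. rval (g k)) (ocons 1 x))" for x
  proof
    assume "\<exists>y. (\<forall>g\<in>D. 0 \<le> dot g (ocons 1 y)) \<and> (\<forall>i. rval (y i) = x i)"
    then obtain y where y: "\<And>g. g \<in> D \<Longrightarrow> 0 \<le> dot g (ocons 1 y)" "\<And>i. rval (y i) = x i" by blast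
    show "\<forall>g\<in>E. tnonneg (\<lambda>k. rval (g k)) (ocons 1 x)"
    proof
      fix g assume "g \<in> E"
      then obtain \<sigma> where "g \<in> G \<sigma>" unfolding E_def by blast
      then have "g \<in> cspan D" using G_iff[of g \<sigma>] cspan_base by blast
      then have "0 \<le> dot (ocons 1 y) g" by (rule cspan_dot_nonneg) (use y(1) dot_commute in metis)
      then have "0 \<le> dot g (ocons 1 y)" by (simp only: dot_commute)
      then show "tnonneg (\<lambda>k. rval (g k)) (ocons 1 x)" using rval_halfspace[of g x] y(2) by blast
    qed
  next
    assume hsE: "\<forall>g\<in>E. tnonneg (\<lambda>k. rval (g k)) (ocons 1 x)"
    \<comment> \<open>Where \<open>x i\<close> is nonzero, a row in the orthant
      \<open>\<sigma>\<close> has a nonnegative term at \<open>i\<close> if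
      \<open>\<tau> \<sigma> i\<close> holds and a nonpositive one otherwise.\<close>
    define \<tau> where "\<tau> \<sigma> i \<longleftrightarrow> \<sigma> (Some i) = (0 < x i)" for \<sigma> :: "'n option \<Rightarrow> bool" and i
    have "\<forall>g\<in>E. \<exists>M>0. \<forall>n\<ge>M. \<forall>\<tau>. (\<forall>i. (0 < rval (g (Some i)) * x i \<longrightarrow> \<tau> i) \<and> (rval (g (Some i)) * x i < 0 \<longrightarrow> \<not> \<tau> i)) \<longrightarrow>
      0 \<le> dot g (ocons 1 (test_point x n \<tau>))"
      using hsE test_point_nonneg by blast
    then obtain M where M: "\<And>g. g \<in> E \<Longrightarrow> 0 < M g"
      and Mn: "\<And>g n \<tau>. g \<in> E \<Longrightarrow> M g \<le> n \<Longrightarrow>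
        (\<forall>i. (0 < rval (g (Some i)) * x i \<longrightarrow> \<tau> i) \<and> (rval (g (Some i)) * x i < 0 \<longrightarrow> \<not> \<tau> i)) \<Longrightarrow>
        0 \<le> dot g (ocons 1 (test_point x n \<tau>))" by metis
    \<comment> \<open>Since \<open>E\<close> is finite, one box size serves all rows and all
      orthants.\<close>
    define n where "n = Max (insert 1 (M ` E))"
    have n: "0 < n" "\<And>g. g \<in> E \<Longrightarrow> M g \<le> n"
      unfolding n_def using E by (simp_all add: Max_gr_iff)
    have G_test: "0 \<le> dot g (ocons 1 (test_point x n (\<tau> \<sigma>)))" if g: "g \<in> G \<sigma>" for g \<sigma>
    proof (rule Mn)
      show gE: "g \<in> E" using g unfolding E_def by blast
      show "M g \<le> n" using n(2)[OF gE] .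
      have "\<forall>i. if \<sigma> i then 0 \<le> g i else g i \<le> 0" using G_iff[of g \<sigma>] g cspan_base by blast
      then have "if \<sigma> (Some i) then 0 \<le> rval (g (Some i)) else rval (g (Some i)) \<le> 0" for i
        using rval_sign[of "g (Some i)"] by (metis le_less)
      then show "\<forall>i. (0 < rval (g (Some i)) * x i \<longrightarrow> \<tau> \<sigma> i) \<and> (rval (g (Some i)) * x i < 0 \<longrightarrow> \<not> \<tau> \<sigma> i)"
        unfolding \<tau>_def zero_less_mult_iff mult_less_0_iff by (smt (verit))
    qed
    \<comment> \<open>Membership of \<open>?e\<close> would certify that no solution lies in the
      box. The part \<open>f\<close> of such a certificate in the dual cone determines an orthant,
      and the test point of this orthant is nonnegative on \<open>f\<close> and on the box rows but
      has value -1 on \<open>?e\<close>.\<close>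
    let ?e = "(\<lambda>k. if k = None then - 1 else 0) :: 'n option \<Rightarrow> puiseux"
    have "?e \<notin> cspan (D \<union> box_rows x n)"
    proof
      assume "?e \<in> cspan (D \<union> box_rows x n)"
      then obtain f \<rho> where f: "f \<in> cspan D" and \<rho>: "\<rho> \<in> cspan (box_rows x n)" and e: "?e = (\<lambda>k. f k + \<rho> k)"
        using cspan_decomp[of ?e "D \<union> box_rows x n" D "box_rows x n"] by blast
      define \<sigma> where "\<sigma> k \<longleftrightarrow> 0 \<le> f k" for k
      define y where "y = ocons 1 (test_point x n (\<tau> \<sigma>))"
      have "f \<in> cspan (G \<sigma>)" unfolding G_iff using f by (auto simp: \<sigma>_def)
      then have "0 \<le> dot y f"
        by (rule cspan_dot_nonneg) (use G_test dot_commute y_def in metis)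
      moreover have "0 \<le> dot y \<rho>"
        by (rule cspan_dot_nonneg[OF \<rho>]) (use box_rows_test_point[OF _ n(1)] dot_commute y_def in metis)
      moreover have "dot y f + dot y \<rho> = dot y ?e" unfolding e dot_add ..
      moreover have "dot y ?e = - 1" unfolding dot_unit by (simp add: y_def)
      ultimately show False by simp
    qed
    moreover obtain C where C: "finite C" "\<And>f. f \<in> cspan (D \<union> box_rows x n) \<longleftrightarrow> (\<forall>d\<in>C. 0 \<le> dot d f)"
      using finitely_generated_cone_polyhedral[of "D \<union> box_rows x n"] D finite_box_rows by blast
    ultimately obtain d where d: "d \<in> C" "\<not> 0 \<le> dot d ?e" by blast
    \<comment> \<open>The violated row has a positive constant entry; dividing by it turns the row
      into a solution inside the box.\<close>
    then have d0: "0 < d None" unfolding dot_unit by simp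
    define y where "y i = d (Some i) / d None" for i
    have y: "(\<lambda>k. (1 / d None) * d k) = ocons 1 y"
      using d0 by (auto simp: fun_eq_iff ocons_def y_def split: option.split)
    have nn: "0 \<le> dot g (ocons 1 y)" if "g \<in> D \<union> box_rows x n" for g
    proof -
      have "g \<in> cspan (D \<union> box_rows x n)" using that by (rule cspan_base)
      then have "0 \<le> dot d g" using C(2) d(1) by blast
      then have "0 \<le> dot g d" by (simp only: dot_commute)
      then show ?thesis unfolding y[symmetric] dot_scale using d0 by simp
    qed
    have "rval (y i) = x i" for i by (rule box_rows_rval[of x n]) (use nn in blast)
    then show "\<exists>y. (\<forall>g\<in>D. 0 \<le> dot g (ocons 1 y)) \<and> (\<forall>i. rval (y i) = x i)" using nn by blast
  qed
  then show ?thesis using E by blast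
qed

section \<open>Signed tropical numbers as reals\<close>

fun to_real :: "sym_trop \<Rightarrow> real" where
  "to_real TZero = 0"
| "to_real (TNum Plus r) = exp r"
| "to_real (TNum Minus r) = - exp r"
| "to_real (TNum Balanced r) = exp r"

definition to_trop :: "real \<Rightarrow> sym_trop" where
  "to_trop r = (if r = 0 then TZero else if 0 < r then TNum Plus (ln r) else TNum Minus (ln (- r)))"

lemma T_signed_iff: "x \<in> T_signed \<longleftrightarrow> (\<forall>r. x \<noteq> TNum Balanced r)"
proof (cases x)
  case (TNum s r)
  then show ?thesis by (cases s) (auto simp: T_signed_def T_pos_def T_neg_def zero_sym_trop_def)
qed (simp add: T_signed_def zero_sym_trop_def)

lemma T_signed_cases:
  assumes "x \<in> T_signed"
  obtains "x = TZero" | r where "x = TNum Plus r" | r where "x = TNum Minus r"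
  using assms unfolding T_signed_iff by (metis sym_trop.exhaust tsign.exhaust)

lemma to_trop_signed [simp]: "to_trop r \<in> T_signed"
  by (simp add: T_signed_iff to_trop_def)

lemma to_real_to_trop [simp]: "to_real (to_trop r) = r"
  by (simp add: to_trop_def)

lemma to_trop_to_real: "x \<in> T_signed \<Longrightarrow> to_trop (to_real x) = x"
  by (erule T_signed_cases) (simp_all add: to_trop_def)

lemma to_real_inj: "x \<in> T_signed \<Longrightarrow> y \<in> T_signed \<Longrightarrow> to_real x = to_real y \<Longrightarrow> x = y"
  by (metis to_trop_to_real)

lemma T_signed_mult: "x \<in> T_signed \<Longrightarrow> y \<in> T_signed \<Longrightarrow> x * y \<in> T_signed"
  by (erule T_signed_cases; erule T_signed_cases) (simp_all add: T_signed_iff)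

lemma to_real_mult: "x \<in> T_signed \<Longrightarrow> y \<in> T_signed \<Longrightarrow> to_real (x * y) = to_real x * to_real y"
  by (erule T_signed_cases; erule T_signed_cases) (simp_all add: exp_add)

lemma T_signed_left_sum: "x \<in> T_signed \<Longrightarrow> y \<in> T_signed \<Longrightarrow> x \<lhd> y \<in> T_signed"
  by (erule T_signed_cases; erule T_signed_cases) (auto simp: T_signed_iff left_sum_def)

lemma to_real_left_sum:
  "x \<in> T_signed \<Longrightarrow> y \<in> T_signed \<Longrightarrow> to_real (x \<lhd> y) = (if \<bar>to_real y\<bar> \<le> \<bar>to_real x\<bar> then to_real x else to_real y)"
  by (erule T_signed_cases; erule T_signed_cases) (auto simp: left_sum_def)

lemma sval_signed [simp]: "sval f \<in> T_signed"
  by (auto simp: sval_def T_signed_iff zero_sym_trop_def)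

lemma to_real_sval [simp]: "to_real (sval f) = rval f"
  by (simp add: sval_def rval_def zero_sym_trop_def)

lemma T_nonneg_iff: "l \<in> T_nonneg \<longleftrightarrow> l \<in> T_signed \<and> 0 \<le> to_real l"
proof (cases l)
  case (TNum s r)
  then show ?thesis by (cases s) (auto simp: T_nonneg_def T_pos_def zero_sym_trop_def T_signed_iff)
qed (simp add: T_nonneg_def zero_sym_trop_def T_signed_iff)

definition rvec :: "sym_trop ^ 'n \<Rightarrow> 'n \<Rightarrow> real" where
  "rvec x = (\<lambda>i. to_real (x $ i))"

definition tvec :: "('n \<Rightarrow> real) \<Rightarrow> sym_trop ^ 'n" where
  "tvec p = (\<chi> i. to_trop (p i))"

lemma tvec_signed [simp]: "tvec p \<in> signed_space"
  by (simp add: signed_space_def tvec_def)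

lemma rvec_tvec [simp]: "rvec (tvec p) = p"
  by (simp add: rvec_def tvec_def)

lemma tvec_rvec: "x \<in> signed_space \<Longrightarrow> tvec (rvec x) = x"
  by (simp add: signed_space_def tvec_def rvec_def vec_eq_iff to_trop_to_real)

text \<open>\<open>trop_of_parts p q\<close> is the tropical sum of positive numbers of largest norm \<open>ln p\<close> and
  negative numbers of largest norm \<open>ln q\<close>.\<close>

definition trop_of_parts :: "real \<Rightarrow> real \<Rightarrow> sym_trop" where
  "trop_of_parts p q = (if q < p then TNum Plus (ln p) else if p < q then TNum Minus (ln q)
     else if p = 0 then TZero else TNum Balanced (ln p))"

lemma trop_of_parts_add_pos:
  assumes "0 \<le> p" "0 \<le> q" "0 < r"
  shows "TNum Plus (ln r) + trop_of_parts p q = trop_of_parts (max r p) q"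
  by (cases p q rule: linorder_cases; cases r p rule: linorder_cases; cases r q rule: linorder_cases)
    (use assms in \<open>auto simp: trop_of_parts_def max_def\<close>)

lemma trop_of_parts_add_neg:
  assumes "0 \<le> p" "0 \<le> q" "0 < r"
  shows "TNum Minus (ln r) + trop_of_parts p q = trop_of_parts p (max r q)"
  by (cases p q rule: linorder_cases; cases r p rule: linorder_cases; cases r q rule: linorder_cases)
    (use assms in \<open>auto simp: trop_of_parts_def max_def\<close>)

lemma trop_of_parts_add:
  assumes "0 \<le> p" "0 \<le> q" "x \<in> T_signed"
  shows "x + trop_of_parts p q = trop_of_parts (max (to_real x) p) (max (- to_real x) q)"
  using assms(3)
proof (cases rule: T_signed_cases)
  case 1
  then show ?thesis using assms by (simp add: max_def)
next
  case (2 r)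
  have "TNum Plus (ln (exp r)) + trop_of_parts p q = trop_of_parts (max (exp r) p) q" by (rule trop_of_parts_add_pos) (use assms in simp_all)
  moreover have "max (- exp r) q = q" using assms(2) exp_gt_zero[of r] by linarith
  ultimately show ?thesis using 2 by simp
next
  case (3 r)
  have "TNum Minus (ln (exp r)) + trop_of_parts p q = trop_of_parts p (max (exp r) q)" by (rule trop_of_parts_add_neg) (use assms in simp_all)
  moreover have "max (- exp r) p = p" using assms(1) exp_gt_zero[of r] by linarith
  ultimately show ?thesis using 3 by simp
qed

lemma sum_eq_trop_of_parts:
  assumes "finite A" "\<And>i. i \<in> A \<Longrightarrow> f i \<in> T_signed"
  shows "sum f A = trop_of_parts (Max (insert 0 ((\<lambda>i. to_real (f i)) ` A))) (Max (insert 0 ((\<lambda>i. - to_real (f i)) ` A)))"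
  using assms
proof (induction A)
  case empty
  then show ?case by (simp add: trop_of_parts_def zero_sym_trop_def)
next
  case (insert a A)
  have IH: "sum f A = trop_of_parts (Max (insert 0 ((\<lambda>i. to_real (f i)) ` A))) (Max (insert 0 ((\<lambda>i. - to_real (f i)) ` A)))"
    by (rule insert.IH) (use insert.prems in blast)
  have st_eq: "f a + sum f A = trop_of_parts (max (to_real (f a)) (Max (insert 0 ((\<lambda>i. to_real (f i)) ` A))))
      (max (- to_real (f a)) (Max (insert 0 ((\<lambda>i. - to_real (f i)) ` A))))"
    unfolding IH by (rule trop_of_parts_add) (use insert.hyps insert.prems in simp_all)
  have M: "Max (insert 0 (g ` insert a A)) = max (g a) (Max (insert 0 (g ` A)))" for g :: "_ \<Rightarrow> real"
    using insert.hyps by (simp add: insert_commute[of 0])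
  show ?case unfolding sum.insert[OF insert.hyps(1,2)] M by (rule st_eq)
qed

lemma trop_of_parts_nonneg_iff: "trop_of_parts p q \<in> T_pos \<union> T_bal \<longleftrightarrow> q \<le> p"
  by (auto simp: trop_of_parts_def T_pos_def T_bal_def zero_sym_trop_def)

lemma sum_nonneg_iff:
  fixes f :: "'i::finite \<Rightarrow> sym_trop"
  assumes "\<And>i. f i \<in> T_signed"
  shows "sum f UNIV \<in> T_pos \<union> T_bal \<longleftrightarrow> (\<forall>i. \<exists>m. - to_real (f i) \<le> to_real (f m))"
proof -
  have "sum f UNIV \<in> T_pos \<union> T_bal \<longleftrightarrow>
      Max (insert 0 (range (\<lambda>i. - to_real (f i)))) \<le> Max (insert 0 (range (\<lambda>i. to_real (f i))))"
    using sum_eq_trop_of_parts[of UNIV f] assms by (simp only: trop_of_parts_nonneg_iff finite)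
  also have "\<dots> \<longleftrightarrow> (\<forall>i. - to_real (f i) \<le> Max (insert 0 (range (\<lambda>i. to_real (f i)))))"
    by simp
  also have "\<dots> \<longleftrightarrow> (\<forall>i. \<exists>m. - to_real (f i) \<le> to_real (f m))"
  proof (intro iff_allI iffI)
    fix i assume *: "- to_real (f i) \<le> Max (insert 0 (range (\<lambda>i. to_real (f i))))"
    have "Max (insert 0 (range (\<lambda>i. to_real (f i)))) \<in> insert 0 (range (\<lambda>i. to_real (f i)))" by (rule Max_in) simp_all
    then consider "- to_real (f i) \<le> 0" | m where "- to_real (f i) \<le> to_real (f m)" using * by auto
    then show "\<exists>m. - to_real (f i) \<le> to_real (f m)"
    proof cases
      case 1
      then show ?thesis by (intro exI[of _ i]) simp
    qed blast
  next
    fix i assume "\<exists>m. - to_real (f i) \<le> to_real (f m)"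
    then obtain m where "- to_real (f i) \<le> to_real (f m)" by blast
    moreover have "to_real (f m) \<le> Max (insert 0 (range (\<lambda>i. to_real (f i))))" by (rule Max_ge) simp_all
    ultimately show "- to_real (f i) \<le> Max (insert 0 (range (\<lambda>i. to_real (f i))))" by linarith
  qed
  finally show ?thesis .
qed

text \<open>A row may have zero linear part and is then an inequality between constants. Generators
  of dual cones and polars can be of this kind; \<open>finite_intersection_iff\<close> eliminates
  them.\<close>

definition solutions :: "('n::finite option \<Rightarrow> real) set \<Rightarrow> (sym_trop ^ 'n) set" where
  "solutions A = {x \<in> signed_space. \<forall>b\<in>A. tnonneg b (ocons 1 (rvec x))}"

lemma closed_halfspace_eq:
  fixes a :: "sym_trop ^ 'n::finite"
  assumes "a0 \<in> T_signed" "a \<in> signed_space"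
  shows "closed_halfspace a0 a = solutions {ocons (to_real a0) (rvec a)}"
proof -
  have "a0 + (\<Sum>i\<in>UNIV. a $ i * x $ i) \<in> T_pos \<union> T_bal \<longleftrightarrow> tnonneg (ocons (to_real a0) (rvec a)) (ocons 1 (rvec x))"
    if x: "x \<in> signed_space" for x
  proof -
    define f where "f = ocons a0 (\<lambda>i. a $ i * x $ i)"
    have f: "f k \<in> T_signed" "to_real (f k) = ocons (to_real a0) (rvec a) k * ocons 1 (rvec x) k" for k
      using assms x by (cases k; simp add: f_def signed_space_def T_signed_mult to_real_mult rvec_def)+
    have "sum f UNIV = f None + sum f (range Some)"
      unfolding UNIV_option_conv by (rule sum.insert) auto
    also have "sum f (range Some) = (\<Sum>i\<in>UNIV. a $ i * x $ i)"
      by (subst sum.reindex) (simp_all add: f_def)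
    finally have "a0 + (\<Sum>i\<in>UNIV. a $ i * x $ i) = sum f UNIV" by (simp add: f_def)
    then show ?thesis using sum_nonneg_iff[of f, OF f(1)] unfolding tnonneg_iff f(2) by simp
  qed
  then show ?thesis unfolding closed_halfspace_def solutions_def by auto
qed

lemma is_closed_halfspace_iff:
  "is_closed_halfspace H \<longleftrightarrow> (\<exists>b. (\<exists>i. b (Some i) \<noteq> 0) \<and> H = solutions {b})"
proof
  assume "is_closed_halfspace H"
  then obtain a0 a where a: "a0 \<in> T_signed" "a \<in> signed_space" "a \<noteq> 0" "H = closed_halfspace a0 a"
    unfolding is_closed_halfspace_def by blast
  have "\<exists>i. a $ i \<noteq> 0" using a(3) by (simp add: vec_eq_iff)
  then obtain i where "a $ i \<noteq> TZero" by (auto simp: zero_sym_trop_def)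
  moreover have "a $ i \<in> T_signed" using a(2) by (simp add: signed_space_def)
  ultimately have "to_real (a $ i) \<noteq> 0" using to_real_inj[of "a $ i" TZero] by (auto simp: T_signed_iff)
  then show "\<exists>b. (\<exists>i. b (Some i) \<noteq> 0) \<and> H = solutions {b}"
    using a(4) closed_halfspace_eq[OF a(1,2)] by (intro exI[of _ "ocons (to_real a0) (rvec a)"]) (auto simp: rvec_def)
next
  assume "\<exists>b. (\<exists>i. b (Some i) \<noteq> 0) \<and> H = solutions {b}"
  then obtain b i where b: "b (Some i) \<noteq> 0" "H = solutions {b}" by blast
  have "ocons (to_real (to_trop (b None))) (rvec (tvec (\<lambda>i. b (Some i)))) = b"
    by (auto simp: fun_eq_iff ocons_def split: option.split)
  then have "H = closed_halfspace (to_trop (b None)) (tvec (\<lambda>i. b (Some i)))"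
    using closed_halfspace_eq[of "to_trop (b None)" "tvec (\<lambda>i. b (Some i))"] b(2) by simp
  moreover have "tvec (\<lambda>i. b (Some i)) \<noteq> 0"
    using b(1) by (auto simp: vec_eq_iff tvec_def to_trop_def zero_sym_trop_def)
  ultimately show "is_closed_halfspace H" unfolding is_closed_halfspace_def
    by (intro bexI[of _ "to_trop (b None)"] bexI[of _ "tvec (\<lambda>i. b (Some i))"] conjI to_trop_signed tvec_signed)
qed

lemma solutions_Union: "signed_space \<inter> (\<Inter>i\<in>I. solutions (A i)) = solutions (\<Union>i\<in>I. A i)"
  by (auto simp: solutions_def)

lemma tnonneg_constant:
  assumes "\<And>i. b (Some i) = 0"
  shows "tnonneg b (ocons 1 x) \<longleftrightarrow> 0 \<le> b None"
proof
  assume "tnonneg b (ocons 1 x)"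
  then obtain k where "\<bar>b None * ocons 1 x None\<bar> \<le> b k * ocons 1 x k" unfolding tnonneg_def by blast
  then show "0 \<le> b None" using assms by (cases k) auto
next
  assume b: "0 \<le> b None"
  have "\<bar>b k * ocons 1 x k\<bar> \<le> b None * ocons 1 x None" for k using assms b by (cases k) simp_all
  then show "tnonneg b (ocons 1 x)" unfolding tnonneg_def by blast
qed

lemma finite_intersection_iff:
  fixes X :: "(sym_trop ^ 'n::finite) set"
  shows "(\<exists>F. finite F \<and> (\<forall>H\<in>F. is_closed_halfspace H) \<and> X = signed_space \<inter> \<Inter>F) \<longleftrightarrow>
    (\<exists>A. finite A \<and> X = solutions A)"
proof
  assume "\<exists>F. finite F \<and> (\<forall>H\<in>F. is_closed_halfspace H) \<and> X = signed_space \<inter> \<Inter>F"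
  then obtain F where F: "finite F" "\<And>H. H \<in> F \<Longrightarrow> is_closed_halfspace H" "X = signed_space \<inter> \<Inter>F" by blast
  then have "\<forall>H\<in>F. \<exists>b. H = solutions {b}" unfolding is_closed_halfspace_iff by blast
  then obtain b where b: "\<And>H. H \<in> F \<Longrightarrow> H = solutions {b H}" by metis
  have "(\<lambda>H. solutions {b H}) ` F = (\<lambda>H. H) ` F" by (rule image_cong[OF refl]) (rule b[symmetric])
  then have "X = signed_space \<inter> (\<Inter>H\<in>F. solutions {b H})" using F(3) by simp
  then have "X = solutions (b ` F)" unfolding solutions_Union UNION_singleton_eq_range .
  then show "\<exists>A. finite A \<and> X = solutions A" using F(1) by blast
next
  assume "\<exists>A. finite A \<and> X = solutions A"
  then obtain A where A: "finite A" "X = solutions A" by blast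
  show "\<exists>F. finite F \<and> (\<forall>H\<in>F. is_closed_halfspace H) \<and> X = signed_space \<inter> \<Inter>F"
  proof (cases "\<exists>b\<in>A. (\<forall>i. b (Some i) = 0) \<and> b None < 0")
    case True
    then obtain b where "b \<in> A" "\<And>i. b (Some i) = 0" "b None < 0" by blast
    then have "X = {}" unfolding A(2) solutions_def using tnonneg_constant[of b] by fastforce
    \<comment> \<open>The empty set is cut out by two opposite halfspaces in an arbitrary
      coordinate, whose inequalities read \<open>1 \<le> p i\<close> and
      \<open>1 \<le> - p i\<close>.\<close>
    define i :: 'n where "i = undefined"
    let ?b = "\<lambda>c::real. two_term (- 1) i c"
    have "solutions {?b 1} \<inter> solutions {?b (- 1)} = {}"
    proof -
      have *: "1 \<le> c * p i" if c: "tnonneg (?b c) (ocons 1 p)" for c p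
      proof -
        obtain k where k: "\<bar>?b c None * ocons 1 p None\<bar> \<le> ?b c k * ocons 1 p k" using c unfolding tnonneg_def by blast
        then show ?thesis by (cases k) (auto simp: two_term_def split: if_splits)
      qed
      show ?thesis using *[of 1] *[of "- 1"] by (fastforce simp: solutions_def)
    qed
    moreover have "is_closed_halfspace (solutions {?b 1})" "is_closed_halfspace (solutions {?b (- 1)})"
      unfolding is_closed_halfspace_iff by (rule exI[of _ "?b 1"], auto simp: two_term_def)
        (rule exI[of _ "?b (- 1)"], auto simp: two_term_def)
    ultimately show ?thesis using \<open>X = {}\<close> by (intro exI[of _ "{solutions {?b 1}, solutions {?b (- 1)}}"]) auto
  next
    case False
    define B where "B = {b \<in> A. \<exists>i. b (Some i) \<noteq> 0}"
    have "tnonneg b (ocons 1 p)" if "b \<in> A" "b \<notin> B" for b p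
      using that False tnonneg_constant[of b p] unfolding B_def by force
    then have "solutions A = solutions B" unfolding solutions_def B_def by blast
    also have "\<dots> = signed_space \<inter> (\<Inter>b\<in>B. solutions {b})" unfolding solutions_Union by simp
    finally have "X = signed_space \<inter> \<Inter>((\<lambda>b. solutions {b}) ` B)" using A(2) by simp
    moreover have "\<forall>H\<in>(\<lambda>b. solutions {b}) ` B. is_closed_halfspace H"
      unfolding is_closed_halfspace_iff B_def by blast
    moreover have "finite ((\<lambda>b. solutions {b}) ` B)" using A(1) by (simp add: B_def)
    ultimately show ?thesis by blast
  qed
qed

lemma rvec_sval_vec: "rvec (sval_vec y) = (\<lambda>i. rval (y $ i))"
  by (simp add: rvec_def sval_vec_def)

lemma sval_vec_image:
  fixes D :: "('n::finite option \<Rightarrow> puiseux) set"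
  shows "sval_vec ` {y. \<forall>g\<in>D. 0 \<le> dot g (ocons 1 (\<lambda>i. y $ i))} =
    {x \<in> signed_space. \<exists>y. (\<forall>g\<in>D. 0 \<le> dot g (ocons 1 y)) \<and> (\<forall>i. rval (y i) = rvec x i)}" (is "?L = ?R")
proof (intro equalityI subsetI)
  fix x assume "x \<in> ?L"
  then obtain y where y: "x = sval_vec y" "\<forall>g\<in>D. 0 \<le> dot g (ocons 1 (\<lambda>i. y $ i))" by blast
  then have "x \<in> signed_space" by (simp add: signed_space_def sval_vec_def)
  then show "x \<in> ?R" using y by (auto simp: rvec_sval_vec)
next
  fix x assume "x \<in> ?R"
  then obtain y where x: "x \<in> signed_space" and y: "\<forall>g\<in>D. 0 \<le> dot g (ocons 1 y)" "\<And>i. rval (y i) = rvec x i"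
    by blast
  have "sval_vec (\<chi> i. y i) \<in> signed_space" by (simp add: signed_space_def sval_vec_def)
  then have "sval_vec (\<chi> i. y i) = tvec (rvec (sval_vec (\<chi> i. y i)))" by (simp only: tvec_rvec)
  also have "rvec (sval_vec (\<chi> i. y i)) = rvec x" by (simp add: rvec_sval_vec y(2))
  finally have "x = sval_vec (\<chi> i. y i)" using tvec_rvec[OF x] by simp
  moreover have "($) (\<chi> i. y i) = y" by (rule ext) simp
  ultimately show "x \<in> ?L" using y(1) by (intro image_eqI[of _ _ "\<chi> i. y i"]) simp_all
qed

lemma affine_halfspace_eq:
  "{y. a0 + (\<Sum>i\<in>UNIV. a $ i * y $ i) \<ge> 0} = {y. 0 \<le> dot (ocons a0 (\<lambda>i. a $ i)) (ocons 1 (\<lambda>i. y $ i))}"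
  by (simp add: dot_option)

lemma polyhedron_solutions:
  fixes P :: "(puiseux ^ 'n::finite) set"
  assumes "is_polyhedron P"
  shows "\<exists>A. finite A \<and> sval_vec ` P = solutions A"
proof -
  obtain F where F: "finite F" "\<And>H. H \<in> F \<Longrightarrow> is_affine_halfspace H" "P = \<Inter>F"
    using assms unfolding is_polyhedron_def by blast
  have "\<exists>g. H = {y. 0 \<le> dot g (ocons 1 (\<lambda>i. y $ i))}" if H: "H \<in> F" for H
  proof -
    obtain a0 a where "H = {y. a0 + (\<Sum>i\<in>UNIV. a $ i * y $ i) \<ge> 0}"
      using F(2)[OF H] unfolding is_affine_halfspace_def by blast
    then show ?thesis unfolding affine_halfspace_eq by (intro exI[of _ "ocons a0 (($) a)"])
  qed
  then have "\<forall>H\<in>F. \<exists>g. H = {y. 0 \<le> dot g (ocons 1 (\<lambda>i. y $ i))}" by blast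
  from bchoice[OF this] obtain g where g: "\<forall>H\<in>F. H = {y. 0 \<le> dot (g H) (ocons 1 (\<lambda>i. y $ i))}" ..
  have g_mem: "y \<in> H \<longleftrightarrow> 0 \<le> dot (g H) (ocons 1 (\<lambda>i. y $ i))" if H: "H \<in> F" for y H
    using arg_cong[of _ _ "\<lambda>S. y \<in> S", OF bspec[OF g H]] unfolding mem_Collect_eq .
  have P: "P = {y. \<forall>f\<in>g ` F. 0 \<le> dot f (ocons 1 (\<lambda>i. y $ i))}"
    unfolding F(3) ball_simps using g_mem by (intro set_eqI) simp
  obtain E where E: "finite E"
    "\<forall>x. (\<exists>y. (\<forall>f\<in>g ` F. 0 \<le> dot f (ocons 1 y)) \<and> (\<forall>i. rval (y i) = x i)) \<longleftrightarrow>
      (\<forall>f\<in>E. tnonneg (\<lambda>k. rval (f k)) (ocons 1 x))"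
    using rval_polyhedron[OF finite_imageI[OF F(1), of g]] by (elim exE conjE)
  have "sval_vec ` P = solutions ((\<lambda>f k. rval (f k)) ` E)"
    unfolding P sval_vec_image E(2)[rule_format] solutions_def by simp
  then show ?thesis using E(1) by blast
qed

text \<open>By \<open>rval_halfspace\<close> the image depends only on the valuations of the
  coefficients, so lifting each coefficient to a monomial is enough.\<close>

lemma halfspace_lift:
  fixes H :: "(sym_trop ^ 'n::finite) set"
  assumes "is_closed_halfspace H"
  shows "\<exists>H'. is_affine_halfspace H' \<and> sval_vec ` H' = H"
proof -
  obtain b i where b: "b (Some i) \<noteq> 0" "H = solutions {b}" using assms unfolding is_closed_halfspace_iff by blast
  define g where "g = (\<lambda>k. rlift (b k))"
  have "g (Some i) \<noteq> 0" using b(1) rval_rlift[of "b (Some i)"] by (auto simp: g_def)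
  then have "(\<chi> i. g (Some i)) \<noteq> 0" by (auto simp: vec_eq_iff)
  moreover have "ocons (g None) (\<lambda>i. (\<chi> i. g (Some i)) $ i) = g"
    by (auto simp: fun_eq_iff ocons_def split: option.split)
  ultimately have "is_affine_halfspace {y. 0 \<le> dot g (ocons 1 (\<lambda>i. y $ i))}"
    unfolding is_affine_halfspace_def affine_halfspace_eq by metis
  moreover have "sval_vec ` {y. \<forall>f\<in>{g}. 0 \<le> dot f (ocons 1 (\<lambda>i. y $ i))} = H"
    unfolding sval_vec_image b(2) solutions_def using rval_halfspace[of g] by (simp add: g_def rval_rlift)
  ultimately show ?thesis by auto
qed

lemma polyhedra_iff:
  fixes X :: "(sym_trop ^ 'n::finite) set"
  shows "(\<exists>A. finite A \<and> X = solutions A) \<longleftrightarrow>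
      (\<exists>F :: (puiseux ^ 'n) set set. finite F \<and> (\<forall>P\<in>F. is_polyhedron P) \<and>
        signed_space \<inter> (\<Inter>P\<in>F. sval_vec ` P) = X)" (is "?i \<longleftrightarrow> ?iii")
    and "(\<exists>A. finite A \<and> X = solutions A) \<longleftrightarrow>
      (\<exists>F :: (puiseux ^ 'n) set set. finite F \<and> (\<forall>H\<in>F. is_affine_halfspace H) \<and>
        signed_space \<inter> (\<Inter>H\<in>F. sval_vec ` H) = X)" (is "_ \<longleftrightarrow> ?iv")
proof -
  have i_iv: "?iv" if i: ?i
  proof -
    obtain F where F: "finite F" "\<And>H. H \<in> F \<Longrightarrow> is_closed_halfspace H" "X = signed_space \<inter> \<Inter>F"
      using i unfolding finite_intersection_iff[symmetric] by blast
    obtain L where L: "\<And>H. H \<in> F \<Longrightarrow> is_affine_halfspace (L H) \<and> sval_vec ` (L H) = H"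
      using halfspace_lift[OF F(2)] by metis
    show ?thesis
    proof (intro exI[of _ "L ` F"] conjI ballI)
      show "signed_space \<inter> (\<Inter>H\<in>L ` F. sval_vec ` H) = X"
        unfolding F(3) image_image using L by auto
    qed (use F(1) L in auto)
  qed
  have iv_iii: "?iii" if iv: ?iv
  proof -
    have "is_polyhedron H" if "is_affine_halfspace H" for H :: "(puiseux ^ 'n) set"
      unfolding is_polyhedron_def by (rule exI[of _ "{H}"]) (use that in simp)
    then show ?thesis using iv by blast
  qed
  have iii_i: "?i" if iii: ?iii
  proof -
    obtain F :: "(puiseux ^ 'n) set set" where F: "finite F" "\<And>P. P \<in> F \<Longrightarrow> is_polyhedron P"
      "signed_space \<inter> (\<Inter>P\<in>F. sval_vec ` P) = X" using iii by blast
    obtain A where A: "\<And>P. P \<in> F \<Longrightarrow> finite (A P) \<and> sval_vec ` P = solutions (A P)"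
      using polyhedron_solutions[OF F(2)] by metis
    have "X = solutions (\<Union>P\<in>F. A P)" unfolding F(3)[symmetric] solutions_Union[symmetric] using A by auto
    moreover have "finite (\<Union>P\<in>F. A P)" by (rule finite_UN_I[OF F(1)]) (use A in simp)
    ultimately show ?thesis by (intro exI conjI)
  qed
  show "?i \<longleftrightarrow> ?iii" by (rule iffI[OF iv_iii[OF i_iv] iii_i])
  show "?i \<longleftrightarrow> ?iv" by (rule iffI[OF i_iv iii_i[OF iv_iii]])
qed

section \<open>TC-convex hulls\<close>

definition homog :: "sym_trop ^ 'n \<Rightarrow> 'n option \<Rightarrow> real" where
  "homog x = ocons 1 (rvec x)"

text \<open>Rows with zero linear part do not define halfspaces, but their validity is the same at
  all points. Admitting them makes the segment a bipolar of two homogenised vectors.\<close>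

lemma tc_segment_iff:
  fixes x y z :: "sym_trop ^ 'n::finite"
  assumes "x \<in> signed_space" "y \<in> signed_space"
  shows "z \<in> tc_segment x y \<longleftrightarrow> z \<in> signed_space \<and> (\<forall>b. tnonneg b (homog x) \<longrightarrow> tnonneg b (homog y) \<longrightarrow> tnonneg b (homog z))"
proof
  assume z: "z \<in> tc_segment x y"
  then have zs: "z \<in> signed_space" by (simp add: tc_segment_def)
  have "tnonneg b (homog z)" if b: "tnonneg b (homog x)" "tnonneg b (homog y)" for b
  proof (cases "\<forall>i. b (Some i) = 0")
    case True
    then show ?thesis using b(1) tnonneg_constant[of b] unfolding homog_def by blast
  next
    case False
    then have "is_closed_halfspace (solutions {b})" unfolding is_closed_halfspace_iff by blast
    moreover have "x \<in> solutions {b}" "y \<in> solutions {b}" using assms b by (simp_all add: solutions_def homog_def)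
    ultimately have "z \<in> solutions {b}" using z unfolding tc_segment_def by blast
    then show ?thesis by (simp add: solutions_def homog_def)
  qed
  then show "z \<in> signed_space \<and> (\<forall>b. tnonneg b (homog x) \<longrightarrow> tnonneg b (homog y) \<longrightarrow> tnonneg b (homog z))" using zs by blast
next
  assume z: "z \<in> signed_space \<and> (\<forall>b. tnonneg b (homog x) \<longrightarrow> tnonneg b (homog y) \<longrightarrow> tnonneg b (homog z))"
  have "z \<in> H" if H: "is_closed_halfspace H" "x \<in> H" "y \<in> H" for H
  proof -
    obtain b where b: "H = solutions {b}" using H(1) unfolding is_closed_halfspace_iff by blast
    then show ?thesis using H(2,3) z by (simp add: solutions_def homog_def)
  qed
  then show "z \<in> tc_segment x y" using z unfolding tc_segment_def by blast
qed

lemma tc_convex_solutions: "tc_convex (solutions A)"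
  unfolding tc_convex_def
proof (intro conjI ballI subsetI)
  fix x y z assume x: "x \<in> solutions A" "y \<in> solutions A" and z: "z \<in> tc_segment x y"
  have "x \<in> signed_space" "y \<in> signed_space" using x by (simp_all add: solutions_def)
  from z[unfolded tc_segment_iff[OF this]] show "z \<in> solutions A"
    using x by (simp add: solutions_def homog_def)
qed (simp add: solutions_def)

section \<open>Cones over sets of points\<close>

definition affine_part :: "('n option \<Rightarrow> real) \<Rightarrow> sym_trop ^ 'n" where
  "affine_part u = tvec (\<lambda>i. u (Some i) / u None)"

lemma affine_part_homog: "x \<in> signed_space \<Longrightarrow> c \<noteq> 0 \<Longrightarrow> affine_part (\<lambda>k. c * homog x k) = x"
  by (simp add: affine_part_def homog_def tvec_rvec)

lemma homog_affine_part: "u None \<noteq> 0 \<Longrightarrow> (\<lambda>k. u None * homog (affine_part u) k) = u"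
  by (auto simp: fun_eq_iff homog_def affine_part_def ocons_def split: option.split)

lemma affine_part_signed [simp]: "affine_part u \<in> signed_space"
  by (simp add: affine_part_def)

text \<open>Apart from the origin all members have a positive constant entry; directions at infinity
  are adjoined only in \<open>closure_cone\<close>.\<close>

definition cone_over :: "(sym_trop ^ 'n) set \<Rightarrow> ('n option \<Rightarrow> real) set" where
  "cone_over Y = {u. u = (\<lambda>_. 0) \<or> (0 < u None \<and> affine_part u \<in> Y)}"

lemma cone_iff: "0 < u None \<Longrightarrow> u \<in> cone_over Y \<longleftrightarrow> affine_part u \<in> Y"
  by (auto simp: cone_over_def)

lemma homog_in_cone: "x \<in> signed_space \<Longrightarrow> homog x \<in> cone_over Y \<longleftrightarrow> x \<in> Y"
  using cone_iff[of "homog x" Y] affine_part_homog[of x 1] by (simp add: homog_def)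

lemma cone_cases:
  assumes "u \<in> cone_over Y"
  obtains "u = (\<lambda>_. 0)" | "0 < u None" "affine_part u \<in> Y"
  using assms unfolding cone_over_def by blast

lemma tnonneg_affine_part: "0 < u None \<Longrightarrow> tnonneg b (homog (affine_part u)) \<longleftrightarrow> tnonneg b u"
  using tnonneg_scale_iff[of "u None" b "homog (affine_part u)"] homog_affine_part[of u] by simp

lemma tc_convex_memI:
  fixes Y :: "(sym_trop ^ 'n::finite) set"
  assumes Y: "tc_convex Y" and x: "0 < x None" "affine_part x \<in> Y" and y: "0 < y None" "affine_part y \<in> Y"
    and z: "0 < z None" "\<And>b. tnonneg b x \<Longrightarrow> tnonneg b y \<Longrightarrow> tnonneg b z"
  shows "affine_part z \<in> Y"
proof -
  have "affine_part z \<in> tc_segment (affine_part x) (affine_part y)"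
    unfolding tc_segment_iff[OF affine_part_signed affine_part_signed]
      tnonneg_affine_part[of x, OF x(1)] tnonneg_affine_part[of y, OF y(1)] tnonneg_affine_part[of z, OF z(1)]
    using z(2) by simp
  then show ?thesis using Y x(2) y(2) unfolding tc_convex_def by blast
qed

lemma lsum_zero: "lsum (\<lambda>_. 0) y = y" "lsum x (\<lambda>_. 0) = x"
  by (auto simp: lsum_def fun_eq_iff)

lemma lsum_None_pos: "0 < x k \<Longrightarrow> 0 \<le> y k \<Longrightarrow> 0 < lsum x y k" "0 \<le> x k \<Longrightarrow> 0 < y k \<Longrightarrow> 0 < lsum x y k"
  by (auto simp: lsum_def)

lemma opp_only_not_pos: "opp_only x y l \<Longrightarrow> 0 \<le> x k \<Longrightarrow> 0 \<le> y k \<Longrightarrow> l \<noteq> k"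
  unfolding opp_only_def by (metis le_minus_iff minus_zero antisym)

lemma tcone_cone:
  fixes Y :: "(sym_trop ^ 'n::finite) set"
  assumes Y: "tc_convex Y"
  shows "tcone (cone_over Y)"
  unfolding tcone_def
proof (intro conjI ballI allI impI)
  show "(\<lambda>_. 0) \<in> cone_over Y" by (simp add: cone_over_def)
next
  fix x and c :: real assume x: "x \<in> cone_over Y" and c: "0 < c"
  from x show "(\<lambda>k. c * x k) \<in> cone_over Y"
  proof (cases rule: cone_cases)
    case 2
    have "affine_part (\<lambda>k. c * x k) = affine_part x" using c by (simp add: affine_part_def)
    then show ?thesis using 2 c by (simp add: cone_over_def)
  qed (simp add: cone_over_def)
next
  fix x y assume x: "x \<in> cone_over Y" and y: "y \<in> cone_over Y"
  from x show "lsum x y \<in> cone_over Y"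
  proof (cases rule: cone_cases)
    case 1
    then show ?thesis using y by (simp add: lsum_zero)
  next
    case x': 2
    from y show ?thesis
    proof (cases rule: cone_cases)
      case 1
      then show ?thesis using x by (simp add: lsum_zero)
    next
      case y': 2
      have p: "0 < lsum x y None" by (rule lsum_None_pos) (use x' y' in simp_all)
      have "affine_part (lsum x y) \<in> Y" by (rule tc_convex_memI[OF Y x' y' p tnonneg_lsum])
      then show ?thesis using p by (simp add: cone_iff)
    qed
  qed
next
  fix x y l t assume x: "x \<in> cone_over Y" and y: "y \<in> cone_over Y" and o: "opp_only x y l" and t: "\<bar>t\<bar> \<le> \<bar>x l\<bar>"
  have nz: "x \<noteq> (\<lambda>_. 0)" "y \<noteq> (\<lambda>_. 0)" using o by (auto simp: opp_only_def)
  from x nz have x': "0 < x None" "affine_part x \<in> Y" by (auto elim: cone_cases)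
  from y nz have y': "0 < y None" "affine_part y \<in> Y" by (auto elim: cone_cases)
  have l: "l \<noteq> None" by (rule opp_only_not_pos[OF o]) (use x' y' in simp_all)
  have "0 < lsum x y None" by (rule lsum_None_pos) (use x' y' in simp_all)
  then have p: "0 < ((lsum x y)(l := t)) None" unfolding fun_upd_other[OF l[symmetric]] .
  have "affine_part ((lsum x y)(l := t)) \<in> Y"
    by (rule tc_convex_memI[OF Y x' y' p tnonneg_elim[OF _ _ o t]])
  then show "(lsum x y)(l := t) \<in> cone_over Y" using p by (simp only: cone_iff)
qed

text \<open>The direction from cones to convexity is separation from two points. It makes
  TC-convexity checkable by the rules of a cone, as needed in
  \<open>recession_generated\<close>.\<close>

lemma tc_convex_iff_tcone:
  fixes Y :: "(sym_trop ^ 'n::finite) set"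
  assumes Y: "Y \<subseteq> signed_space"
  shows "tc_convex Y \<longleftrightarrow> tcone (cone_over Y)"
proof
  assume K: "tcone (cone_over Y)"
  show "tc_convex Y"
    unfolding tc_convex_def
  proof (intro conjI ballI Y)
    fix x y assume x: "x \<in> Y" and y: "y \<in> Y"
    show "tc_segment x y \<subseteq> Y"
    proof
    fix z assume z: "z \<in> tc_segment x y"
    have s: "x \<in> signed_space" "y \<in> signed_space" using x y Y by blast+
    note z' = z[unfolded tc_segment_iff[OF s]]
    have "homog z \<in> cone_over Y"
    proof (rule ccontr)
      assume "homog z \<notin> cone_over Y"
      moreover have "{homog x, homog y} \<subseteq> cone_over Y" using x y s by (simp add: homog_in_cone)
      ultimately obtain a where "\<forall>f\<in>{homog x, homog y}. tnonneg a f" "\<not> tnonneg a (homog z)"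
        using tcone_separation[OF K, of "{homog x, homog y}" "homog z"] by auto
      then show False using z' by simp
    qed
    then show "z \<in> Y" using z' by (simp add: homog_in_cone)
    qed
  qed
qed (rule tcone_cone)

lemma tc_hull_least: "tc_convex S \<Longrightarrow> M \<subseteq> S \<Longrightarrow> tc_hull M \<subseteq> S"
  unfolding tc_hull_def by blast

lemma subset_tc_hull: "M \<subseteq> tc_hull M"
  unfolding tc_hull_def by blast

lemma signed_space_eq_solutions: "signed_space = solutions {}"
  by (simp add: solutions_def)

lemma tc_convex_tc_hull:
  fixes M :: "(sym_trop ^ 'n::finite) set"
  assumes "M \<subseteq> signed_space"
  shows "tc_convex (tc_hull M)"
  unfolding tc_convex_def
proof (intro conjI ballI)
  show "tc_hull M \<subseteq> signed_space"
    by (rule tc_hull_least[OF _ assms]) (simp add: signed_space_eq_solutions tc_convex_solutions)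
  show "tc_segment x y \<subseteq> tc_hull M" if "x \<in> tc_hull M" "y \<in> tc_hull M" for x y
    using that unfolding tc_hull_def tc_convex_def by blast
qed

section \<open>Recession directions\<close>

definition recession :: "('n option \<Rightarrow> real) set \<Rightarrow> ('n option \<Rightarrow> real) set" where
  "recession K = {u. u None = 0 \<and> (\<forall>x\<in>K. 0 < x None \<longrightarrow> lsum x u \<in> K)}"

text \<open>Points and directions become members of one tropical cone, so that they can be separated
  together from a further point. Its members with positive constant entry are those of
  \<open>K\<close>.\<close>

definition closure_cone :: "('n option \<Rightarrow> real) set \<Rightarrow> ('n option \<Rightarrow> real) set" where
  "closure_cone K = {x \<in> K. 0 < x None} \<union> recession K"

lemma recessionD: "u \<in> recession K \<Longrightarrow> u None = 0"
  "u \<in> recession K \<Longrightarrow> x \<in> K \<Longrightarrow> 0 < x None \<Longrightarrow> lsum x u \<in> K"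
  by (simp_all add: recession_def)

text \<open>In an elimination between a point and a direction, and in a left sum that starts with
  the direction, the direction is first replaced by its left sum with half the point in front, which
  is a point. The absorption laws remove the half copy from the result. Two directions are combined
  behind an arbitrary point \<open>z\<close>.\<close>

lemma tcone_closure_cone:
  fixes K :: "('n option \<Rightarrow> real) set"
  assumes K: "tcone K"
  shows "tcone (closure_cone K)"
proof -
  let ?P = "{x \<in> K. 0 < x None}"
  have scale: "(\<lambda>k. c * x k) \<in> ?P" if "x \<in> ?P" "0 < c" for x and c :: real
    using that tcone_scale[OF K] by simp
  have PR: "lsum x u \<in> ?P" if "x \<in> ?P" "u \<in> recession K" for x u
    using that recessionD[of u K] by (auto simp: lsum_def)
  have PP: "lsum x y \<in> ?P" if "x \<in> ?P" "y \<in> ?P" for x y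
    using that tcone_lsum[OF K] lsum_None_pos(1)[of x None y] by simp
  have elim_PR: "(lsum x y)(l := t) \<in> ?P" if x: "x \<in> ?P" and y: "y \<in> ?P \<union> recession K"
    and o: "opp_only x y l" and t: "\<bar>t\<bar> \<le> \<bar>x l\<bar>" for x y l t
  proof -
    let ?y = "lsum (\<lambda>k. (1/2) * x k) y"
    have y0: "0 \<le> y None" using y recessionD(1)[of y K] by auto
    have y': "?y \<in> ?P" using scale[OF x, of "1/2"] y PP PR by auto
    have o': "opp_only x ?y l" by (rule opp_only_absorb) (use o in \<open>auto simp: opp_only_def\<close>)
    have l: "l \<noteq> None" by (rule opp_only_not_pos[OF o]) (use x y0 in simp_all)
    have "0 < lsum x y None" by (rule lsum_None_pos) (use x y0 in simp_all)
    then have "0 < ((lsum x y)(l := t)) None" unfolding fun_upd_other[OF l[symmetric]] .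
    moreover have "(lsum x ?y)(l := t) \<in> K" by (rule tcone_elim[OF K _ _ o' t]) (use x y' in simp_all)
    then have "(lsum x y)(l := t) \<in> K" by (simp only: lsum_absorb2)
    ultimately show ?thesis by blast
  qed
  show ?thesis
    unfolding tcone_def
  proof (intro conjI ballI allI impI)
    show "(\<lambda>_. 0) \<in> closure_cone K" by (simp add: closure_cone_def recession_def lsum_zero)
  next
    fix x and c :: real assume x: "x \<in> closure_cone K" and c: "0 < c"
    show "(\<lambda>k. c * x k) \<in> closure_cone K"
    proof (cases "x \<in> ?P")
      case True
      then show ?thesis using scale c by (simp add: closure_cone_def)
    next
      case False
      then have x: "x \<in> recession K" using x unfolding closure_cone_def by blast
      have "lsum y (\<lambda>k. c * x k) \<in> K" if y: "y \<in> K" "0 < y None" for y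
      proof -
        have "(\<lambda>k. (1 / c) * y k) \<in> K" by (rule tcone_scale[OF K y(1)]) (use c in simp)
        then have "lsum (\<lambda>k. (1 / c) * y k) x \<in> K" by (rule recessionD(2)[OF x]) (use y c in simp)
        then have "(\<lambda>k. c * lsum (\<lambda>k. (1 / c) * y k) x k) \<in> K" by (rule tcone_scale[OF K _ c])
        then show ?thesis using lsum_scale[OF c, of "\<lambda>k. (1 / c) * y k" x] c by simp
      qed
      then show ?thesis using recessionD(1)[OF x] by (simp add: closure_cone_def recession_def)
    qed
  next
    fix x y assume "x \<in> closure_cone K" "y \<in> closure_cone K"
    then consider "x \<in> ?P" "y \<in> ?P" | "x \<in> ?P" "y \<in> recession K" | "x \<in> recession K" "y \<in> ?P"
      | "x \<in> recession K" "y \<in> recession K" unfolding closure_cone_def by blast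
    then show "lsum x y \<in> closure_cone K"
    proof cases
      case 1
      then show ?thesis using PP unfolding closure_cone_def by blast
    next
      case 2
      then show ?thesis using PR unfolding closure_cone_def by blast
    next
      case 3
      have "lsum (lsum (\<lambda>k. (1/2) * y k) x) y \<in> ?P"
        by (rule PP[OF PR[OF scale[OF 3(2)] 3(1)] 3(2)]) simp
      then have "lsum x y \<in> ?P" by (simp only: lsum_absorb)
      then show ?thesis unfolding closure_cone_def by blast
    next
      case 4
      have "lsum z (lsum x y) \<in> K" if z: "z \<in> K" "0 < z None" for z
        using PR[OF _ 4(2), of "lsum z x"] PR[OF _ 4(1), of z] z unfolding lsum_assoc by simp
      moreover have "lsum x y None = 0" using recessionD(1)[OF 4(1)] recessionD(1)[OF 4(2)] by (simp add: lsum_def)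
      ultimately show ?thesis by (simp add: closure_cone_def recession_def)
    qed
  next
    fix x y l t assume "x \<in> closure_cone K" "y \<in> closure_cone K" and o: "opp_only x y l" and t: "\<bar>t\<bar> \<le> \<bar>x l\<bar>"
    then consider "x \<in> ?P" "y \<in> ?P \<union> recession K" | "x \<in> recession K" "y \<in> ?P"
      | "x \<in> recession K" "y \<in> recession K" unfolding closure_cone_def by blast
    then show "(lsum x y)(l := t) \<in> closure_cone K"
    proof cases
      case 1
      then show ?thesis using elim_PR[OF 1 o t] unfolding closure_cone_def by blast
    next
      case 2
      have o': "opp_only y x l" using opp_only_commute[THEN iffD1, OF o] .
      have t': "\<bar>t\<bar> \<le> \<bar>y l\<bar>" using t o by (simp add: opp_only_def)
      have "(lsum y x)(l := t) \<in> ?P" by (rule elim_PR[OF 2(2) _ o' t']) (use 2 in blast)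
      then show ?thesis unfolding elim_commute[OF o] closure_cone_def by blast
    next
      case 3
      have xl: "x l \<noteq> 0" "y l = - x l" and op: "\<And>k. k \<noteq> l \<Longrightarrow> y k = - x k \<Longrightarrow> x k = 0"
        using o unfolding opp_only_def by blast+
      have "lsum z ((lsum x y)(l := t)) \<in> K" if z: "z \<in> K" "0 < z None" for z
      proof (rule lsum_elim_mem[OF K recessionD(2)[OF 3(1) z] recessionD(2)[OF 3(2) z] xl])
        show "lsum z ((lsum x y)(l := t)) k = lsum z (lsum x y) k" if "k \<noteq> l" for k
          by (rule lsum_cong) (use that in simp)
      qed (use op t in simp_all)
      moreover have l: "l \<noteq> None" using o recessionD(1)[OF 3(1)] unfolding opp_only_def by metis
      have "((lsum x y)(l := t)) None = 0"
        unfolding fun_upd_other[OF l[symmetric]] using recessionD(1)[OF 3(1)] recessionD(1)[OF 3(2)] by (simp add: lsum_def)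
      ultimately show ?thesis unfolding closure_cone_def recession_def by blast
    qed
  qed
qed

lemma small_scale:
  fixes x u :: "'i::finite \<Rightarrow> real"
  shows "\<exists>e>0. \<forall>d. 0 < d \<longrightarrow> d < e \<longrightarrow> (\<forall>k. u k \<noteq> 0 \<longrightarrow> \<bar>d * x k\<bar> < \<bar>u k\<bar>)"
proof -
  define e where "e = Min (insert 1 ((\<lambda>k. \<bar>u k\<bar> / (1 + \<bar>x k\<bar>)) ` {k. u k \<noteq> 0}))"
  have "0 < e" unfolding e_def by (subst Min_gr_iff) (auto intro!: divide_pos_pos add_pos_nonneg)
  moreover have "\<bar>d * x k\<bar> < \<bar>u k\<bar>" if d: "0 < d" "d < e" and k: "u k \<noteq> 0" for d k
  proof -
    have pos: "0 < 1 + \<bar>x k\<bar>" by (simp add: add_pos_nonneg)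
    have "e \<le> \<bar>u k\<bar> / (1 + \<bar>x k\<bar>)" unfolding e_def by (rule Min_le) (use k in auto)
    then have "d < \<bar>u k\<bar> / (1 + \<bar>x k\<bar>)" using d by linarith
    then have "d * (1 + \<bar>x k\<bar>) < \<bar>u k\<bar>" using pos by (simp only: pos_less_divide_eq)
    then have "d * \<bar>x k\<bar> < \<bar>u k\<bar>" using d(1) by (simp add: distrib_left)
    then show ?thesis using d(1) by (simp add: abs_mult)
  qed
  ultimately show ?thesis by blast
qed

text \<open>For small \<open>d\<close> this is \<open>lsum (d x) u\<close>; unlike the latter it commutes with the operations of a
  tropical cone for every \<open>d\<close>.\<close>

definition overlay :: "('i \<Rightarrow> real) \<Rightarrow> real \<Rightarrow> ('i \<Rightarrow> real) \<Rightarrow> 'i \<Rightarrow> real" where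
  "overlay u d x = (\<lambda>k. if u k \<noteq> 0 then u k else d * x k)"

lemma overlay_lsum:
  assumes "0 < d"
  shows "overlay u d (lsum x y) = lsum (overlay u d x) (overlay u d y)"
  using assms by (auto simp: overlay_def lsum_def fun_eq_iff abs_mult)

text \<open>If \<open>u l\<close> is nonzero, the overlay hides the cancellation and a left sum is
  enough. Otherwise it persists, scaled by \<open>d\<close>, and remains the only one, since entries
  of \<open>u\<close> occur in both overlays with the same sign.\<close>

lemma overlay_elim:
  assumes S: "tcone S" and d: "0 < d" and x: "overlay u d x \<in> S" and y: "overlay u d y \<in> S"
    and o: "opp_only x y l" and t: "\<bar>t\<bar> \<le> \<bar>x l\<bar>"
  shows "overlay u d ((lsum x y)(l := t)) \<in> S"
proof (cases "u l = 0")
  case False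
  have "overlay u d ((lsum x y)(l := t)) = overlay u d (lsum x y)"
    using False by (auto simp: overlay_def fun_eq_iff)
  then show ?thesis unfolding overlay_lsum[OF d] using tcone_lsum[OF S x y] by simp
next
  case True
  have xl: "y l = - x l" "x l \<noteq> 0" and op: "\<And>k. k \<noteq> l \<Longrightarrow> y k = - x k \<Longrightarrow> x k = 0"
    using o unfolding opp_only_def by blast+
  have "opp_only (overlay u d x) (overlay u d y) l"
    unfolding opp_only_def
  proof (intro conjI allI impI)
    fix k assume k: "k \<noteq> l" "overlay u d y k = - overlay u d x k"
    show "overlay u d x k = 0"
    proof (cases "u k = 0")
      case True
      then have "d * y k = d * (- x k)" using k by (simp add: overlay_def)
      then have "y k = - x k" using d by (simp only: mult_cancel_left) simp
      then show ?thesis using op[OF k(1)] True by (simp add: overlay_def)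
    qed (use k in \<open>simp add: overlay_def\<close>)
  qed (use True xl d in \<open>simp_all add: overlay_def\<close>)
  moreover have "\<bar>d * t\<bar> \<le> \<bar>overlay u d x l\<bar>" using t d True by (simp add: overlay_def abs_mult)
  ultimately have "(lsum (overlay u d x) (overlay u d y))(l := d * t) \<in> S" by (rule tcone_elim[OF S x y])
  moreover have "overlay u d ((lsum x y)(l := t)) = (lsum (overlay u d x) (overlay u d y))(l := d * t)"
    unfolding overlay_lsum[OF d, symmetric] using True by (auto simp: overlay_def fun_eq_iff)
  ultimately show ?thesis by simp
qed

text \<open>Up to scaling, the points that stay in \<open>K\<close> when moved arbitrarily far along
  \<open>u\<close>. The threshold \<open>e\<close> belongs to the single point, and a combination
  takes the smaller threshold.\<close>

definition overlay_cone :: "('n option \<Rightarrow> real) set \<Rightarrow> ('n option \<Rightarrow> real) \<Rightarrow> ('n option \<Rightarrow> real) set" where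
  "overlay_cone K u = {x. x = (\<lambda>_. 0) \<or>
     x \<in> K \<and> 0 < x None \<and> (\<exists>e>0. \<forall>d. 0 < d \<longrightarrow> d < e \<longrightarrow> overlay u d x \<in> K)}"

lemma overlay_cone_cases:
  assumes "x \<in> overlay_cone K u"
  obtains "x = (\<lambda>_. 0)" | e where "x \<in> K" "0 < x None" "e > 0" "\<And>d. 0 < d \<Longrightarrow> d < e \<Longrightarrow> overlay u d x \<in> K"
  using assms unfolding overlay_cone_def by blast

lemma overlay_coneI:
  assumes "x \<in> K" "0 < x None" "e > 0" "\<And>d. 0 < d \<Longrightarrow> d < e \<Longrightarrow> overlay u d x \<in> K"
  shows "x \<in> overlay_cone K u"
  using assms unfolding overlay_cone_def by blast

lemma tcone_overlay_cone:
  assumes K: "tcone K"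
  shows "tcone (overlay_cone K u)"
  unfolding tcone_def
proof (intro conjI ballI allI impI)
  show "(\<lambda>_. 0) \<in> overlay_cone K u" by (simp add: overlay_cone_def)
next
  fix x and c :: real assume x: "x \<in> overlay_cone K u" and c: "0 < c"
  from x show "(\<lambda>k. c * x k) \<in> overlay_cone K u"
  proof (cases rule: overlay_cone_cases)
    case (2 e)
    show ?thesis
    proof (rule overlay_coneI)
      show "(\<lambda>k. c * x k) \<in> K" by (rule tcone_scale[OF K 2(1) c])
      show "0 < e / c" "0 < c * x None" using 2 c by simp_all
      fix d assume d: "0 < d" "d < e / c"
      have "overlay u d (\<lambda>k. c * x k) = overlay u (d * c) x" by (auto simp: overlay_def fun_eq_iff)
      then show "overlay u d (\<lambda>k. c * x k) \<in> K" using 2(4)[of "d * c"] d c by (simp add: pos_less_divide_eq)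
    qed
  qed (simp add: overlay_cone_def)
next
  fix x y assume x: "x \<in> overlay_cone K u" and y: "y \<in> overlay_cone K u"
  from x show "lsum x y \<in> overlay_cone K u"
  proof (cases rule: overlay_cone_cases)
    case 1
    then show ?thesis using y by (simp add: lsum_zero)
  next
    case x': (2 e)
    from y show ?thesis
    proof (cases rule: overlay_cone_cases)
      case 1
      then show ?thesis using x by (simp add: lsum_zero)
    next
      case y': (2 e')
      show ?thesis
      proof (rule overlay_coneI)
        show "lsum x y \<in> K" by (rule tcone_lsum[OF K x'(1) y'(1)])
        show "0 < lsum x y None" by (rule lsum_None_pos) (use x' y' in simp_all)
        show "0 < min e e'" using x' y' by simp
        show "overlay u d (lsum x y) \<in> K" if "0 < d" "d < min e e'" for d
          unfolding overlay_lsum[OF that(1)] using tcone_lsum[OF K x'(4) y'(4)] that by simp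
      qed
    qed
  qed
next
  fix x y l t assume x: "x \<in> overlay_cone K u" and y: "y \<in> overlay_cone K u"
    and o: "opp_only x y l" and t: "\<bar>t\<bar> \<le> \<bar>x l\<bar>"
  have nz: "x \<noteq> (\<lambda>_. 0)" "y \<noteq> (\<lambda>_. 0)" using o by (auto simp: opp_only_def)
  from x nz obtain e where x': "x \<in> K" "0 < x None" "e > 0" "\<And>d. 0 < d \<Longrightarrow> d < e \<Longrightarrow> overlay u d x \<in> K"
    by (auto elim: overlay_cone_cases)
  from y nz obtain e' where y': "y \<in> K" "0 < y None" "e' > 0" "\<And>d. 0 < d \<Longrightarrow> d < e' \<Longrightarrow> overlay u d y \<in> K"
    by (auto elim: overlay_cone_cases)
  have l: "l \<noteq> None" by (rule opp_only_not_pos[OF o]) (use x' y' in simp_all)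
  show "(lsum x y)(l := t) \<in> overlay_cone K u"
  proof (rule overlay_coneI)
    show "(lsum x y)(l := t) \<in> K" by (rule tcone_elim[OF K x'(1) y'(1) o t])
    have "0 < lsum x y None" by (rule lsum_None_pos) (use x' y' in simp_all)
    then show "0 < ((lsum x y)(l := t)) None" unfolding fun_upd_other[OF l[symmetric]] .
    show "0 < min e e'" using x' y' by simp
    show "overlay u d ((lsum x y)(l := t)) \<in> K" if "0 < d" "d < min e e'" for d
      by (rule overlay_elim[OF K that(1) x'(4) y'(4) o t]) (use that in simp_all)
  qed
qed

text \<open>With \<open>d \<le> 1\<close> the entries that the overlay takes from \<open>x\<close>
  are absorbed by \<open>x\<close> itself, and only those of \<open>u\<close> remain.\<close>

lemma overlay_cone_lsum:
  assumes K: "tcone K" and x: "x \<in> overlay_cone K u" "0 < x None"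
  shows "lsum x u \<in> K"
  using x(1)
proof (cases rule: overlay_cone_cases)
  case 1
  then show ?thesis using x(2) by simp
next
  case (2 e)
  define d where "d = min (e / 2) 1"
  have d: "0 < d" "d < e" "d \<le> 1" using 2(3) by (simp_all add: d_def min_def)
  have "lsum x (overlay u d x) \<in> K" by (rule tcone_lsum[OF K 2(1) 2(4)[OF d(1,2)]])
  moreover have "lsum x (overlay u d x) k = lsum x u k" for k
  proof (cases "u k = 0")
    case True
    have "\<bar>d * x k\<bar> \<le> \<bar>x k\<bar>" using d by (simp add: abs_mult mult_left_le_one_le)
    then show ?thesis using True by (simp add: lsum_def overlay_def)
  qed (simp add: lsum_def overlay_def)
  then have "lsum x (overlay u d x) = lsum x u" by (rule ext)
  ultimately show ?thesis by simp
qed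

section \<open>Generation by points and directions\<close>

definition generated :: "(sym_trop ^ 'n) set \<Rightarrow> (sym_trop ^ 'n) set \<Rightarrow> (sym_trop ^ 'n) set" where
  "generated V W = {v \<lhd>\<^sub>v (l *s w) | v w l. v \<in> V \<and> w \<in> W \<and> l \<in> T_nonneg}"

lemma homog_left_sum:
  assumes "v \<in> signed_space" "w \<in> signed_space" "l \<in> T_nonneg"
  shows "v \<lhd>\<^sub>v (l *s w) \<in> signed_space"
    and "homog (v \<lhd>\<^sub>v (l *s w)) = lsum (homog v) (\<lambda>k. to_real l * ocons 0 (rvec w) k)"
proof -
  have s: "v $ i \<in> T_signed" "w $ i \<in> T_signed" "l * w $ i \<in> T_signed" "l \<in> T_signed" for i
    using assms by (simp_all add: signed_space_def T_nonneg_iff T_signed_mult)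
  show "v \<lhd>\<^sub>v (l *s w) \<in> signed_space"
    using s by (simp add: signed_space_def left_sum_vec_def vector_scalar_mult_def T_signed_left_sum)
  show "homog (v \<lhd>\<^sub>v (l *s w)) = lsum (homog v) (\<lambda>k. to_real l * ocons 0 (rvec w) k)"
  proof
    fix k
    show "homog (v \<lhd>\<^sub>v (l *s w)) k = lsum (homog v) (\<lambda>k. to_real l * ocons 0 (rvec w) k) k"
      using s by (cases k)
        (simp_all add: homog_def lsum_def rvec_def left_sum_vec_def vector_scalar_mult_def to_real_left_sum to_real_mult)
  qed
qed

lemma generated_signed: "V \<subseteq> signed_space \<Longrightarrow> W \<subseteq> signed_space \<Longrightarrow> generated V W \<subseteq> signed_space"
  unfolding generated_def using homog_left_sum(1) by blast

lemma overlay_cone_scale_iff: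
  assumes "tcone K" "0 < c"
  shows "(\<lambda>k. c * x k) \<in> overlay_cone K u \<longleftrightarrow> x \<in> overlay_cone K u"
proof
  assume "(\<lambda>k. c * x k) \<in> overlay_cone K u"
  from tcone_scale[OF tcone_overlay_cone[OF assms(1)] this, of "1 / c"] assms(2)
  show "x \<in> overlay_cone K u" by simp
qed (rule tcone_scale[OF tcone_overlay_cone[OF assms(1)] _ assms(2)])

text \<open>The hull is the least TC-convex set containing the generators, so the points that remain
  in the cone under the overlay with \<open>u\<close> are collected in \<open>Y\<close>, and
  \<open>Y\<close> is shown to be TC-convex and to contain the generators.\<close>

lemma recession_generated:
  fixes V W :: "(sym_trop ^ 'n::finite) set"
  assumes V: "V \<subseteq> signed_space" and W: "W \<subseteq> signed_space" and w: "w \<in> W"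
  shows "ocons 0 (rvec w) \<in> recession (cone_over (tc_hull (generated V W)))"
proof -
  define K where "K = cone_over (tc_hull (generated V W))"
  define u where "u = ocons 0 (rvec w)"
  have hull: "tc_convex (tc_hull (generated V W))" by (rule tc_convex_tc_hull[OF generated_signed[OF V W]])
  have K: "tcone K" unfolding K_def by (rule tcone_cone[OF hull])
  have genK: "homog p \<in> K" if p: "p \<in> generated V W" for p
    using that subset_tc_hull generated_signed[OF V W] homog_in_cone unfolding K_def by blast
  define Y where "Y = {p \<in> signed_space. homog p \<in> overlay_cone K u}"
  have Y_iff: "affine_part x \<in> Y \<longleftrightarrow> x \<in> overlay_cone K u" if x: "0 < x None" for x
  proof -
    have "x \<in> overlay_cone K u \<longleftrightarrow> (\<lambda>k. x None * homog (affine_part x) k) \<in> overlay_cone K u"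
      using homog_affine_part[of x] x by simp
    then show ?thesis unfolding overlay_cone_scale_iff[OF K x] by (simp add: Y_def)
  qed
  have "cone_over Y = overlay_cone K u"
  proof (intro set_eqI iffI)
    fix x assume "x \<in> cone_over Y"
    then show "x \<in> overlay_cone K u"
      by (cases rule: cone_cases) (simp_all add: Y_iff, simp add: overlay_cone_def)
  next
    fix x assume x: "x \<in> overlay_cone K u"
    then show "x \<in> cone_over Y"
    proof (cases rule: overlay_cone_cases)
      case (2 e)
      then show ?thesis using Y_iff[of x, OF 2(2)] x by (simp add: cone_iff)
    qed (simp add: cone_over_def)
  qed
  then have "tc_convex Y"
    using tcone_overlay_cone[OF K] by (subst tc_convex_iff_tcone) (auto simp: Y_def)
  moreover have "generated V W \<subseteq> Y"
  proof
    fix p assume p: "p \<in> generated V W"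
    then obtain v w' l where vw: "v \<in> V" "w' \<in> W" "l \<in> T_nonneg" "p = v \<lhd>\<^sub>v (l *s w')"
      unfolding generated_def by blast
    have vs: "v \<in> signed_space" "w' \<in> signed_space" "w \<in> signed_space" using vw V W w by blast+
    have hp: "homog p = lsum (homog v) (\<lambda>k. to_real l * ocons 0 (rvec w') k)"
      unfolding vw(4) by (rule homog_left_sum(2)[OF vs(1,2) vw(3)])
    obtain e where e: "e > 0" "\<And>d k. 0 < d \<Longrightarrow> d < e \<Longrightarrow> u k \<noteq> 0 \<Longrightarrow> \<bar>d * homog v k\<bar> < \<bar>u k\<bar>"
      using small_scale[of u "homog v"] by blast
    obtain e' where e': "e' > 0" "\<And>d k. 0 < d \<Longrightarrow> d < e' \<Longrightarrow> u k \<noteq> 0 \<Longrightarrow> \<bar>d * homog p k\<bar> < \<bar>u k\<bar>"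
      using small_scale[of u "homog p"] by blast
    have "homog p \<in> overlay_cone K u"
    proof (rule overlay_coneI[OF genK[OF p]])
      show "0 < homog p None" by (simp add: homog_def)
      show "0 < min e e'" using e e' by simp
      fix d assume d: "0 < d" "d < min e e'"
      \<comment> \<open>The generator formed with the multiplier \<open>1 / d\<close>, scaled by
        \<open>d\<close>, becomes the left sum of \<open>d\<close> times \<open>v\<close> and
        \<open>u\<close>; it brings in \<open>u\<close> at full size.\<close>
      have l: "to_trop (1 / d) \<in> T_nonneg" using d by (simp add: T_nonneg_iff)
      have "v \<lhd>\<^sub>v (to_trop (1 / d) *s w) \<in> generated V W" unfolding generated_def using vw(1) w l by blast
      then have "lsum (homog v) (\<lambda>k. (1 / d) * u k) \<in> K"
        using genK homog_left_sum(2)[OF vs(1,3) l] unfolding u_def by fastforce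
      then have "(\<lambda>k. d * lsum (homog v) (\<lambda>k. (1 / d) * u k) k) \<in> K" by (rule tcone_scale[OF K _ d(1)])
      then have g: "lsum (\<lambda>k. d * homog v k) u \<in> K"
        using lsum_scale[OF d(1), of "homog v" "\<lambda>k. (1 / d) * u k"] d(1) by simp
      have "lsum (lsum (\<lambda>k. d * homog v k) u) (\<lambda>k. d * homog p k) \<in> K"
        by (rule tcone_lsum[OF K g tcone_scale[OF K genK[OF p] d(1)]])
      moreover have "lsum (lsum (\<lambda>k. d * homog v k) u) (\<lambda>k. d * homog p k) k = overlay u d (homog p) k" for k
      proof (cases "u k = 0")
        case False
        have "\<bar>d * homog v k\<bar> < \<bar>u k\<bar>" "\<bar>d * homog p k\<bar> < \<bar>u k\<bar>" using e(2) e'(2) d False by auto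
        then have "lsum (\<lambda>k. d * homog v k) u k = u k" "\<bar>d * homog p k\<bar> \<le> \<bar>u k\<bar>" by (simp_all add: lsum_def)
        then show ?thesis using False by (simp add: lsum_def[of "lsum _ _"] overlay_def)
      next
        case True
        \<comment> \<open>As \<open>p\<close> is a left sum starting with \<open>v\<close>, it
          equals \<open>v\<close> or exceeds it in norm at each coordinate. Off the support of
          \<open>u\<close> the result is therefore the entry of \<open>d\<close> times
          \<open>p\<close>.\<close>
        have "\<bar>homog p k\<bar> \<le> \<bar>homog v k\<bar> \<longrightarrow> homog p k = homog v k" unfolding hp by (simp add: lsum_def)
        moreover have "lsum (\<lambda>k. d * homog v k) u k = d * homog v k" using True by (simp add: lsum_def)
        ultimately show ?thesis using True d(1)
          by (auto simp add: lsum_def[of "lsum _ _"] overlay_def abs_mult)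
      qed
      then have "lsum (lsum (\<lambda>k. d * homog v k) u) (\<lambda>k. d * homog p k) = overlay u d (homog p)" by (rule ext)
      ultimately show "overlay u d (homog p) \<in> K" by simp
    qed
    then show "p \<in> Y" using p generated_signed[OF V W] unfolding Y_def by blast
  qed
  ultimately have sub: "tc_hull (generated V W) \<subseteq> Y" by (rule tc_hull_least)
  have "lsum x u \<in> K" if x: "x \<in> K" "0 < x None" for x
  proof -
    have "affine_part x \<in> Y" using x sub cone_iff[of x, OF x(2)] unfolding K_def by blast
    then have "x \<in> overlay_cone K u" by (simp add: Y_iff x)
    then show ?thesis using overlay_cone_lsum[OF K] x by blast
  qed
  then show ?thesis unfolding recession_def K_def[symmetric] u_def by simp
qed

lemma generated_in_closure_cone:
  fixes V W :: "(sym_trop ^ 'n::finite) set"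
  assumes V: "V \<subseteq> signed_space" and W: "W \<subseteq> signed_space"
  shows "v \<in> V \<Longrightarrow> W \<noteq> {} \<Longrightarrow> homog v \<in> closure_cone (cone_over (tc_hull (generated V W)))"
    and "w \<in> W \<Longrightarrow> ocons 0 (rvec w) \<in> closure_cone (cone_over (tc_hull (generated V W)))"
    and "x \<in> closure_cone (cone_over (tc_hull (generated V W))) \<Longrightarrow> 0 < x None \<Longrightarrow> affine_part x \<in> tc_hull (generated V W)"
proof -
  assume v: "v \<in> V" and "W \<noteq> {}"
  then obtain w where w: "w \<in> W" by blast
  have vs: "v \<in> signed_space" "w \<in> signed_space" using v w V W by blast+
  \<comment> \<open>With multiplier zero the generator is \<open>v\<close> itself, but some
    \<open>w\<close> must be available to form it.\<close>
  have l: "to_trop 0 \<in> T_nonneg" by (simp add: T_nonneg_iff)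
  have "homog (v \<lhd>\<^sub>v (to_trop 0 *s w)) = homog v" unfolding homog_left_sum(2)[OF vs l] by (simp add: lsum_zero)
  then have "rvec (v \<lhd>\<^sub>v (to_trop 0 *s w)) = rvec v" unfolding homog_def fun_eq_iff by (metis ocons_simps(2))
  then have "v \<lhd>\<^sub>v (to_trop 0 *s w) = v" using tvec_rvec[OF vs(1)] tvec_rvec[OF homog_left_sum(1)[OF vs l]] by simp
  then have "v \<in> generated V W" unfolding generated_def using v w l by force
  then have "v \<in> tc_hull (generated V W)" using subset_tc_hull by blast
  then show "homog v \<in> closure_cone (cone_over (tc_hull (generated V W)))"
    using homog_in_cone[OF vs(1)] by (simp add: closure_cone_def homog_def)
next
  assume "w \<in> W"
  then show "ocons 0 (rvec w) \<in> closure_cone (cone_over (tc_hull (generated V W)))"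
    using recession_generated[OF V W] unfolding closure_cone_def by blast
next
  assume x: "x \<in> closure_cone (cone_over (tc_hull (generated V W)))" "0 < x None"
  then have "x \<in> cone_over (tc_hull (generated V W))" using recessionD(1)[of x] unfolding closure_cone_def by force
  then show "affine_part x \<in> tc_hull (generated V W)" using cone_iff[of x, OF x(2)] by blast
qed

lemma tnonneg_generated:
  assumes "v \<in> signed_space" "w \<in> signed_space" "l \<in> T_nonneg"
    and "tnonneg b (homog v)" "tnonneg b (ocons 0 (rvec w))"
  shows "tnonneg b (homog (v \<lhd>\<^sub>v (l *s w)))"
  unfolding homog_left_sum(2)[OF assms(1-3)]
  by (rule tnonneg_lsum[OF assms(4) tnonneg_scale[OF assms(5)]]) (use assms(3) in \<open>simp add: T_nonneg_iff\<close>)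

section \<open>Generators of a finite system and of its polar\<close>

definition sign_vec :: "('i \<Rightarrow> bool) \<Rightarrow> 'i \<Rightarrow> real" where
  "sign_vec \<sigma> k = (if \<sigma> k then 1 else - 1)"

lemma abs_sign_vec [simp]: "\<bar>sign_vec \<sigma> k\<bar> = 1"
  by (simp add: sign_vec_def)

lemma reflect_sign_vec_nonneg: "0 \<le> reflect (sign_vec (\<lambda>k. 0 \<le> x k)) x k"
  by (simp add: reflect_def sign_vec_def)

lemma max_eq_lsum:
  assumes "\<And>i. 0 \<le> x i" "\<And>i. 0 \<le> y i"
  shows "(\<lambda>i. max (x i) (y i)) = lsum x y"
  using assms by (auto simp: lsum_def max_def fun_eq_iff)

lemma mspan_subset_tcone:
  assumes S: "tcone S" and "x \<in> mspan G" and G: "\<forall>g\<in>G. \<forall>i. 0 \<le> g i" "G \<subseteq> S"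
  shows "x \<in> S"
  using assms(2)
proof (induction rule: mspan.induct)
  case zero
  show ?case by (rule tcone_zero[OF S])
next
  case (gen g c)
  then show ?case using tcone_scale[OF S, of g c] tcone_zero[OF S] G(2) by (cases "c = 0") auto
next
  case (max x y)
  have "(\<lambda>i. max (x i) (y i)) = lsum x y"
    by (rule max_eq_lsum) (use mspan_nonneg[OF max.hyps(1) G(1)] mspan_nonneg[OF max.hyps(2) G(1)] in simp_all)
  then show ?case using tcone_lsum[OF S max.IH] by simp
qed

text \<open>By the symmetry of \<open>tnonneg\<close>, the inequalities valid at a fixed point form
  a tropical cone. This lets \<open>polar_generation\<close> act on inequalities as well as on
  points.\<close>

lemma tcone_tnonneg: "tcone {a. tnonneg a x}"
  unfolding tcone_def tnonneg_commute[of _ x] mem_Collect_eq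
  by (intro conjI ballI allI impI) (simp_all add: tnonneg_lsum tnonneg_elim tnonneg_scale, simp add: tnonneg_def)

text \<open>The set of solutions is generated orthant by orthant, which is why the generators used for \<open>x\<close>
  may be taken with compatible signs.\<close>

theorem polar_generation:
  fixes A :: "('i::finite \<Rightarrow> real) set"
  assumes A: "finite A"
  shows "\<exists>H. finite H \<and> (\<forall>g\<in>H. \<forall>a\<in>A. tnonneg a g) \<and>
    (\<forall>x S. (\<forall>a\<in>A. tnonneg a x) \<longrightarrow> tcone S \<longrightarrow> {g \<in> H. \<forall>k. 0 < x k \<longrightarrow> 0 \<le> g k} \<subseteq> S \<longrightarrow> x \<in> S)"
proof -
  have "\<forall>\<sigma> :: 'i \<Rightarrow> bool. \<exists>G. finite G \<and> (\<forall>g\<in>G. \<forall>i. 0 \<le> g i) \<and>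
    (\<forall>x. x \<in> mspan G \<longleftrightarrow> (\<forall>i. 0 \<le> x i) \<and> (\<forall>a\<in>reflect (sign_vec \<sigma>) ` A. tnonneg a x))"
    by (intro allI mspan_finite_generation) (simp add: A)
  from choice[OF this] obtain G where G: "\<forall>\<sigma> :: 'i \<Rightarrow> bool. finite (G \<sigma>) \<and> (\<forall>g\<in>G \<sigma>. \<forall>i. 0 \<le> g i) \<and>
    (\<forall>x. x \<in> mspan (G \<sigma>) \<longleftrightarrow> (\<forall>i. 0 \<le> x i) \<and> (\<forall>a\<in>reflect (sign_vec \<sigma>) ` A. tnonneg a x))" ..
  note Gfin = G[rule_format, THEN conjunct1]
  note Gnn = G[rule_format, THEN conjunct2, THEN conjunct1]
  note Gspan = G[THEN spec, THEN conjunct2, THEN conjunct2, THEN spec]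
  have ff: "reflect (sign_vec \<sigma>) (reflect (sign_vec \<sigma>) x) = x" for \<sigma> :: "'i \<Rightarrow> bool" and x by (rule reflect_reflect) simp
  define H where "H = (\<Union>\<sigma>. reflect (sign_vec \<sigma>) ` G \<sigma>)"
  have "finite H" unfolding H_def using Gfin by simp
  moreover have "tnonneg a g" if g: "g \<in> H" and a: "a \<in> A" for a g
  proof -
    obtain \<sigma> f where f: "f \<in> G \<sigma>" "g = reflect (sign_vec \<sigma>) f" using g unfolding H_def by blast
    have "tnonneg (reflect (sign_vec \<sigma>) a) f" using Gspan[of f \<sigma>] mspan_base[OF f(1)] a by blast
    then show ?thesis unfolding f(2) tnonneg_reflect .
  qed
  moreover have "x \<in> S" if x: "\<forall>a\<in>A. tnonneg a x" and S: "tcone S"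
    and HS: "{g \<in> H. \<forall>k. 0 < x k \<longrightarrow> 0 \<le> g k} \<subseteq> S" for x S
  proof -
    \<comment> \<open>The orthant of \<open>x\<close>, with zero entries counted as nonnegative. Its
      generators are nonnegative wherever \<open>x\<close> is positive.\<close>
    define \<sigma> where "\<sigma> = (\<lambda>k. 0 \<le> x k)"
    have "\<forall>a\<in>reflect (sign_vec \<sigma>) ` A. tnonneg a (reflect (sign_vec \<sigma>) x)"
      using x by (auto simp: tnonneg_reflect ff)
    then have "reflect (sign_vec \<sigma>) x \<in> mspan (G \<sigma>)"
      using Gspan[of "reflect (sign_vec \<sigma>) x" \<sigma>] reflect_sign_vec_nonneg[of x] unfolding \<sigma>_def by blast
    moreover have "G \<sigma> \<subseteq> {y. reflect (sign_vec \<sigma>) y \<in> S}"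
    proof
      fix g assume g: "g \<in> G \<sigma>"
      then have "reflect (sign_vec \<sigma>) g \<in> H" unfolding H_def by blast
      moreover have "0 \<le> reflect (sign_vec \<sigma>) g k" if "0 < x k" for k
        using Gnn[of \<sigma>] g that by (simp add: reflect_def sign_vec_def \<sigma>_def)
      ultimately show "g \<in> {y. reflect (sign_vec \<sigma>) y \<in> S}" using HS by blast
    qed
    ultimately have "reflect (sign_vec \<sigma>) x \<in> {y. reflect (sign_vec \<sigma>) y \<in> S}"
      by (intro mspan_subset_tcone[OF tcone_reflect[OF abs_sign_vec S] _ Gnn])
    then show ?thesis by (simp add: ff)
  qed
  ultimately show ?thesis by blast
qed

text \<open>A bipolar argument. The rows \<open>A\<close> generate the polar of the generators. A
  row separating a solution \<open>z\<close> of \<open>A\<close> would belong to this polar; but the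
  rows valid at \<open>z\<close> form a tropical cone containing \<open>A\<close>, so the separating
  row would be valid at \<open>z\<close>.\<close>

theorem tc_hull_generated_solutions:
  fixes V W :: "(sym_trop ^ 'n::finite) set"
  assumes fin: "finite V" "finite W" and V: "V \<subseteq> signed_space" and W: "W \<subseteq> signed_space"
  shows "\<exists>A. finite A \<and> tc_hull (generated V W) = solutions A"
proof (cases "W = {}")
  \<comment> \<open>Without directions there are no generators, and the empty hull is cut out by an
    unsatisfiable inequality between constants.\<close>
  case True
  then have "generated V W = {}" by (simp add: generated_def)
  moreover have "tc_convex {}" by (simp add: tc_convex_def)
  ultimately have "tc_hull (generated V W) = {}" using tc_hull_least[of "{}" "generated V W"] by simp
  also have "{} = solutions {ocons (- 1) (\<lambda>_::'n. 0)}" by (auto simp: solutions_def tnonneg_constant)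
  finally show ?thesis by blast
next
  case W0: False
  define F where "F = homog ` V \<union> (\<lambda>w. ocons 0 (rvec w)) ` W"
  have F: "finite F" using fin by (simp add: F_def)
  from polar_generation[OF F] obtain A where A: "finite A" "\<forall>a\<in>A. \<forall>f\<in>F. tnonneg f a"
    "\<forall>a S. (\<forall>f\<in>F. tnonneg f a) \<longrightarrow> tcone S \<longrightarrow> {g \<in> A. \<forall>k. 0 < a k \<longrightarrow> 0 \<le> g k} \<subseteq> S \<longrightarrow> a \<in> S"
    by (elim exE conjE)
  have AF: "tnonneg a f" if "a \<in> A" "f \<in> F" for a f
    using A(2) that tnonneg_commute[of f a] by blast
  have "tc_hull (generated V W) \<subseteq> solutions A"
  proof (rule tc_hull_least[OF tc_convex_solutions], rule subsetI)
    fix p assume p: "p \<in> generated V W"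
    then obtain v w l where vw: "v \<in> V" "w \<in> W" "l \<in> T_nonneg" "p = v \<lhd>\<^sub>v (l *s w)"
      unfolding generated_def by blast
    have "tnonneg a (homog p)" if "a \<in> A" for a
      unfolding vw(4) by (rule tnonneg_generated) (use vw V W AF[OF that] in \<open>auto simp: F_def\<close>)
    moreover have "p \<in> signed_space" using p generated_signed[OF V W] by blast
    ultimately show "p \<in> solutions A" by (simp add: solutions_def homog_def)
  qed
  moreover have "solutions A \<subseteq> tc_hull (generated V W)"
  proof
    fix z assume z: "z \<in> solutions A"
    then have zs: "z \<in> signed_space" by (simp add: solutions_def)
    let ?S = "closure_cone (cone_over (tc_hull (generated V W)))"
    have S: "tcone ?S" by (intro tcone_closure_cone tcone_cone tc_convex_tc_hull generated_signed V W)
    have "homog z \<in> ?S"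
    proof (rule ccontr)
      assume nz: "homog z \<notin> ?S"
      have "F \<subseteq> ?S" unfolding F_def using generated_in_closure_cone(1,2)[OF V W] W0 by blast
      from tcone_separation[OF S F this nz] obtain a where a: "\<forall>f\<in>F. tnonneg a f" "\<not> tnonneg a (homog z)" by blast
      have "\<forall>f\<in>F. tnonneg f a" using a(1) tnonneg_commute[of a] by blast
      moreover have "A \<subseteq> {a. tnonneg a (homog z)}" using z by (auto simp: solutions_def homog_def)
      ultimately have "a \<in> {a. tnonneg a (homog z)}"
        using A(3)[THEN spec[of _ a], THEN spec[of _ "{a. tnonneg a (homog z)}"]] tcone_tnonneg by blast
      then show False using a(2) by blast
    qed
    then have "affine_part (homog z) \<in> tc_hull (generated V W)"
      by (rule generated_in_closure_cone(3)[OF V W]) (simp add: homog_def)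
    then show "z \<in> tc_hull (generated V W)" using affine_part_homog[OF zs, of 1] by simp
  qed
  ultimately show ?thesis using A(1) by blast
qed

theorem solutions_tc_hull_generated:
  fixes A :: "('n::finite option \<Rightarrow> real) set"
  assumes A: "finite A"
  shows "\<exists>V W. finite V \<and> finite W \<and> V \<subseteq> signed_space \<and> W \<subseteq> signed_space \<and> tc_hull (generated V W) = solutions A"
proof -
  from polar_generation[OF A] obtain H where H: "finite H" "\<forall>g\<in>H. \<forall>a\<in>A. tnonneg a g"
    "\<forall>x S. (\<forall>a\<in>A. tnonneg a x) \<longrightarrow> tcone S \<longrightarrow> {g \<in> H. \<forall>k. 0 < x k \<longrightarrow> 0 \<le> g k} \<subseteq> S \<longrightarrow> x \<in> S"
    by (elim exE conjE)
  define V :: "(sym_trop ^ 'n) set" where "V = affine_part ` {g \<in> H. 0 < g None}"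
  \<comment> \<open>The zero direction guarantees that \<open>W\<close> is nonempty, since otherwise
    no generator could be formed.\<close>
  define W :: "(sym_trop ^ 'n) set" where "W = insert (tvec (\<lambda>_. 0)) ((\<lambda>g. tvec (\<lambda>i. g (Some i))) ` {g \<in> H. g None = 0})"
  have VW: "finite V" "finite W" "V \<subseteq> signed_space" "W \<subseteq> signed_space" "W \<noteq> {}"
    using H(1) by (auto simp: V_def W_def)
  have hsV: "tnonneg a (homog v)" if "v \<in> V" "a \<in> A" for v a
    using that H(2) tnonneg_affine_part by (auto simp: V_def)
  have hom_tvec: "ocons 0 (rvec (tvec (\<lambda>i. g (Some i)))) = g" if "g None = 0" for g
    using that by (auto simp: fun_eq_iff ocons_def split: option.split)
  have hsW: "tnonneg a (ocons 0 (rvec w))" if w: "w \<in> W" "a \<in> A" for w a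
  proof (cases "w = tvec (\<lambda>_. 0)")
    case True
    have "ocons 0 (rvec w) k = 0" for k unfolding True by (cases k) simp_all
    then show ?thesis unfolding tnonneg_def by simp
  next
    case False
    then obtain g where g: "g \<in> H" "g None = 0" "w = tvec (\<lambda>i. g (Some i))" using w(1) unfolding W_def by blast
    show ?thesis unfolding g(3) hom_tvec[of g, OF g(2)] using H(2) g(1) w(2) by blast
  qed
  have "tc_hull (generated V W) \<subseteq> solutions A"
  proof (rule tc_hull_least[OF tc_convex_solutions], rule subsetI)
    fix p assume p: "p \<in> generated V W"
    then obtain v w l where vw: "v \<in> V" "w \<in> W" "l \<in> T_nonneg" "p = v \<lhd>\<^sub>v (l *s w)"
      unfolding generated_def by blast
    have "tnonneg a (homog p)" if "a \<in> A" for a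
      unfolding vw(4) by (rule tnonneg_generated) (use vw VW(3,4) hsV[OF vw(1) that] hsW[OF vw(2) that] in auto)
    moreover have "p \<in> signed_space" using p generated_signed[OF VW(3,4)] by blast
    ultimately show "p \<in> solutions A" by (simp add: solutions_def homog_def)
  qed
  moreover have "solutions A \<subseteq> tc_hull (generated V W)"
  proof
    fix p assume p: "p \<in> solutions A"
    then have ps: "p \<in> signed_space" by (simp add: solutions_def)
    let ?S = "closure_cone (cone_over (tc_hull (generated V W)))"
    have S: "tcone ?S" by (intro tcone_closure_cone tcone_cone tc_convex_tc_hull generated_signed VW)
    have HS: "g \<in> ?S" if g: "g \<in> H" and g0: "0 \<le> g None" for g
    proof (cases "g None = 0")
      case True
      then have "tvec (\<lambda>i. g (Some i)) \<in> W" unfolding W_def using g by blast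
      from generated_in_closure_cone(2)[OF VW(3,4) this] show ?thesis unfolding hom_tvec[of g, OF True] .
    next
      case False
      then have g0: "0 < g None" using g0 by simp
      then have "affine_part g \<in> V" unfolding V_def using g by blast
      from tcone_scale[OF S generated_in_closure_cone(1)[OF VW(3,4) this VW(5)] g0]
      show ?thesis using homog_affine_part[of g] g0 by simp
    qed
    have "\<forall>a\<in>A. tnonneg a (homog p)" using p by (simp add: solutions_def homog_def)
    \<comment> \<open>A generator with negative constant entry yields neither a point nor a
      direction. Compatibility with the constant entry 1 of \<open>homog p\<close> excludes
      it.\<close>
    moreover have "{g \<in> H. \<forall>k. 0 < homog p k \<longrightarrow> 0 \<le> g k} \<subseteq> ?S"
    proof
      fix g assume "g \<in> {g \<in> H. \<forall>k. 0 < homog p k \<longrightarrow> 0 \<le> g k}"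
      then have "g \<in> H" "0 < homog p None \<longrightarrow> 0 \<le> g None" by blast+
      then show "g \<in> ?S" by (intro HS) (simp_all add: homog_def)
    qed
    ultimately have "homog p \<in> ?S" using H(3)[THEN spec[of _ "homog p"], THEN spec[of _ ?S]] S by blast
    then have "affine_part (homog p) \<in> tc_hull (generated V W)"
      by (rule generated_in_closure_cone(3)[OF VW(3,4)]) (simp add: homog_def)
    then show "p \<in> tc_hull (generated V W)" using affine_part_homog[OF ps, of 1] by simp
  qed
  ultimately have "tc_hull (generated V W) = solutions A" by (rule antisym)
  then show ?thesis using VW by blast
qed

theorem theorem6p6:
  fixes X :: "(sym_trop ^ 'n) set"
  assumes "X \<subseteq> signed_space"
  shows
    "((\<exists>F. finite F \<and> (\<forall>H\<in>F. is_closed_halfspace H) \<and> X = signed_space \<inter> \<Inter>F) \<longleftrightarrow>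
      (\<exists>V W. finite V \<and> finite W \<and> V \<subseteq> signed_space \<and> W \<subseteq> signed_space \<and>
        tc_hull {v \<lhd>\<^sub>v (l *s w) | v w l. v \<in> V \<and> w \<in> W \<and> l \<in> T_nonneg} = X)) \<and>
     ((\<exists>F. finite F \<and> (\<forall>H\<in>F. is_closed_halfspace H) \<and> X = signed_space \<inter> \<Inter>F) \<longleftrightarrow>
      (\<exists>F :: (puiseux ^ 'n) set set. finite F \<and> (\<forall>P\<in>F. is_polyhedron P) \<and>
        signed_space \<inter> (\<Inter>P\<in>F. sval_vec ` P) = X)) \<and>
     ((\<exists>F. finite F \<and> (\<forall>H\<in>F. is_closed_halfspace H) \<and> X = signed_space \<inter> \<Inter>F) \<longleftrightarrow>
      (\<exists>F :: (puiseux ^ 'n) set set. finite F \<and> (\<forall>H\<in>F. is_affine_halfspace H) \<and>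
        signed_space \<inter> (\<Inter>H\<in>F. sval_vec ` H) = X))"
proof -
  have "(\<exists>A. finite A \<and> X = solutions A) \<longleftrightarrow> (\<exists>V W. finite V \<and> finite W \<and> V \<subseteq> signed_space \<and>
      W \<subseteq> signed_space \<and> tc_hull (generated V W) = X)" (is "?i \<longleftrightarrow> ?ii")
  proof
    assume ?i
    then obtain A where "finite A" "X = solutions A" by blast
    then show ?ii using solutions_tc_hull_generated[of A] by simp
  next
    assume ?ii
    then obtain V W where "finite V" "finite W" "V \<subseteq> signed_space" "W \<subseteq> signed_space" "X = tc_hull (generated V W)"
      by blast
    then show ?i using tc_hull_generated_solutions[of V W] by simp
  qed
  then show ?thesis
    unfolding finite_intersection_iff generated_def by (intro conjI polyhedra_iff)
qed

end
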